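(* Let $\mathcal{H}$ be the holomorphic rank 2 Pfaffian system on $SL(2,\mathbb{C})\times\mathbb{CP}^1$ generated, in homogeneous coordinates $[p,q]$ on $\mathbb{CP}^1$, by $$pq\,\alpha^2-q^2\alpha^1,\qquad pq\,\alpha^3+p^2\alpha^1,\qquad q^2\alpha^3+p^2\alpha^2,$$ let $\mathcal{E}$ be the real version of $\mathcal{H}$, and let $\Delta_{SU(2)}$ be the restriction to $SU(2)$ of the right diagonal action $\Delta((A,[p,q]);C)=(AC,[p,q]C)$ of $SL(2,\mathbb{C})$. Then, with the quotient of $SL(2,\mathbb{C})\times\mathbb{CP}^1$ by $\Delta_{SU(2)}$ represented by the map $\Pi_{\Delta_{SU(2)}}:SL(2,\mathbb{C})\times\mathbb{CP}^1\to\mathrm{H}^3\times\mathbb{CP}^1$ described in the context, $$\mathcal{E}/\Delta_{SU(2)}=\mathcal{M}_{CMC}.$$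
   Context: Maurer–Cartan forms: for $A=\begin{bmatrix} a & b \\ c & d \end{bmatrix}\in SL(2,\mathbb{C})$, holomorphic left-invariant 1-forms $\alpha^i$ are defined by $A^{-1}dA=\begin{bmatrix} \alpha^1 & \alpha^2 \\ \alpha^3 & -\alpha^1 \end{bmatrix}$ (and are pulled back to products without change of notation). An exterior differential system (EDS) is a graded ideal of differential forms closed under $d$. A (holomorphic) Pfaffian system is the EDS generated by the sections of a (holomorphic) subbundle of $T^*$ (resp. $T^*_{1,0}$) and their exterior derivatives. The real version of a holomorphic Pfaffian system is the real Pfaffian system generated by the real and imaginary parts of its 1-forms. If a Lie group $G$ acts by symmetries of an EDS $\mathcal{E}$ on $N$ with smooth quotient submersion $\pi:N\to N/G$, then $\mathcal{E}/G=\{\theta\in\Omega^*(N/G):\pi^*\theta\in\mathcal{E}\}$. Hyperbolic space: $\mathrm{H}^3=\{x\in\mathbb{R}^4:(x^0)^2-(x^1)^2-(x^2)^2-(x^3)^2=1,\ x^0>0\}$. Let $\mathsf{j}(x^0,x^1,x^2,x^3)=\begin{pmatrix} x^0+x^3 & x^1+\mathrm{i}x^2 \\ {x^1}-\mathrm{i}x^2 & x^0-x^3 \end{pmatrix}$, identifying $\mathbb{R}^4$ with Hermitian $2\times2$ matrices. Define $\Pi_{SU(2)}:SL(2,\mathbb{C})\to\mathrm{H}^3$, $\Pi_{SU(2)}(A)=\mathsf{j}^{-1}(AA^\dagger)$; $\Pi_{\mathbb{B}}:SL(2,\mathbb{C})\to\mathbb{CP}^1$, $\Pi_{\mathbb{B}}(A)=[a,c]$;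 and $\Pi_{S^1}=(\Pi_{SU(2)},\Pi_{\mathbb{B}}):SL(2,\mathbb{C})\to\mathrm{H}^3\times\mathbb{CP}^1$, which represents the quotient of $SL(2,\mathbb{C})$ by right multiplication by $S^1=\{\mathrm{diag}(e^{\mathrm{i}\theta},e^{-\mathrm{i}\theta})\}$. $\mathcal{B}$ is the real EDS on $SL(2,\mathbb{C})$ whose complexification is algebraically generated by $\alpha^1+\overline{\alpha^1}$, $\alpha^3\wedge(\alpha^2+\overline{\alpha^3})$ and $\overline{\alpha^3}\wedge(\overline{\alpha^2}+\alpha^3)$. $\mathcal{M}_{CMC}$ is the EDS on the 5-manifold $\mathrm{H}^3\times\mathbb{CP}^1$ obtained as the quotient of $\mathcal{B}$ by its Cauchy characteristics, i.e. $\mathcal{M}_{CMC}=\{\theta:\Pi_{S^1}^*\theta\in\mathcal{B}\}$; its integral surfaces (satisfying an independence condition) project to the constant mean curvature one surfaces in $\mathrm{H}^3$. Quotient map: $\Pi_{\Delta_{SU(2)}}(A,[p,q])=\big(\Pi_{SU(2)}(A),\ \iota([p,q]A^{-1})\big)$ with $\iota([p,q])=[q,-p]$. It is $\Delta_{SU(2)}$-invariant and induces a diffeomorphism $(SL(2,\mathbb{C})\times\mathbb{CP}^1)/\Delta_{SU(2)}\to\mathrm{H}^3\times\mathbb{CP}^1$. *)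

theory Defs
  imports "HOL-Analysis.Analysis"
begin

section \<open>Differential forms on embedded submanifolds\<close>

text \<open>
  Manifolds are submanifolds \<open>M\<close> of a Euclidean space \<open>'e\<close>. An inhomogeneous differential form
  maps a point and a list of tangent vectors to a scalar (real or complex); its component of degree
  \<open>k\<close> is the restriction to lists of length \<open>k\<close>. So that equality of forms is equality of
  functions, forms are zero at points outside \<open>M\<close> and on vectors that are not tangent to \<open>M\<close>.
\<close>

primrec ck_on :: "nat \<Rightarrow> 'e::euclidean_space set \<Rightarrow> ('e \<Rightarrow> 'b::real_normed_vector) \<Rightarrow> bool" where
  "ck_on 0 S = (\<lambda>f. continuous_on S f)"
| "ck_on (Suc n) S = (\<lambda>f. (\<forall>x\<in>S. f differentiable (at x)) \<and>
      (\<forall>v. ck_on n S (\<lambda>x. frechet_derivative f (at x) v)))"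

text \<open>Only used for open sets.\<close>
definition smooth_on :: "'e::euclidean_space set \<Rightarrow> ('e \<Rightarrow> 'b::real_normed_vector) \<Rightarrow> bool" where
  "smooth_on S f \<longleftrightarrow> (\<forall>n. ck_on n S f)"

definition tangent :: "'e::euclidean_space set \<Rightarrow> 'e \<Rightarrow> 'e set" where
  "tangent M x = {v. \<exists>c. (\<forall>t. c t \<in> M) \<and> c 0 = x \<and> (c has_vector_derivative v) (at 0)}"

type_synonym ('e, 'b) form = "'e \<Rightarrow> 'e list \<Rightarrow> 'b"

definition alternating_multilinear ::
  "'e::euclidean_space set \<Rightarrow> ('e list \<Rightarrow> 'b::real_normed_field) \<Rightarrow> bool" where
  "alternating_multilinear T \<phi> \<longleftrightarrow> (\<forall>vs. set vs \<subseteq> T \<longrightarrow>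
      (\<forall>i<length vs. \<forall>u\<in>T. \<forall>w\<in>T. \<forall>c d.
          \<phi> (vs[i := c *\<^sub>R u + d *\<^sub>R w]) = c *\<^sub>R \<phi> (vs[i := u]) + d *\<^sub>R \<phi> (vs[i := w])) \<and>
      (\<forall>i j. i < j \<longrightarrow> j < length vs \<longrightarrow> vs ! i = vs ! j \<longrightarrow> \<phi> vs = 0))"

definition local_extension ::
  "'e::euclidean_space set \<Rightarrow> ('e, 'b::real_normed_field) form \<Rightarrow> 'e \<Rightarrow> ('e, 'b) form \<Rightarrow> bool" where
  "local_extension M \<omega> x \<eta> \<longleftrightarrow> (\<exists>U. open U \<and> x \<in> U \<and>
      (\<forall>y\<in>U. alternating_multilinear UNIV (\<eta> y)) \<and>
      (\<forall>vs. smooth_on U (\<lambda>y. \<eta> y vs)) \<and>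
      (\<forall>y\<in>U \<inter> M. \<forall>vs. set vs \<subseteq> tangent M y \<longrightarrow> \<omega> y vs = \<eta> y vs))"

definition forms :: "'e::euclidean_space set \<Rightarrow> ('e, 'b::real_normed_field) form set" where
  "forms M = {\<omega>.
      (\<forall>x vs. x \<notin> M \<or> \<not> set vs \<subseteq> tangent M x \<longrightarrow> \<omega> x vs = 0) \<and>
      (\<forall>x\<in>M. alternating_multilinear (tangent M x) (\<omega> x)) \<and>
      (\<forall>x\<in>M. \<exists>\<eta>. local_extension M \<omega> x \<eta>)}"

definition homogeneous_part :: "nat \<Rightarrow> ('e, 'b::zero) form \<Rightarrow> ('e, 'b) form" where
  "homogeneous_part k \<omega> = (\<lambda>x vs. if length vs = k then \<omega> x vs else 0)"

definition form_plus :: "('e, 'b::plus) form \<Rightarrow> ('e, 'b) form \<Rightarrow> ('e, 'b) form" where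
  "form_plus \<omega> \<eta> = (\<lambda>x vs. \<omega> x vs + \<eta> x vs)"

definition form_cnj :: "('e, complex) form \<Rightarrow> ('e, complex) form" where
  "form_cnj \<omega> = (\<lambda>x vs. cnj (\<omega> x vs))"

text \<open>
  The wedge product is the signed sum over shuffles: \<open>S\<close> is the set of positions of the arguments
  passed to \<open>\<omega>\<close>, and the exponent counts the inversions of the shuffle.
\<close>
definition wedge :: "('e, 'b::real_normed_field) form \<Rightarrow> ('e, 'b) form \<Rightarrow> ('e, 'b) form" where
  "wedge \<omega> \<eta> = (\<lambda>x vs. \<Sum>S\<in>Pow {..<length vs}.
      (- 1) ^ card {(i, j). i < j \<and> i \<in> {..<length vs} - S \<and> j \<in> S} *
      \<omega> x (nths vs S) * \<eta> x (nths vs (- S)))"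

definition euclidean_d :: "('e::euclidean_space, 'b::real_normed_field) form \<Rightarrow> ('e, 'b) form" where
  "euclidean_d \<omega> = (\<lambda>x vs. \<Sum>i<length vs.
      (- 1) ^ i * frechet_derivative (\<lambda>y. \<omega> y (take i vs @ drop (Suc i) vs)) (at x) (vs ! i))"

text \<open>The value does not depend on the extension, since \<open>d\<close> commutes with restriction to \<open>M\<close>.\<close>
definition ext_d ::
  "'e::euclidean_space set \<Rightarrow> ('e, 'b::real_normed_field) form \<Rightarrow> ('e, 'b) form" where
  "ext_d M \<omega> = (\<lambda>x vs. if x \<in> M \<and> set vs \<subseteq> tangent M x
      then euclidean_d (SOME \<eta>. local_extension M \<omega> x \<eta>) x vs else 0)"

text \<open>
  A derivative of \<open>f\<close> at \<open>x\<close> within \<open>M\<close> is determined only on \<open>tangent M x\<close>, where it is the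
  differential of \<open>f\<close> along \<open>M\<close>.
\<close>
definition pullback ::
  "'e::euclidean_space set \<Rightarrow> ('e \<Rightarrow> 'f::euclidean_space) \<Rightarrow> ('f, 'b::real_normed_field) form
    \<Rightarrow> ('e, 'b) form" where
  "pullback M f \<omega> = (\<lambda>x vs. if x \<in> M \<and> set vs \<subseteq> tangent M x
      then \<omega> (f x) (map (frechet_derivative f (at x within M)) vs) else 0)"

definition one_form :: "'e::euclidean_space set \<Rightarrow> ('e \<Rightarrow> 'e \<Rightarrow> 'b::zero) \<Rightarrow> ('e, 'b) form" where
  "one_form M \<phi> = (\<lambda>x vs. if x \<in> M \<and> length vs = 1 \<and> set vs \<subseteq> tangent M x then \<phi> x (hd vs) else 0)"

section \<open>Exterior differential systems\<close>

definition graded_ideal :: "'e::euclidean_space set \<Rightarrow> ('e, 'b::real_normed_field) form set \<Rightarrow> bool" where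
  "graded_ideal M I \<longleftrightarrow> I \<subseteq> forms M \<and> (\<lambda>x vs. 0) \<in> I \<and>
      (\<forall>\<omega>\<in>I. \<forall>\<eta>\<in>I. form_plus \<omega> \<eta> \<in> I) \<and>
      (\<forall>\<omega>\<in>I. \<forall>\<eta>\<in>forms M. wedge \<eta> \<omega> \<in> I \<and> wedge \<omega> \<eta> \<in> I) \<and>
      (\<forall>\<omega>\<in>I. \<forall>k. homogeneous_part k \<omega> \<in> I)"

definition algebraic_ideal ::
  "'e::euclidean_space set \<Rightarrow> ('e, 'b::real_normed_field) form set \<Rightarrow> ('e, 'b) form set" where
  "algebraic_ideal M S = \<Inter>{I. graded_ideal M I \<and> S \<subseteq> I}"

definition is_EDS :: "'e::euclidean_space set \<Rightarrow> ('e, real) form set \<Rightarrow> bool" where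
  "is_EDS M I \<longleftrightarrow> graded_ideal M I \<and> (\<forall>\<omega>\<in>I. ext_d M \<omega> \<in> I)"

definition EDS_generated :: "'e::euclidean_space set \<Rightarrow> ('e, real) form set \<Rightarrow> ('e, real) form set" where
  "EDS_generated M S = \<Inter>{I. is_EDS M I \<and> S \<subseteq> I}"

text \<open>
  A subbundle of the cotangent bundle is given by its fibres; only the restrictions of the
  covectors in \<open>F x\<close> to \<open>tangent M x\<close> matter.
\<close>
definition bundle_sections ::
  "'e::euclidean_space set \<Rightarrow> ('e \<Rightarrow> ('e \<Rightarrow> real) set) \<Rightarrow> ('e, real) form set" where
  "bundle_sections M F = {\<omega>\<in>forms M. homogeneous_part 1 \<omega> = \<omega> \<and>
      (\<forall>x\<in>M. \<exists>\<phi>\<in>F x. \<forall>v\<in>tangent M x. \<omega> x [v] = \<phi> v)}"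

definition pfaffian_system ::
  "'e::euclidean_space set \<Rightarrow> ('e \<Rightarrow> ('e \<Rightarrow> real) set) \<Rightarrow> ('e, real) form set" where
  "pfaffian_system M F = EDS_generated M (bundle_sections M F)"

text \<open>
  The real span of the real and imaginary parts of the covectors in \<open>F x\<close>, for a complex subspace
  \<open>F x\<close>.
\<close>
definition real_bundle :: "('e \<Rightarrow> ('e \<Rightarrow> complex) set) \<Rightarrow> 'e \<Rightarrow> ('e \<Rightarrow> real) set" where
  "real_bundle F x = {(\<lambda>v. Re (\<phi> v) + Im (\<psi> v)) | \<phi> \<psi>. \<phi> \<in> F x \<and> \<psi> \<in> F x}"

definition real_version ::
  "'e::euclidean_space set \<Rightarrow> ('e \<Rightarrow> ('e \<Rightarrow> complex) set) \<Rightarrow> ('e, real) form set" where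
  "real_version M F = pfaffian_system M (real_bundle F)"

definition complexification :: "('e, real) form set \<Rightarrow> ('e, complex) form set" where
  "complexification I = {(\<lambda>x vs. Complex (\<omega> x vs) (\<eta> x vs)) | \<omega> \<eta>. \<omega> \<in> I \<and> \<eta> \<in> I}"

definition real_forms_in ::
  "'e::euclidean_space set \<Rightarrow> ('e, complex) form set \<Rightarrow> ('e, real) form set" where
  "real_forms_in M J = {\<omega>\<in>forms M. (\<lambda>x vs. complex_of_real (\<omega> x vs)) \<in> J}"

text \<open>A real ideal is recovered from its complexification.\<close>
lemma real_forms_in_complexification:
  assumes "graded_ideal M I"
  shows "real_forms_in M (complexification I) = I"
proof
  show "real_forms_in M (complexification I) \<subseteq> I"
  proof
    fix \<omega> assume "\<omega> \<in> real_forms_in M (complexification I)"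
    then obtain \<alpha> \<beta> where "\<alpha> \<in> I"
      and eq: "(\<lambda>x vs. complex_of_real (\<omega> x vs)) = (\<lambda>x vs. Complex (\<alpha> x vs) (\<beta> x vs))"
      by (auto simp: real_forms_in_def complexification_def)
    have "\<omega> = \<alpha>"
      using eq by (metis (no_types, opaque_lifting) Re_complex_of_real complex.sel(1) ext)
    with \<open>\<alpha> \<in> I\<close> show "\<omega> \<in> I" by simp
  qed
  show "I \<subseteq> real_forms_in M (complexification I)"
  proof
    fix \<omega> assume "\<omega> \<in> I"
    moreover have "(\<lambda>x vs. complex_of_real (\<omega> x vs)) \<in> complexification I"
      unfolding complexification_def complex_of_real_def mem_Collect_eq
      by (rule exI[of _ \<omega>], rule exI[of _ "\<lambda>x vs. 0"])
         (use assms \<open>\<omega> \<in> I\<close> in \<open>simp add: graded_ideal_def\<close>)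
    ultimately show "\<omega> \<in> real_forms_in M (complexification I)"
      using assms by (auto simp: real_forms_in_def graded_ideal_def)
  qed
qed

text \<open>
  The quotient of \<open>I\<close>, for a map \<open>\<pi>\<close> from \<open>M\<close> to \<open>N\<close> that represents the quotient of \<open>M\<close> by a
  group acting by symmetries.
\<close>
definition quotient_EDS ::
  "'e::euclidean_space set \<Rightarrow> ('e \<Rightarrow> 'f::euclidean_space) \<Rightarrow> 'f set \<Rightarrow> ('e, real) form set
    \<Rightarrow> ('f, real) form set" where
  "quotient_EDS M \<pi> N I = {\<theta>\<in>forms N. pullback M \<pi> \<theta> \<in> I}"

section \<open>The manifolds and maps\<close>

definition SL2C :: "(complex^2^2) set" where
  "SL2C = {A. det A = 1}"

definition dagger :: "complex^2^2 \<Rightarrow> complex^2^2" where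
  "dagger A = (\<chi> i j. cnj (A $ j $ i))"

definition SU2 :: "(complex^2^2) set" where
  "SU2 = {A\<in>SL2C. A ** dagger A = mat 1}"

text \<open>The indices 0, 1, 2, 3 are the four elements of the type \<open>4\<close>, where \<open>0 = 4\<close>.\<close>
definition H3 :: "(real^4) set" where
  "H3 = {x. (x $ 0)\<^sup>2 - (x $ 1)\<^sup>2 - (x $ 2)\<^sup>2 - (x $ 3)\<^sup>2 = 1 \<and> x $ 0 > 0}"

definition herm :: "real^4 \<Rightarrow> complex^2^2" where
  "herm x = vector [vector [complex_of_real (x $ 0 + x $ 3), Complex (x $ 1) (x $ 2)],
                    vector [Complex (x $ 1) (- x $ 2), complex_of_real (x $ 0 - x $ 3)]]"

text \<open>
  The complex projective line is embedded in the \<open>2 \<times> 2\<close> matrices by sending a line in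
  \<open>complex^2\<close> to the orthogonal projection onto it. The point with homogeneous coordinates \<open>p, q\<close>
  is \<open>hpoint (vector [p, q])\<close>.
\<close>
definition hpoint :: "complex^2 \<Rightarrow> complex^2^2" where
  "hpoint w = (\<chi> i j. w $ i * cnj (w $ j) / complex_of_real ((norm w)\<^sup>2))"

definition CP1 :: "(complex^2^2) set" where
  "CP1 = hpoint ` {w. w \<noteq> 0}"

text \<open>The map induced by \<open>F\<close> on homogeneous coordinates; it is used for injective linear \<open>F\<close>.\<close>
definition cp1_map :: "(complex^2 \<Rightarrow> complex^2) \<Rightarrow> complex^2^2 \<Rightarrow> complex^2^2" where
  "cp1_map F P = hpoint (F (SOME w. w \<noteq> 0 \<and> hpoint w = P))"

definition cp1_act :: "complex^2^2 \<Rightarrow> complex^2^2 \<Rightarrow> complex^2^2" where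
  "cp1_act P C = cp1_map (\<lambda>w. w v* C) P"

definition iota :: "complex^2^2 \<Rightarrow> complex^2^2" where
  "iota = cp1_map (\<lambda>w. vector [w $ 2, - (w $ 1)])"

lemma norm_sq_vec2: "complex_of_real ((norm w)\<^sup>2) = w $ 1 * cnj (w $ 1) + w $ 2 * cnj (w $ 2)"
  for w :: "complex^2"
proof -
  have "(norm w)\<^sup>2 = (norm (w $ 1))\<^sup>2 + (norm (w $ 2))\<^sup>2"
    by (simp add: norm_vec_def L2_set_def sum_2)
  then show ?thesis
    by (simp only: of_real_add complex_norm_square)
qed

lemma vec2_nonzero: "w \<noteq> 0 \<longleftrightarrow> w $ 1 \<noteq> 0 \<or> w $ 2 \<noteq> 0" for w :: "complex^2"
  by (auto simp: vec_eq_iff forall_2)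

lemma hpoint_scale:
  assumes "c \<noteq> 0"
  shows "hpoint (c *s w) = hpoint w"
proof (cases "w = 0")
  case False
  have "complex_of_real ((norm (c *s w))\<^sup>2) = c * cnj c * complex_of_real ((norm w)\<^sup>2)"
    by (simp only: norm_sq_vec2) (simp add: algebra_simps)
  with assms False show ?thesis
    by (simp add: hpoint_def vec_eq_iff)
qed simp

lemma hpoint_eq_iff:
  assumes "w \<noteq> 0" "z \<noteq> 0"
  shows "hpoint w = hpoint z \<longleftrightarrow> (\<exists>c. c \<noteq> 0 \<and> w = c *s z)"
proof
  assume eq: "hpoint w = hpoint z"
  let ?n = "\<lambda>w::complex^2. complex_of_real ((norm w)\<^sup>2)"
  obtain k where k: "z $ k \<noteq> 0"
    using assms(2) vec2_nonzero by blast
  have e: "w $ i * cnj (w $ j) / ?n w = z $ i * cnj (z $ j) / ?n z" for i j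
    using eq unfolding hpoint_def vec_eq_iff by simp
  have wk: "w $ k \<noteq> 0"
    using e[of k k] k assms by auto
  have ni: "?n w \<noteq> 0" "?n z \<noteq> 0"
    using assms by auto
  define c where "c = ?n w * cnj (z $ k) / (?n z * cnj (w $ k))"
  have "w $ i = c * z $ i" for i
  proof -
    have "w $ i * cnj (w $ k) * ?n z = z $ i * cnj (z $ k) * ?n w"
      using iffD1[OF frac_eq_eq[OF ni] e[of i k]] .
    then have "w $ i * (?n z * cnj (w $ k)) = ?n w * cnj (z $ k) * z $ i"
      by (simp only: mult_ac)
    then show ?thesis
      using ni wk unfolding c_def by (simp add: eq_divide_eq del: of_real_power)
  qed
  then have "w = c *s z"
    by (simp add: vec_eq_iff)
  moreover have "c \<noteq> 0"
    using ni k wk unfolding c_def by simp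
  ultimately show "\<exists>c. c \<noteq> 0 \<and> w = c *s z"
    by blast
qed (use hpoint_scale in auto)

lemma cp1_map_hpoint:
  assumes "w \<noteq> 0" and "\<And>c z. F (c *s z) = c *s F z"
  shows "cp1_map F (hpoint w) = hpoint (F w)"
proof -
  define z where "z = (SOME z. z \<noteq> 0 \<and> hpoint z = hpoint w)"
  have "z \<noteq> 0 \<and> hpoint z = hpoint w"
    unfolding z_def by (rule someI[of _ w]) (use assms in auto)
  then obtain c where "c \<noteq> 0" "z = c *s w"
    using hpoint_eq_iff assms(1) by blast
  then have "hpoint (F z) = hpoint (F w)"
    by (simp add: assms(2) hpoint_scale)
  then show ?thesis
    by (simp add: cp1_map_def z_def)
qed

lemma cp1_act_hpoint: "w \<noteq> 0 \<Longrightarrow> cp1_act (hpoint w) C = hpoint (w v* C)"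
  unfolding cp1_act_def
  by (rule cp1_map_hpoint)
     (auto simp: vector_matrix_mult_def vec_eq_iff sum_2 algebra_simps)

lemma iota_hpoint: "w \<noteq> 0 \<Longrightarrow> iota (hpoint w) = hpoint (vector [w $ 2, - (w $ 1)])"
  unfolding iota_def
  by (rule cp1_map_hpoint) (auto simp: vec_eq_iff forall_2 vector_2)

definition Delta :: "(complex^2^2) \<times> (complex^2^2) \<Rightarrow> complex^2^2 \<Rightarrow> (complex^2^2) \<times> (complex^2^2)" where
  "Delta = (\<lambda>(A, P) C. (A ** C, cp1_act P C))"

definition Pi_SU2 :: "complex^2^2 \<Rightarrow> real^4" where
  "Pi_SU2 A = inv herm (A ** dagger A)"

definition Pi_B :: "complex^2^2 \<Rightarrow> complex^2^2" where
  "Pi_B A = hpoint (vector [A $ 1 $ 1, A $ 2 $ 1])"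

definition Pi_S1 :: "complex^2^2 \<Rightarrow> (real^4) \<times> (complex^2^2)" where
  "Pi_S1 A = (Pi_SU2 A, Pi_B A)"

definition Pi_Delta_SU2 :: "(complex^2^2) \<times> (complex^2^2) \<Rightarrow> (real^4) \<times> (complex^2^2)" where
  "Pi_Delta_SU2 = (\<lambda>(A, P). (Pi_SU2 A, iota (cp1_act P (matrix_inv A))))"

lemma SL2C_inverse:
  assumes "A \<in> SL2C"
  shows "A ** matrix_inv A = mat 1" "matrix_inv A ** A = mat 1"
proof -
  have "invertible A"
    using assms by (simp add: SL2C_def invertible_det_nz)
  then have "A ** matrix_inv A = mat 1 \<and> matrix_inv A ** A = mat 1"
    unfolding invertible_def matrix_inv_def by (rule someI_ex)
  then show "A ** matrix_inv A = mat 1" "matrix_inv A ** A = mat 1"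
    by blast+
qed

lemma dagger_mult: "dagger (A ** B) = dagger B ** dagger A"
  by (simp add: dagger_def matrix_matrix_mult_def vec_eq_iff sum_2 mult.commute)

lemma dagger_mat1: "dagger (mat 1) = mat 1"
  by (simp add: dagger_def mat_def vec_eq_iff)

lemma herm_Pi_SU2: "herm (Pi_SU2 A) = A ** dagger A"
proof -
  let ?H = "A ** dagger A"
  define x :: "real^4" where "x = (\<chi> i. if i = 0 then Re (?H$1$1 + ?H$2$2) / 2
      else if i = 1 then Re (?H$1$2) else if i = 2 then Im (?H$1$2)
      else Re (?H$1$1 - ?H$2$2) / 2)"
  have x: "x $ 0 = Re (?H$1$1 + ?H$2$2) / 2" "x $ 1 = Re (?H$1$2)" "x $ 2 = Im (?H$1$2)"
    "x $ 3 = Re (?H$1$1 - ?H$2$2) / 2"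
    by (simp_all add: x_def)
  have "herm x = ?H"
    by (simp add: herm_def vec_eq_iff forall_2 vector_2 x complex_eq_iff
        matrix_matrix_mult_def dagger_def sum_2 field_simps)
  then have "?H \<in> range herm"
    by (metis rangeI)
  then show ?thesis
    by (simp add: Pi_SU2_def f_inv_into_f)
qed

text \<open>The fibres of \<open>Pi_Delta_SU2\<close> are the orbits of the action.\<close>
lemma Pi_Delta_SU2_eq_iff:
  assumes x: "x \<in> SL2C \<times> CP1" and y: "y \<in> SL2C \<times> CP1"
  shows "Pi_Delta_SU2 x = Pi_Delta_SU2 y \<longleftrightarrow> (\<exists>C\<in>SU2. y = Delta x C)"
proof -
  obtain A w where xw: "x = (A, hpoint w)" "w \<noteq> 0" and A: "A \<in> SL2C"
    using x by (auto simp: CP1_def)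
  obtain B z where yz: "y = (B, hpoint z)" "z \<noteq> 0" and B: "B \<in> SL2C"
    using y by (auto simp: CP1_def)
  let ?J = "\<lambda>u::complex^2. vector [u $ 2, - (u $ 1)] :: complex^2"
  have nz: "u v* matrix_inv D \<noteq> 0" if "D \<in> SL2C" "u \<noteq> 0" for u D
    using that SL2C_inverse(2)[OF that(1)]
    by (metis vector_matrix_mul_assoc vector_matrix_mul_rid vector_matrix_mult_0)
  have Pi: "Pi_Delta_SU2 (D, hpoint u) = (Pi_SU2 D, hpoint (?J (u v* matrix_inv D)))"
    if "D \<in> SL2C" "u \<noteq> 0" for u D
    using that nz by (simp add: Pi_Delta_SU2_def cp1_act_hpoint iota_hpoint)
  have J0: "?J u \<noteq> 0 \<longleftrightarrow> u \<noteq> 0" for u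
    by (auto simp: vec2_nonzero vector_2)
  have Jsc: "?J u = c *s ?J v \<longleftrightarrow> u = c *s v" for u v c
    by (auto simp: vec_eq_iff forall_2 vector_2)
  have hJ: "hpoint (?J u) = hpoint (?J v) \<longleftrightarrow> hpoint u = hpoint v" if "u \<noteq> 0" "v \<noteq> 0" for u v
    using that by (simp add: hpoint_eq_iff J0 Jsc)
  have PiSU: "Pi_SU2 A = Pi_SU2 B \<longleftrightarrow> A ** dagger A = B ** dagger B"
    by (metis Pi_SU2_def herm_Pi_SU2)
  have vs: "(c *s u) v* D = c *s (u v* D)" for c :: complex and u :: "complex^2" and D :: "complex^2^2"
    by (simp add: vector_matrix_mult_def vec_eq_iff sum_2 algebra_simps)
  have act: "hpoint (u v* D) = hpoint (v v* D)"
    if "hpoint u = hpoint v" "u \<noteq> 0" "v \<noteq> 0" for u v D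
    using that by (auto simp: hpoint_eq_iff vs hpoint_scale)
  show ?thesis
  proof
    assume eq: "Pi_Delta_SU2 x = Pi_Delta_SU2 y"
    define C where "C = matrix_inv A ** B"
    have B_eq: "B = A ** C"
      by (simp add: C_def matrix_mul_assoc SL2C_inverse(1)[OF A])
    have dC: "det C = 1"
      using A B B_eq by (auto simp: SL2C_def det_mul)
    have AB: "A ** dagger A = B ** dagger B"
      using eq PiSU by (simp add: xw yz Pi A B)
    have 1: "dagger A ** dagger (matrix_inv A) = mat 1"
      using SL2C_inverse(2)[OF A] by (metis dagger_mult dagger_mat1)
    have "C ** dagger C = matrix_inv A ** (B ** dagger B) ** dagger (matrix_inv A)"
      by (simp add: C_def dagger_mult matrix_mul_assoc)
    also have "\<dots> = (matrix_inv A ** A) ** (dagger A ** dagger (matrix_inv A))"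
      by (simp add: AB[symmetric] matrix_mul_assoc)
    also have "\<dots> = mat 1"
      by (simp add: 1 SL2C_inverse(2)[OF A])
    finally have C: "C \<in> SU2"
      using dC by (simp add: SU2_def SL2C_def)
    have "hpoint (w v* matrix_inv A) = hpoint (z v* matrix_inv B)"
      using eq hJ nz A B xw yz by (simp add: Pi)
    then have "hpoint (w v* matrix_inv A v* B) = hpoint (z v* matrix_inv B v* B)"
      using act nz A B xw yz by blast
    then have "hpoint z = hpoint (w v* C)"
      by (simp add: vector_matrix_mul_assoc C_def SL2C_inverse(2)[OF B])
    then have "y = Delta x C"
      by (simp add: xw yz Delta_def cp1_act_hpoint B_eq)
    with C show "\<exists>C\<in>SU2. y = Delta x C" by blast
  next
    assume "\<exists>C\<in>SU2. y = Delta x C"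
    then obtain C where C: "C \<in> SU2" and yC: "y = Delta x C" by blast
    have B_eq: "B = A ** C" and z: "hpoint z = hpoint (w v* C)"
      using yC by (simp_all add: xw yz Delta_def cp1_act_hpoint)
    have "C \<in> SL2C" and CC: "C ** dagger C = mat 1"
      using C by (auto simp: SU2_def)
    have "B ** dagger B = A ** (C ** dagger C) ** dagger A"
      by (simp add: B_eq dagger_mult matrix_mul_assoc)
    then have 1: "Pi_SU2 A = Pi_SU2 B"
      by (simp add: PiSU CC)
    have wC: "w v* C \<noteq> 0"
      using SL2C_inverse(1)[OF \<open>C \<in> SL2C\<close>] xw(2)
      by (metis vector_matrix_mul_assoc vector_matrix_mul_rid vector_matrix_mult_0)
    have "C ** matrix_inv B = matrix_inv A ** A ** C ** matrix_inv B"
      by (simp add: SL2C_inverse(2)[OF A])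
    also have "\<dots> = matrix_inv A ** (B ** matrix_inv B)"
      by (simp add: B_eq matrix_mul_assoc)
    also have "\<dots> = matrix_inv A"
      by (simp add: SL2C_inverse(1)[OF B])
    finally have inv: "C ** matrix_inv B = matrix_inv A" .
    have "hpoint (z v* matrix_inv B) = hpoint (w v* C v* matrix_inv B)"
      using act z yz(2) wC by blast
    also have "\<dots> = hpoint (w v* matrix_inv A)"
      by (simp add: vector_matrix_mul_assoc inv)
    finally show "Pi_Delta_SU2 x = Pi_Delta_SU2 y"
      using 1 hJ nz A B xw yz by (simp add: Pi)
  qed
qed

section \<open>The systems\<close>

definition maurer_cartan :: "complex^2^2 \<Rightarrow> complex^2^2 \<Rightarrow> complex^2^2" where
  "maurer_cartan A V = matrix_inv A ** V"

definition \<alpha>1 :: "complex^2^2 \<Rightarrow> complex^2^2 \<Rightarrow> complex" where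
  "\<alpha>1 A V = maurer_cartan A V $ 1 $ 1"

definition \<alpha>2 :: "complex^2^2 \<Rightarrow> complex^2^2 \<Rightarrow> complex" where
  "\<alpha>2 A V = maurer_cartan A V $ 1 $ 2"

definition \<alpha>3 :: "complex^2^2 \<Rightarrow> complex^2^2 \<Rightarrow> complex" where
  "\<alpha>3 A V = maurer_cartan A V $ 2 $ 1"

text \<open>
  The fibre is the complex span of the three covectors. Rescaling the homogeneous coordinates
  rescales all three by the same factor. If \<open>\<theta>1\<close>, \<open>\<theta>2\<close>, \<open>\<theta>3\<close> are the three covectors in the order
  given, then \<open>p\<^sup>2 \<theta>1 + q\<^sup>2 \<theta>2 = p q \<theta>3\<close>, so the rank is 2.
\<close>
definition H_bundle ::
  "(complex^2^2) \<times> (complex^2^2) \<Rightarrow> ((complex^2^2) \<times> (complex^2^2) \<Rightarrow> complex) set" where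
  "H_bundle = (\<lambda>(A, P). {\<phi>. \<exists>p q c1 c2 c3. vector [p, q] \<noteq> (0 :: complex^2) \<and>
      P = hpoint (vector [p, q]) \<and>
      \<phi> = (\<lambda>(V, W). c1 * (p * q * \<alpha>2 A V - q\<^sup>2 * \<alpha>1 A V) +
                   c2 * (p * q * \<alpha>3 A V + p\<^sup>2 * \<alpha>1 A V) +
                   c3 * (q\<^sup>2 * \<alpha>3 A V + p\<^sup>2 * \<alpha>2 A V))})"

lemma H_bundle_hpoint:
  assumes nz: "vector [p, q] \<noteq> (0 :: complex^2)"
  shows "H_bundle (A, hpoint (vector [p, q])) =
    {\<phi>. \<exists>c1 c2 c3. \<phi> = (\<lambda>(V, W). c1 * (p * q * \<alpha>2 A V - q\<^sup>2 * \<alpha>1 A V) +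
                   c2 * (p * q * \<alpha>3 A V + p\<^sup>2 * \<alpha>1 A V) +
                   c3 * (q\<^sup>2 * \<alpha>3 A V + p\<^sup>2 * \<alpha>2 A V))}" (is "_ = ?R")
proof
  show "?R \<subseteq> H_bundle (A, hpoint (vector [p, q]))"
    using nz unfolding H_bundle_def by blast
  show "H_bundle (A, hpoint (vector [p, q])) \<subseteq> ?R"
  proof
    fix \<phi> assume "\<phi> \<in> H_bundle (A, hpoint (vector [p, q]))"
    then obtain r s c1 c2 c3 where rs: "vector [r, s] \<noteq> (0 :: complex^2)"
      "hpoint (vector [p, q]) = hpoint (vector [r, s])"
      and \<phi>: "\<phi> = (\<lambda>(V, W). c1 * (r * s * \<alpha>2 A V - s\<^sup>2 * \<alpha>1 A V) +
                   c2 * (r * s * \<alpha>3 A V + r\<^sup>2 * \<alpha>1 A V) +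
                   c3 * (s\<^sup>2 * \<alpha>3 A V + r\<^sup>2 * \<alpha>2 A V))"
      unfolding H_bundle_def by blast
    then obtain c where "vector [r, s] = c *s (vector [p, q] :: complex^2)"
      using nz hpoint_eq_iff by metis
    then have "r = c * p" "s = c * q"
      by (simp_all add: vec_eq_iff forall_2 vector_2)
    then have "\<phi> = (\<lambda>(V, W). (c1 * c\<^sup>2) * (p * q * \<alpha>2 A V - q\<^sup>2 * \<alpha>1 A V) +
                   (c2 * c\<^sup>2) * (p * q * \<alpha>3 A V + p\<^sup>2 * \<alpha>1 A V) +
                   (c3 * c\<^sup>2) * (q\<^sup>2 * \<alpha>3 A V + p\<^sup>2 * \<alpha>2 A V))"
      by (simp add: \<phi> fun_eq_iff power2_eq_square algebra_simps)
    then show "\<phi> \<in> ?R" by blast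
  qed
qed

definition E_system :: "((complex^2^2) \<times> (complex^2^2), real) form set" where
  "E_system = real_version (SL2C \<times> CP1) H_bundle"

definition B_generators :: "(complex^2^2, complex) form set" where
  "B_generators =
     (let a1 = one_form SL2C \<alpha>1; a2 = one_form SL2C \<alpha>2; a3 = one_form SL2C \<alpha>3
      in {form_plus a1 (form_cnj a1),
          wedge a3 (form_plus a2 (form_cnj a3)),
          wedge (form_cnj a3) (form_plus (form_cnj a2) a3)})"

text \<open>
  By \<open>real_forms_in_complexification\<close>, this is the only real EDS whose complexification can be the
  ideal algebraically generated by \<open>B_generators\<close>.
\<close>
definition B_system :: "(complex^2^2, real) form set" where
  "B_system = real_forms_in SL2C (algebraic_ideal SL2C B_generators)"

definition M_CMC :: "((real^4) \<times> (complex^2^2), real) form set" where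
  "M_CMC = quotient_EDS SL2C Pi_S1 (H3 \<times> CP1) B_system"

end

theory Submission
  imports Defs
begin

text \<open>
  Write \<open>Q\<close> for the transpose of \<open>P\<close> and \<open>X\<close> for the Maurer-Cartan form. The Pfaffian system
  annihilates the complex rank 2 distribution \<open>Q ** X = 0\<close>, and modulo its 1-forms the exterior
  derivatives are multiples of one form \<open>\<Omega>\<close> of type (2,0). Since a complex plane carries no form of
  type (3,0), the generated system is given by pointwise conditions in low degrees: the part of
  degree 0 vanishes, the part of degree 1 annihilates the distribution, and the part of degree 2
  has type (2,0) + (0,2) on it. In the same way, a form pulled back along \<open>Pi_S1\<close> lies in the second
  system iff it satisfies these conditions on the real 4-dimensional distribution with complex
  coframe \<open>\<alpha>3\<close>, \<open>\<alpha>2 + cnj \<alpha>3\<close>. The differentials of \<open>Pi_Delta_SU2\<close> and \<open>Pi_S1\<close> map the two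
  distributions to the same complex planes, so the two conditions on a form downstairs agree.
\<close>

subsection \<open>Smooth functions\<close>

text \<open>Both systems are defined as intersections of all ideals with certain elements, so
  membership is shown by exhibiting global smooth forms; local coframes would call for a partition
  of unity. Global replacements are the \<open>Basis\<close> components of the projections
  \<open>pE\<close>, \<open>dE\<close>, \<open>pB\<close>, \<open>dB\<close> and, since CP1 has no
  nowhere vanishing tangent field, a sum over four pairs of fields whose weights add up to one. The
  second system is described only for forms that factor through \<open>pB\<close>: Im \<alpha>1
  annihilates the distribution there without lying in the ideal, whereas forms pulled back along
  \<open>Pi_S1\<close> vanish on the tangents of the circle orbits. The first system is closed under
  d, so d on a submanifold has to be independent of the chosen extension; this holds because the
  derivative of the tangential projection is symmetric on tangent vectors. The second ideal is
  generated algebraically, and no derivative of forms is taken there. The two distributions are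
  compared by a unitary frame \<open>C\<close> that moves the point of CP1 to [0, 1], over which
  \<open>Pi_Delta_SU2\<close> is \<open>Pi_S1\<close>.\<close>

lemma ck_on_cong:
  assumes "open S" "\<And>x. x \<in> S \<Longrightarrow> f x = g x" "ck_on n S f"
  shows "ck_on n S g"
  using assms(2,3)
proof (induction n arbitrary: f g)
  case 0
  then show ?case using continuous_on_cong[of S S f g] by simp
next
  case (Suc n)
  have d: "(g has_derivative frechet_derivative f (at x)) (at x)" if "x \<in> S" for x
  proof (rule has_derivative_transform_within_open[OF _ \<open>open S\<close> that])
    show "(f has_derivative frechet_derivative f (at x)) (at x)"
      using Suc.prems(2) that by (simp add: frechet_derivative_works)
  qed (use Suc.prems(1) in auto)
  then have eq: "frechet_derivative f (at x) = frechet_derivative g (at x)" if "x \<in> S" for x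
    using that by (metis frechet_derivative_at)
  have "ck_on n S (\<lambda>x. frechet_derivative g (at x) v)" for v
    by (rule Suc.IH[of "\<lambda>x. frechet_derivative f (at x) v"]) (use Suc.prems(2) eq in auto)
  with d show ?case by (auto simp: differentiable_def)
qed

lemma ck_on_SucI:
  assumes "open S" "\<And>x. x \<in> S \<Longrightarrow> (f has_derivative f' x) (at x)" "\<And>v. ck_on n S (\<lambda>x. f' x v)"
  shows "ck_on (Suc n) S f"
proof -
  have "ck_on n S (\<lambda>x. frechet_derivative f (at x) v)" for v
    by (rule ck_on_cong[OF assms(1) _ assms(3)[of v]])
       (metis assms(2) frechet_derivative_at)
  then show ?thesis using assms(2) by (auto simp: differentiable_def)
qed

lemma ck_on_has_derivative:
  assumes "ck_on (Suc n) S f" "x \<in> S"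
  shows "(f has_derivative frechet_derivative f (at x)) (at x)"
  using assms by (simp add: frechet_derivative_works)

lemma ck_on_Suc_D: "ck_on (Suc n) S f \<Longrightarrow> ck_on n S f"
proof (induction n arbitrary: f)
  case 0
  then show ?case
    by (auto intro!: continuous_at_imp_continuous_on differentiable_imp_continuous_within)
next
  case (Suc n)
  then show ?case by simp
qed

lemma ck_on_subset: "ck_on n S f \<Longrightarrow> T \<subseteq> S \<Longrightarrow> ck_on n T f"
  by (induction n arbitrary: f) (auto intro: continuous_on_subset)

lemma ck_on_const: "ck_on n S (\<lambda>x. c)"
  by (induction n arbitrary: c) auto

lemma ck_on_linear:
  assumes "bounded_linear h" "open S" "ck_on n S f"
  shows "ck_on n S (\<lambda>x. h (f x))"
  using assms(3)
proof (induction n arbitrary: f)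
  case 0
  then show ?case using assms(1) by (auto intro: bounded_linear.continuous_on)
next
  case (Suc n)
  show ?case
  proof (rule ck_on_SucI[OF assms(2), where f' = "\<lambda>x v. h (frechet_derivative f (at x) v)"])
    show "((\<lambda>x. h (f x)) has_derivative (\<lambda>v. h (frechet_derivative f (at x) v))) (at x)"
      if "x \<in> S" for x
      by (rule bounded_linear.has_derivative[OF assms(1) ck_on_has_derivative[OF Suc.prems that]])
    show "ck_on n S (\<lambda>x. h (frechet_derivative f (at x) v))" for v
      using Suc by simp
  qed
qed

lemma ck_on_add:
  assumes "open S" "ck_on n S f" "ck_on n S g"
  shows "ck_on n S (\<lambda>x. f x + g x)"
  using assms(2,3)
proof (induction n arbitrary: f g)
  case 0
  then show ?case by (auto intro: continuous_on_add)
next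
  case (Suc n)
  show ?case
    by (rule ck_on_SucI[OF assms(1) has_derivative_add[OF ck_on_has_derivative[OF Suc.prems(1)]
          ck_on_has_derivative[OF Suc.prems(2)]]])
       (use Suc in auto)
qed

text \<open>Induction for all \<open>f\<close> and \<open>g\<close> at once: the product rule gives
  two terms built with the same \<open>h\<close>, each from functions of one order lower.\<close>

lemma ck_on_bilinear:
  assumes "bounded_bilinear h" "open S" "ck_on n S f" "ck_on n S g"
  shows "ck_on n S (\<lambda>x. h (f x) (g x))"
  using assms(3,4)
proof (induction n arbitrary: f g)
  case 0
  then show ?case using assms(1) by (auto intro: bounded_bilinear.continuous_on)
next
  case (Suc n)
  have f: "ck_on n S f" "ck_on n S (\<lambda>x. frechet_derivative f (at x) v)" for v
    using ck_on_Suc_D[OF Suc.prems(1)] Suc.prems(1) by auto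
  have g: "ck_on n S g" "ck_on n S (\<lambda>x. frechet_derivative g (at x) v)" for v
    using ck_on_Suc_D[OF Suc.prems(2)] Suc.prems(2) by auto
  show ?case
    by (rule ck_on_SucI[OF assms(2) bounded_bilinear.FDERIV[OF assms(1)
          ck_on_has_derivative[OF Suc.prems(1)] ck_on_has_derivative[OF Suc.prems(2)]]])
       (intro ck_on_add[OF assms(2)] Suc.IH f g | assumption)+
qed

text \<open>Here \<open>f\<close> stays fixed in the induction: the derivative -(1/f) f' (1/f)
  contains the reciprocal of the same function, which the induction hypothesis supplies one order
  lower.\<close>

lemma ck_on_inverse:
  fixes f :: "'e::euclidean_space \<Rightarrow> real"
  assumes "open S" "ck_on n S f" "\<And>x. x \<in> S \<Longrightarrow> f x \<noteq> 0"
  shows "ck_on n S (\<lambda>x. inverse (f x))"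
  using assms(2)
proof (induction n)
  case 0
  then show ?case using assms(3) by (auto intro: continuous_on_inverse)
next
  case (Suc n)
  have IH: "ck_on n S (\<lambda>x. inverse (f x))" using Suc ck_on_Suc_D by blast
  have m: "ck_on n S (\<lambda>x. f x * g x)" if "ck_on n S f" "ck_on n S g" for f g :: "'e \<Rightarrow> real"
    using that by (rule ck_on_bilinear[OF bounded_bilinear_mult assms(1)])
  show ?case
  proof (rule ck_on_SucI[OF assms(1) Deriv.has_derivative_inverse[OF assms(3) ck_on_has_derivative[OF Suc.prems]]])
    show "ck_on n S (\<lambda>x. - (inverse (f x) * frechet_derivative f (at x) v * inverse (f x)))" for v
      by (rule ck_on_linear[OF bounded_linear_minus[OF bounded_linear_ident] assms(1)])
         (use Suc.prems in \<open>auto intro!: m IH\<close>)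
  qed
qed

lemma ck_on_sum:
  assumes "open S" "\<And>i. i \<in> A \<Longrightarrow> ck_on n S (f i)"
  shows "ck_on n S (\<lambda>x. \<Sum>i\<in>A. f i x)"
  using assms(2)
proof (induction A rule: infinite_finite_induct)
  case (insert a A)
  then show ?case by (auto intro: ck_on_add[OF assms(1)])
qed (auto intro: ck_on_const)

lemma ck_on_compose:
  fixes f :: "'e::euclidean_space \<Rightarrow> 'f::euclidean_space" and g :: "'f \<Rightarrow> 'b::real_normed_vector"
  assumes "open S" "open T" "f ` S \<subseteq> T" "ck_on n S f" "ck_on n T g"
  shows "ck_on n S (\<lambda>x. g (f x))"
  using assms(4,5)
proof (induction n arbitrary: g)
  case 0
  then show ?case using assms(3) by (auto intro: continuous_on_compose2)
next
  case (Suc n)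
  let ?g' = "\<lambda>y. frechet_derivative g (at y)" and ?f' = "\<lambda>x. frechet_derivative f (at x)"
  show ?case
  \<comment> \<open>In the chain rule both the base point and the direction of the derivative of
    \<open>g\<close> vary with \<open>x\<close>, whereas \<open>ck_on\<close> speaks of fixed
    directions; expanding the direction in \<open>Basis\<close> separates them.\<close>
  proof (rule ck_on_SucI[OF assms(1), where f' = "\<lambda>x v. \<Sum>b\<in>Basis. (?f' x v \<bullet> b) *\<^sub>R ?g' (f x) b"])
    fix x assume x: "x \<in> S"
    have g: "(g has_derivative ?g' (f x)) (at (f x))"
      using x assms(3) by (intro ck_on_has_derivative[OF Suc.prems(2)]) auto
    have D: "((\<lambda>x. g (f x)) has_derivative (\<lambda>v. ?g' (f x) (?f' x v))) (at x)"
      using diff_chain_at[OF ck_on_has_derivative[OF Suc.prems(1) x] g] by (simp add: o_def)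
    have E: "?g' (f x) w = (\<Sum>b\<in>Basis. (w \<bullet> b) *\<^sub>R ?g' (f x) b)" for w
    proof -
      have l: "linear (?g' (f x))" by (rule has_derivative_linear[OF g])
      have "?g' (f x) w = ?g' (f x) (\<Sum>b\<in>Basis. (w \<bullet> b) *\<^sub>R b)"
        by (simp add: euclidean_representation)
      then show ?thesis by (simp add: linear_sum[OF l] linear_scale[OF l])
    qed
    show "((\<lambda>x. g (f x)) has_derivative
        (\<lambda>v. \<Sum>b\<in>Basis. (?f' x v \<bullet> b) *\<^sub>R ?g' (f x) b)) (at x)"
      by (rule has_derivative_eq_rhs[OF D]) (rule ext, rule E)
  next
    fix v
    have "ck_on n S (\<lambda>x. ?g' (f x) b)" for b
      by (rule Suc.IH[OF ck_on_Suc_D[OF Suc.prems(1)]]) (use Suc.prems(2) in simp)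
    moreover have "ck_on n S (\<lambda>x. ?f' x v \<bullet> b)" for b
      using Suc.prems(1) by (auto intro: ck_on_linear[OF bounded_linear_inner_left assms(1)])
    ultimately show "ck_on n S (\<lambda>x. \<Sum>b\<in>Basis. (?f' x v \<bullet> b) *\<^sub>R ?g' (f x) b)"
      by (intro ck_on_sum[OF assms(1)] ck_on_bilinear[OF bounded_bilinear_scaleR assms(1)])
  qed
qed

lemma smooth_on_cong: "open S \<Longrightarrow> (\<And>x. x \<in> S \<Longrightarrow> f x = g x) \<Longrightarrow> smooth_on S f \<Longrightarrow> smooth_on S g"
  unfolding smooth_on_def using ck_on_cong by blast

lemma smooth_on_subset: "smooth_on S f \<Longrightarrow> T \<subseteq> S \<Longrightarrow> smooth_on T f"
  unfolding smooth_on_def using ck_on_subset by blast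

lemma smooth_on_const [intro]: "smooth_on S (\<lambda>x. c)"
  unfolding smooth_on_def using ck_on_const by blast

lemma smooth_on_linear: "bounded_linear h \<Longrightarrow> open S \<Longrightarrow> smooth_on S f \<Longrightarrow> smooth_on S (\<lambda>x. h (f x))"
  unfolding smooth_on_def using ck_on_linear by blast

lemma smooth_on_add: "open S \<Longrightarrow> smooth_on S f \<Longrightarrow> smooth_on S g \<Longrightarrow> smooth_on S (\<lambda>x. f x + g x)"
  unfolding smooth_on_def using ck_on_add by blast

lemma smooth_on_bilinear:
  "bounded_bilinear h \<Longrightarrow> open S \<Longrightarrow> smooth_on S f \<Longrightarrow> smooth_on S g \<Longrightarrow> smooth_on S (\<lambda>x. h (f x) (g x))"
  unfolding smooth_on_def using ck_on_bilinear by blast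

lemma smooth_on_inverse:
  fixes f :: "'e::euclidean_space \<Rightarrow> real"
  shows "open S \<Longrightarrow> smooth_on S f \<Longrightarrow> (\<And>x. x \<in> S \<Longrightarrow> f x \<noteq> 0) \<Longrightarrow> smooth_on S (\<lambda>x. inverse (f x))"
  unfolding smooth_on_def using ck_on_inverse by blast

lemma smooth_on_sum:
  "open S \<Longrightarrow> (\<And>i. i \<in> A \<Longrightarrow> smooth_on S (f i)) \<Longrightarrow> smooth_on S (\<lambda>x. \<Sum>i\<in>A. f i x)"
  unfolding smooth_on_def by (intro allI ck_on_sum) auto

lemma smooth_on_compose:
  fixes f :: "'e::euclidean_space \<Rightarrow> 'f::euclidean_space"
  shows "open S \<Longrightarrow> open T \<Longrightarrow> f ` S \<subseteq> T \<Longrightarrow> smooth_on S f \<Longrightarrow> smooth_on T g \<Longrightarrow>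
    smooth_on S (\<lambda>x. g (f x))"
  unfolding smooth_on_def using ck_on_compose[of S T f _ g] by auto

lemma smooth_on_ident: "open S \<Longrightarrow> smooth_on S (\<lambda>x. x)"
proof -
  assume S: "open S"
  have "ck_on n S (\<lambda>x. x)" for n
  proof (cases n)
    case (Suc m)
    show ?thesis unfolding Suc
      by (rule ck_on_SucI[OF S has_derivative_ident]) (rule ck_on_const)
  qed auto
  then show ?thesis unfolding smooth_on_def by blast
qed

lemma smooth_on_frechet_derivative:
  "smooth_on S f \<Longrightarrow> smooth_on S (\<lambda>x. frechet_derivative f (at x) v)"
  unfolding smooth_on_def by (metis ck_on.simps(2))

lemma smooth_on_has_derivative:
  "smooth_on S f \<Longrightarrow> x \<in> S \<Longrightarrow> (f has_derivative frechet_derivative f (at x)) (at x)"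
  unfolding smooth_on_def using ck_on_has_derivative by blast

subsection \<open>Alternating multilinear functions on lists\<close>

abbreviation alt :: "('e::euclidean_space list \<Rightarrow> 'b::real_normed_field) \<Rightarrow> bool" where
  "alt \<equiv> alternating_multilinear UNIV"

lemma alt_linear:
  assumes "alt \<phi>"
  shows "\<phi> (as @ (c *\<^sub>R u + d *\<^sub>R w) # bs) = c *\<^sub>R \<phi> (as @ u # bs) + d *\<^sub>R \<phi> (as @ w # bs)"
proof -
  have "\<phi> ((as @ u # bs)[length as := c *\<^sub>R u + d *\<^sub>R w]) =
      c *\<^sub>R \<phi> ((as @ u # bs)[length as := u]) + d *\<^sub>R \<phi> ((as @ u # bs)[length as := w])"
    using assms[unfolded alternating_multilinear_def, THEN spec, of "as @ u # bs"]
    by (simp only: subset_UNIV simp_thms length_append list.size UNIV_I ball_UNIV)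
  then show ?thesis by (simp add: list_update_append)
qed

lemma alt_adjacent: "alt \<phi> \<Longrightarrow> \<phi> (as @ x # x # bs) = 0"
proof -
  assume "alt \<phi>"
  moreover have "length as < Suc (length as)" "Suc (length as) < length (as @ x # x # bs)"
    "(as @ x # x # bs) ! length as = (as @ x # x # bs) ! Suc (length as)"
    by (simp_all add: nth_append)
  ultimately show ?thesis unfolding alternating_multilinear_def by blast
qed

lemma linear_slotI:
  assumes "\<And>c d u w. f (c *\<^sub>R u + d *\<^sub>R w) = c *\<^sub>R f u + d *\<^sub>R f w"
  shows "linear f"
proof (rule linearI)
  show "f (x + y) = f x + f y" for x y using assms[of 1 x 1 y] by simp
  show "f (r *\<^sub>R x) = r *\<^sub>R f x" for r x using assms[of r x 0 x] by simp
qed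

lemma alt_slot_linear: "alt \<phi> \<Longrightarrow> linear (\<lambda>u. \<phi> (as @ u # bs))"
  by (rule linear_slotI) (rule alt_linear)

text \<open>Polarisation: expand the vanishing value with \<open>x + y\<close> in two adjacent
  slots.\<close>

lemma swap_of_adjacent:
  fixes \<phi> :: "'e::euclidean_space list \<Rightarrow> 'b::real_normed_field"
  assumes lin: "\<And>as bs. linear (\<lambda>u. \<phi> (as @ u # bs))"
    and adj: "\<And>as x bs. \<phi> (as @ x # x # bs) = 0"
  shows "\<phi> (as @ x # y # bs) = - \<phi> (as @ y # x # bs)"
proof -
  have "0 = \<phi> (as @ (x + y) # (x + y) # bs)" using adj by simp
  also have "\<dots> = \<phi> (as @ x # (x + y) # bs) + \<phi> (as @ y # (x + y) # bs)"
    using linear_add[OF lin] by simp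
  also have "\<phi> (as @ x # (x + y) # bs) = \<phi> (as @ x # y # bs)"
    using linear_add[OF lin[of "as @ [x]"]] adj by simp
  also have "\<phi> (as @ y # (x + y) # bs) = \<phi> (as @ y # x # bs)"
    using linear_add[OF lin[of "as @ [y]"]] adj by simp
  finally show ?thesis by (simp add: eq_neg_iff_add_eq_0)
qed

lemma altI:
  fixes \<phi> :: "'e::euclidean_space list \<Rightarrow> 'b::real_normed_field"
  assumes lin: "\<And>as bs. linear (\<lambda>u. \<phi> (as @ u # bs))"
    and adj: "\<And>as x bs. \<phi> (as @ x # x # bs) = 0"
  shows "alt \<phi>"
  unfolding alternating_multilinear_def
proof (intro allI impI conjI ballI)
  fix vs :: "'e list" and i u w c d
  assume "i < length vs"
  then have "vs[i := x] = take i vs @ x # drop (Suc i) vs" for x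
    by (simp add: upd_conv_take_nth_drop)
  then show "\<phi> (vs[i := c *\<^sub>R u + d *\<^sub>R w]) = c *\<^sub>R \<phi> (vs[i := u]) + d *\<^sub>R \<phi> (vs[i := w])"
    using linear_add[OF lin] linear_scale[OF lin] by simp
next
  \<comment> \<open>Moving \<open>x\<close> past the entries between the two copies only changes the
    sign, until the copies are adjacent.\<close>
  have gap: "\<phi> (as @ x # cs @ x # bs) = 0" for as x cs bs
  proof (induction cs arbitrary: as)
    case (Cons c cs)
    have "\<phi> (as @ x # c # cs @ x # bs) = - \<phi> (as @ c # x # cs @ x # bs)"
      by (rule swap_of_adjacent[OF lin adj])
    with Cons[of "as @ [c]"] show ?case by simp
  qed (simp add: adj)
  fix vs :: "'e list" and i j
  assume ij: "i < j" "j < length vs" "vs ! i = vs ! j"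
  then have j: "vs = take j vs @ vs ! j # drop (Suc j) vs" by (simp add: id_take_nth_drop)
  have i: "take j vs = take i (take j vs) @ take j vs ! i # drop (Suc i) (take j vs)"
    using ij by (intro id_take_nth_drop) simp
  have "vs = take i (take j vs) @ vs ! j # drop (Suc i) (take j vs) @ vs ! j # drop (Suc j) vs"
    using i j ij by (metis Cons_eq_appendI append_assoc nth_take)
  then show "\<phi> vs = 0" using gap by metis
qed

lemma alt_swap: "alt \<phi> \<Longrightarrow> \<phi> (as @ x # y # bs) = - \<phi> (as @ y # x # bs)"
  by (rule swap_of_adjacent) (auto intro: alt_slot_linear alt_adjacent)

lemma alt_Cons: "alt \<phi> \<Longrightarrow> alt (\<lambda>us. \<phi> (v # us))"
  by (rule altI) (use alt_slot_linear[of \<phi> "v # _"] alt_adjacent[of \<phi> "v # _"] in auto)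

lemma alt_append: "alt \<phi> \<Longrightarrow> alt (\<lambda>us. \<phi> (vs @ us))"
  by (rule altI) (use alt_slot_linear[of \<phi> "vs @ _"] alt_adjacent[of \<phi> "vs @ _"] in auto)

lemma alt_map: "alt \<phi> \<Longrightarrow> linear L \<Longrightarrow> alt (\<lambda>us. \<phi> (map L us))"
proof (rule altI)
  assume \<phi>: "alt \<phi>" and L: "linear L"
  show "linear (\<lambda>u. \<phi> (map L (as @ u # bs)))" for as bs
    using linear_compose[OF L alt_slot_linear[OF \<phi>]] by (simp add: o_def)
  show "\<phi> (map L (as @ x # x # bs)) = 0" for as x bs
    using alt_adjacent[OF \<phi>] by simp
qed

lemma linear_mult_const: "linear f \<Longrightarrow> linear (\<lambda>u. c * f u)"
  for f :: "'a::real_vector \<Rightarrow> 'b::real_algebra"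
  by (rule linear_slotI) (simp add: linear_add linear_scale distrib_left)

lemma linear_zero_fun: "linear (\<lambda>u. 0)"
  by (rule linear_slotI) simp

lemma alt_scale: "alt \<phi> \<Longrightarrow> alt (\<lambda>us. c ^ length us * \<phi> us)"
proof (rule altI)
  show "linear (\<lambda>u. c ^ length (as @ u # bs) * \<phi> (as @ u # bs))" if "alt \<phi>" for as bs
    using linear_mult_const[OF alt_slot_linear[OF that]] by simp
qed (simp add: alt_adjacent)

lemma alt_mult: "alt \<phi> \<Longrightarrow> alt (\<lambda>us. c * \<phi> us)"
  by (rule altI) (simp_all add: alt_adjacent linear_mult_const alt_slot_linear)

lemma alt_add: "alt \<phi> \<Longrightarrow> alt \<psi> \<Longrightarrow> alt (\<lambda>us. \<phi> us + \<psi> us)"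
  by (rule altI) (simp_all add: alt_adjacent linear_compose_add alt_slot_linear)

lemma alt_zero: "alt (\<lambda>us. 0)"
  by (rule altI) (auto intro: linear_zero_fun)

lemma alt_homogeneous:
  assumes "alt \<phi>"
  shows "alt (\<lambda>us. if length us = k then \<phi> us else 0)"
proof (rule altI)
  show "linear (\<lambda>u. if length (as @ u # bs) = k then \<phi> (as @ u # bs) else 0)" for as bs
    by (cases "length as + Suc (length bs) = k")
       (simp_all add: alt_slot_linear[OF assms] linear_zero_fun)
qed (simp add: alt_adjacent[OF assms])

lemma alt_one: "linear f \<Longrightarrow> alt (\<lambda>us. if length us = 1 then f (hd us) else 0)"
proof (rule altI)
  assume f: "linear f"
  show "linear (\<lambda>u. if length (as @ u # bs) = 1 then f (hd (as @ u # bs)) else 0)" for as bs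
    by (cases as; cases bs) (auto simp: f intro: linear_zero_fun)
  show "(if length (as @ x # x # bs) = 1 then f (hd (as @ x # x # bs)) else 0) = 0" for as x bs
    by simp
qed

lemma alt_expand:
  assumes "alt \<phi>"
  shows "\<phi> (v # us) = (\<Sum>b\<in>Basis. (v \<bullet> b) *\<^sub>R \<phi> (b # us))"
proof -
  have l: "linear (\<lambda>v. \<phi> (v # us))" using alt_slot_linear[OF assms, of "[]"] by simp
  have "\<phi> (v # us) = \<phi> ((\<Sum>b\<in>Basis. (v \<bullet> b) *\<^sub>R b) # us)"
    by (simp add: euclidean_representation)
  also have "\<dots> = (\<Sum>b\<in>Basis. (v \<bullet> b) *\<^sub>R \<phi> (b # us))"
    by (simp add: linear_sum[OF l] linear_scale[OF l])
  finally show ?thesis .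
qed

lemma alt_repeat:
  assumes "alt \<phi>" "\<not> distinct vs"
  shows "\<phi> vs = 0"
proof -
  obtain i j where "i < j" "j < length vs" "vs ! i = vs ! j"
    using assms(2) unfolding distinct_conv_nth by (metis nat_neq_iff)
  with assms(1) show ?thesis unfolding alternating_multilinear_def by blast
qed

text \<open>More vectors than the dimension are dependent; expanding one of them in the others
  leaves only terms with a repeated argument. This makes every form a finite sum of homogeneous
  parts.\<close>

lemma alt_degree_bound:
  fixes vs :: "'e::euclidean_space list"
  assumes "alt \<phi>" "length vs > DIM('e)"
  shows "\<phi> vs = 0"
proof (cases "distinct vs")
  case True
  then have "card (set vs) > DIM('e)" using assms(2) by (simp add: distinct_card)
  then have "dependent (set vs)" using independent_bound by (meson leD)
  then obtain v where v: "v \<in> set vs" "v \<in> span (set vs - {v})" unfolding dependent_def by blast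
  obtain as bs where vs: "vs = as @ v # bs" using v(1) by (meson split_list)
  obtain c where c: "v = (\<Sum>u\<in>set vs - {v}. c u *\<^sub>R u)"
    using v(2) by (auto simp: span_finite)
  have l: "linear (\<lambda>v. \<phi> (as @ v # bs))" by (rule alt_slot_linear[OF assms(1)])
  have "\<phi> vs = \<phi> (as @ (\<Sum>u\<in>set vs - {v}. c u *\<^sub>R u) # bs)" using vs c by metis
  also have "\<dots> = (\<Sum>u\<in>set vs - {v}. c u *\<^sub>R \<phi> (as @ u # bs))"
    by (simp add: linear_sum[OF l] linear_scale[OF l])
  also have "\<dots> = 0"
    by (intro sum.neutral ballI) (use vs True in \<open>auto intro!: alt_repeat[OF assms(1)]\<close>)
  finally show ?thesis .
qed (rule alt_repeat[OF assms(1)])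

subsection \<open>The wedge product\<close>

lemma wedge_Nil [simp]: "wedge \<omega> \<eta> x [] = \<omega> x [] * \<eta> x []"
  by (simp add: wedge_def)

text \<open>The shuffles that pass the first argument to the left factor and those that pass it to the
  right factor, where it moves past all arguments of the left factor.\<close>
lemma wedge_Cons:
  "wedge \<omega> \<eta> x (v # vs) = wedge (\<lambda>x us. \<omega> x (v # us)) \<eta> x vs
    + wedge (\<lambda>x us. (- 1) ^ length us * \<omega> x us) (\<lambda>x us. \<eta> x (v # us)) x vs"
proof -
  define n where "n = length vs"
  define inv where "inv = (\<lambda>m S. {(i, j). i < j \<and> i \<in> {..<m} - S \<and> j \<in> (S :: nat set)})"
  define t where "t = (\<lambda>S. (- 1) ^ card (inv (Suc n) S) *
      \<omega> x (nths (v # vs) S) * \<eta> x (nths (v # vs) (- S)))"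
  let ?A = "(\<lambda>S. Suc ` S) ` Pow {..<n}" and ?B = "(\<lambda>S. insert 0 (Suc ` S)) ` Pow {..<n}"
  have un: "Pow {..<Suc n} = ?A \<union> ?B"
  proof -
    have "{..<Suc n} = insert 0 (Suc ` {..<n})" by (simp add: lessThan_Suc_eq_insert_0)
    then show ?thesis by (simp add: Pow_insert image_image flip: image_Pow_surj[OF refl])
  qed
  have disj: "?A \<inter> ?B = {}" by auto
  have injA: "inj_on (\<lambda>S. Suc ` S) (Pow {..<n})" by (auto simp: inj_on_def inj_image_eq_iff)
  have injB: "inj_on (\<lambda>S. insert 0 (Suc ` S)) (Pow {..<n})"
  proof (rule inj_onI)
    fix S T :: "nat set" assume "insert 0 (Suc ` S) = insert 0 (Suc ` T)"
    then have "Suc ` S = Suc ` T" by (auto simp: set_eq_iff)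
    then show "S = T" by (simp add: inj_image_eq_iff)
  qed
  have fin: "finite (inv m S)" if "S \<subseteq> {..<m}" for m S
    by (rule finite_subset[of _ "{..<m} \<times> {..<m}"]) (use that in \<open>auto simp: inv_def\<close>)
  have cS: "card (map_prod Suc Suc ` X) = card X" for X :: "(nat \<times> nat) set"
    by (rule card_image) (auto simp: inj_on_def)
  have invB: "card (inv (Suc n) (insert 0 (Suc ` S))) = card (inv n S)" for S
  proof -
    have "inv (Suc n) (insert 0 (Suc ` S)) = map_prod Suc Suc ` inv n S"
    proof (intro equalityI subsetI)
      fix p assume "p \<in> inv (Suc n) (insert 0 (Suc ` S))"
      then obtain i j where p: "p = (i, j)" "i < j" "i < Suc n" "i \<noteq> 0" "i \<notin> Suc ` S" "j \<in> Suc ` S"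
        by (auto simp: inv_def)
      then obtain i' j' where "i = Suc i'" "j = Suc j'" by (auto simp: gr0_conv_Suc)
      with p show "p \<in> map_prod Suc Suc ` inv n S" by (auto simp: inv_def intro!: image_eqI[of _ _ "(i', j')"])
    qed (auto simp: inv_def)
    then show ?thesis by (simp add: cS)
  qed
  \<comment> \<open>A position 0 outside \<open>S\<close> precedes every element of \<open>S\<close>
    and so adds \<open>card S\<close> inversions, the source of the sign
    \<open>(- 1) ^ length us\<close>; inside \<open>S\<close> it adds none.\<close>
  have invA: "card (inv (Suc n) (Suc ` S)) = card S + card (inv n S)" if S: "S \<subseteq> {..<n}" for S
  proof -
    have "inv (Suc n) (Suc ` S) = map_prod Suc Suc ` inv n S \<union> Pair 0 ` Suc ` S"
    proof (intro equalityI subsetI)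
      fix p assume "p \<in> inv (Suc n) (Suc ` S)"
      then obtain i j where p: "p = (i, Suc j)" "i < Suc j" "i < Suc n" "i \<notin> Suc ` S" "j \<in> S"
        by (auto simp: inv_def)
      then show "p \<in> map_prod Suc Suc ` inv n S \<union> Pair 0 ` Suc ` S"
        by (cases i) (auto simp: inv_def intro!: image_eqI[of _ _ "(i - 1, j)"])
    qed (auto simp: inv_def)
    moreover have "card (map_prod Suc Suc ` inv n S \<union> Pair 0 ` Suc ` S) =
        card (map_prod Suc Suc ` inv n S) + card (Pair (0::nat) ` Suc ` S)"
      by (intro card_Un_disjoint finite_imageI fin[OF S] finite_subset[OF S]) auto
    ultimately show ?thesis
      by (simp add: cS card_image inj_on_def)
  qed
  have len: "length (nths vs S) = card S" if "S \<subseteq> {..<n}" for S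
    using that by (auto simp: length_nths n_def intro!: arg_cong[of _ _ card])
  have nA: "nths (v # vs) (Suc ` S) = nths vs S" "nths (v # vs) (- Suc ` S) = v # nths vs (- S)" for S
    by (auto simp: nths_Cons inj_image_mem_iff intro!: arg_cong2[of _ _ _ _ nths])
  have nB: "nths (v # vs) (insert 0 (Suc ` S)) = v # nths vs S"
    "nths (v # vs) (- insert 0 (Suc ` S)) = nths vs (- S)" for S
    by (auto simp: nths_Cons inj_image_mem_iff intro!: arg_cong2[of _ _ _ _ nths])
  have "wedge \<omega> \<eta> x (v # vs) = (\<Sum>S\<in>Pow {..<Suc n}. t S)"
    by (simp add: wedge_def t_def inv_def n_def)
  also have "\<dots> = (\<Sum>S\<in>?A. t S) + (\<Sum>S\<in>?B. t S)"
    unfolding un by (rule sum.union_disjoint) (auto simp: disj)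
  also have "(\<Sum>S\<in>?B. t S) = wedge (\<lambda>x us. \<omega> x (v # us)) \<eta> x vs"
    unfolding wedge_def n_def[symmetric] sum.reindex[OF injB] o_def
    by (simp only: t_def invB nB) (simp only: inv_def)
  also have "(\<Sum>S\<in>?A. t S) = wedge (\<lambda>x us. (- 1) ^ length us * \<omega> x us) (\<lambda>x us. \<eta> x (v # us)) x vs"
    unfolding wedge_def n_def[symmetric] sum.reindex[OF injA] o_def
  proof (rule sum.cong[OF refl])
    fix S assume "S \<in> Pow {..<n}"
    then have S: "S \<subseteq> {..<n}" by simp
    show "t (Suc ` S) = (- 1) ^ card {(i, j). i < j \<and> i \<in> {..<n} - S \<and> j \<in> S} *
        ((- 1) ^ length (nths vs S) * \<omega> x (nths vs S)) * \<eta> x (v # nths vs (- S))"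
      unfolding t_def invA[OF S] nA len[OF S] by (simp only: inv_def power_add mult_ac)
  qed
  finally show ?thesis by simp
qed

text \<open>Allows a form to be replaced by a local extension, with which it agrees on tangent
  arguments only.\<close>

lemma wedge_local:
  assumes "set vs \<subseteq> T" "\<And>us. set us \<subseteq> T \<Longrightarrow> \<omega> x us = \<omega>' x us"
    "\<And>us. set us \<subseteq> T \<Longrightarrow> \<eta> x us = \<eta>' x us"
  shows "wedge \<omega> \<eta> x vs = wedge \<omega>' \<eta>' x vs"
  unfolding wedge_def
proof (rule sum.cong[OF refl])
  fix S :: "nat set"
  have "set (nths vs A) \<subseteq> T" for A using assms(1) set_nths_subset by fastforce
  then show "(- 1) ^ card {(i, j). i < j \<and> i \<in> {..<length vs} - S \<and> j \<in> S} *
      \<omega> x (nths vs S) * \<eta> x (nths vs (- S)) =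
    (- 1) ^ card {(i, j). i < j \<and> i \<in> {..<length vs} - S \<and> j \<in> S} *
      \<omega>' x (nths vs S) * \<eta>' x (nths vs (- S))"
    using assms by simp
qed

lemma wedge_scale_left: "wedge (\<lambda>x us. c * \<omega> x us) \<eta> x vs = c * wedge \<omega> \<eta> x vs"
  by (simp add: wedge_def sum_distrib_left mult_ac)

lemma wedge_zero: "(\<And>us. \<omega> x us = 0) \<Longrightarrow> wedge \<omega> \<eta> x vs = 0" "(\<And>us. \<eta> x us = 0) \<Longrightarrow> wedge \<omega> \<eta> x vs = 0"
  by (simp_all add: wedge_def)

lemma wedge_linear_left:
  assumes "\<And>us. linear (\<lambda>u. \<omega> u x us)"
  shows "linear (\<lambda>u. wedge (\<omega> u) \<eta> x vs)"
proof (rule linear_slotI)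
  have "\<omega> (c *\<^sub>R u + d *\<^sub>R w) x us = c *\<^sub>R \<omega> u x us + d *\<^sub>R \<omega> w x us" for c d u w us
    using linear_add[OF assms] linear_scale[OF assms] by simp
  then show "wedge (\<omega> (c *\<^sub>R u + d *\<^sub>R w)) \<eta> x vs =
      c *\<^sub>R wedge (\<omega> u) \<eta> x vs + d *\<^sub>R wedge (\<omega> w) \<eta> x vs" for c d u w
    by (simp add: wedge_def ring_distribs sum.distrib scaleR_sum_right)
qed

lemma wedge_linear_right:
  assumes "\<And>us. linear (\<lambda>u. \<eta> u x us)"
  shows "linear (\<lambda>u. wedge \<omega> (\<eta> u) x vs)"
proof (rule linear_slotI)
  have "\<eta> (c *\<^sub>R u + d *\<^sub>R w) x us = c *\<^sub>R \<eta> u x us + d *\<^sub>R \<eta> w x us" for c d u w us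
    using linear_add[OF assms] linear_scale[OF assms] by simp
  then show "wedge \<omega> (\<eta> (c *\<^sub>R u + d *\<^sub>R w)) x vs =
      c *\<^sub>R wedge \<omega> (\<eta> u) x vs + d *\<^sub>R wedge \<omega> (\<eta> w) x vs" for c d u w
    by (simp add: wedge_def ring_distribs sum.distrib scaleR_sum_right)
qed

lemma alt_wedge:
  assumes "alt (\<omega> x)" "alt (\<eta> x)"
  shows "alt (wedge \<omega> \<eta> x)"
proof (rule altI)
  fix as bs :: "'a list"
  show "linear (\<lambda>u. wedge \<omega> \<eta> x (as @ u # bs))"
    using assms
  proof (induction as arbitrary: \<omega> \<eta>)
    case Nil
    show ?case unfolding append_Nil wedge_Cons
      by (intro linear_compose_add wedge_linear_left wedge_linear_right)
         (use alt_slot_linear[OF Nil(1), of "[]"] alt_slot_linear[OF Nil(2), of "[]"] in auto)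
  next
    case (Cons a as)
    show ?case unfolding append_Cons wedge_Cons
      by (intro linear_compose_add Cons alt_Cons alt_scale)
  qed
next
  fix as bs and y :: 'a
  show "wedge \<omega> \<eta> x (as @ y # y # bs) = 0"
    using assms
  proof (induction as arbitrary: \<omega> \<eta>)
    case Nil
    have 0: "\<omega> x (y # y # us) = 0" "\<eta> x (y # y # us) = 0" for us
      using alt_adjacent[OF Nil(1), of "[]"] alt_adjacent[OF Nil(2), of "[]"] by auto
    \<comment> \<open>When both copies of \<open>y\<close> are distributed, two of the four terms
      repeat it in one factor. The other two give one copy to each factor and differ by this
      sign.\<close>
    have "wedge (\<lambda>x us. (- 1) ^ length (y # us) * \<omega> x (y # us)) (\<lambda>x us. \<eta> x (y # us)) x bs =
      - wedge (\<lambda>x us. (- 1) ^ length us * \<omega> x (y # us)) (\<lambda>x us. \<eta> x (y # us)) x bs"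
      using wedge_scale_left[of "-1" "\<lambda>x us. (- 1) ^ length us * \<omega> x (y # us)"] by simp
    then show ?case unfolding append_Nil wedge_Cons
      by (simp add: 0 wedge_zero)
  next
    case (Cons a as)
    show ?case unfolding append_Cons wedge_Cons
      by (simp add: Cons alt_Cons alt_scale)
  qed
qed

lemma wedge_degree0:
  assumes "\<And>us. us \<noteq> [] \<Longrightarrow> \<omega> x us = 0"
  shows "wedge \<omega> \<eta> x vs = \<omega> x [] * \<eta> x vs"
  using assms
proof (induction vs arbitrary: \<omega> \<eta>)
  case (Cons v vs)
  have "wedge (\<lambda>x us. (- 1) ^ length us * \<omega> x us) (\<lambda>x us. \<eta> x (v # us)) x vs = \<omega> x [] * \<eta> x (v # vs)"
    by (subst Cons.IH) (use Cons.prems in auto)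
  moreover have "wedge (\<lambda>x us. \<omega> x (v # us)) \<eta> x vs = 0"
    by (rule wedge_zero) (simp add: Cons.prems)
  ultimately show ?case by (simp add: wedge_Cons)
qed simp

lemma wedge_degree1:
  assumes "\<And>us. length us \<noteq> 1 \<Longrightarrow> \<omega> x us = 0"
  shows "wedge \<omega> \<eta> x [] = 0"
    and "wedge \<omega> \<eta> x (v # vs) = \<omega> x [v] * \<eta> x vs - wedge \<omega> (\<lambda>x us. \<eta> x (v # us)) x vs"
proof -
  show "wedge \<omega> \<eta> x [] = 0" by (simp add: assms)
  have "wedge (\<lambda>x us. \<omega> x (v # us)) \<eta> x vs = \<omega> x [v] * \<eta> x vs"
    by (rule wedge_degree0) (simp add: assms)
  moreover have "wedge (\<lambda>x us. (- 1) ^ length us * \<omega> x us) (\<lambda>x us. \<eta> x (v # us)) x vs =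
      wedge (\<lambda>x us. - 1 * \<omega> x us) (\<lambda>x us. \<eta> x (v # us)) x vs"
  proof (rule wedge_local[of _ UNIV])
    show "(- 1) ^ length us * \<omega> x us = - 1 * \<omega> x us" for us
      by (cases "length us = 1") (auto simp: assms)
  qed auto
  ultimately show "wedge \<omega> \<eta> x (v # vs) = \<omega> x [v] * \<eta> x vs - wedge \<omega> (\<lambda>x us. \<eta> x (v # us)) x vs"
    by (simp only: wedge_Cons wedge_scale_left) simp
qed

subsection \<open>Closure properties of forms\<close>

lemma local_extensionI:
  assumes "open U" "x \<in> U" "\<And>y. y \<in> U \<Longrightarrow> alt (\<eta> y)" "\<And>vs. smooth_on U (\<lambda>y. \<eta> y vs)"
    "\<And>y vs. y \<in> U \<Longrightarrow> y \<in> M \<Longrightarrow> set vs \<subseteq> tangent M y \<Longrightarrow> \<omega> y vs = \<eta> y vs"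
  shows "local_extension M \<omega> x \<eta>"
  unfolding local_extension_def using assms by blast

text \<open>\<open>local_extension\<close> with the neighbourhood as a parameter, so that extensions
  of several forms can be shrunk to a common open set.\<close>

definition extends_on ::
  "'e::euclidean_space set \<Rightarrow> 'e set \<Rightarrow> ('e, 'b::real_normed_field) form \<Rightarrow> ('e, 'b) form \<Rightarrow> bool" where
  "extends_on M U \<omega> \<eta> \<longleftrightarrow> open U \<and> (\<forall>y\<in>U. alt (\<eta> y)) \<and> (\<forall>vs. smooth_on U (\<lambda>y. \<eta> y vs)) \<and>
    (\<forall>y\<in>U \<inter> M. \<forall>vs. set vs \<subseteq> tangent M y \<longrightarrow> \<omega> y vs = \<eta> y vs)"

lemma local_extension_iff: "local_extension M \<omega> x \<eta> \<longleftrightarrow> (\<exists>U. x \<in> U \<and> extends_on M U \<omega> \<eta>)"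
  unfolding local_extension_def extends_on_def by blast

lemma extends_onD:
  assumes "extends_on M U \<omega> \<eta>"
  shows "open U" "y \<in> U \<Longrightarrow> alt (\<eta> y)" "smooth_on U (\<lambda>y. \<eta> y vs)"
    "y \<in> U \<Longrightarrow> y \<in> M \<Longrightarrow> set vs \<subseteq> tangent M y \<Longrightarrow> \<omega> y vs = \<eta> y vs"
  using assms unfolding extends_on_def by blast+

lemma extends_on_subset: "extends_on M U \<omega> \<eta> \<Longrightarrow> open V \<Longrightarrow> V \<subseteq> U \<Longrightarrow> extends_on M V \<omega> \<eta>"
  unfolding extends_on_def using smooth_on_subset[of U _ V] by blast

lemma formsE:
  assumes "\<omega> \<in> forms M" "x \<in> M"
  obtains \<eta> U where "x \<in> U" "extends_on M U \<omega> \<eta>"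
  using assms unfolding forms_def local_extension_iff by blast

lemma forms_outside: "\<omega> \<in> forms M \<Longrightarrow> x \<notin> M \<or> \<not> set vs \<subseteq> tangent M x \<Longrightarrow> \<omega> x vs = 0"
  unfolding forms_def by blast

text \<open>Multilinearity on the tangent space is inherited from a local extension. Linear
  combinations of arguments must stay tangent for this, whence the subspace assumption.\<close>

lemma formsI:
  fixes M :: "'e::euclidean_space set" and \<omega> :: "('e, 'b::real_normed_field) form"
  assumes sub: "\<And>x. x \<in> M \<Longrightarrow> subspace (tangent M x)"
    and out: "\<And>x vs. x \<notin> M \<or> \<not> set vs \<subseteq> tangent M x \<Longrightarrow> \<omega> x vs = 0"
    and ext: "\<And>x. x \<in> M \<Longrightarrow> \<exists>\<eta>. local_extension M \<omega> x \<eta>"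
  shows "\<omega> \<in> forms M"
proof -
  have "alternating_multilinear (tangent M x) (\<omega> x)" if x: "x \<in> M" for x
  proof -
    obtain \<eta> U where \<eta>: "x \<in> U" "extends_on M U \<omega> \<eta>"
      using ext[OF x] unfolding local_extension_iff by blast
    have eq: "\<omega> x vs = \<eta> x vs" if "set vs \<subseteq> tangent M x" for vs
      by (rule extends_onD(4)[OF \<eta>(2,1) x that])
    have upd: "set (vs[i := u]) \<subseteq> tangent M x" if "set vs \<subseteq> tangent M x" "u \<in> tangent M x" for vs i u
      using that set_update_subset_insert by fastforce
    have comb: "c *\<^sub>R u + d *\<^sub>R w \<in> tangent M x" if "u \<in> tangent M x" "w \<in> tangent M x" for c d u w
      using sub[OF x] that by (simp add: subspace_add subspace_scale)
    show ?thesis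
      using extends_onD(2)[OF \<eta>(2,1)] unfolding alternating_multilinear_def
      by (auto simp: eq upd comb)
  qed
  with out ext show ?thesis unfolding forms_def by blast
qed

lemma local_extensions_common:
  assumes "\<omega> \<in> forms M" "\<eta> \<in> forms M" "x \<in> M"
  obtains \<omega>' \<eta>' U where "x \<in> U" "extends_on M U \<omega> \<omega>'" "extends_on M U \<eta> \<eta>'"
proof -
  obtain \<omega>' U where U: "x \<in> U" "extends_on M U \<omega> \<omega>'" by (rule formsE[OF assms(1,3)])
  obtain \<eta>' V where V: "x \<in> V" "extends_on M V \<eta> \<eta>'" by (rule formsE[OF assms(2,3)])
  have "open (U \<inter> V)" by (intro open_Int extends_onD(1)[OF U(2)] extends_onD(1)[OF V(2)])
  then show thesis
    by (intro that[of "U \<inter> V" \<omega>' \<eta>'] extends_on_subset[OF U(2)] extends_on_subset[OF V(2)])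
       (use U V in auto)
qed

lemma smooth_on_mult:
  fixes f g :: "'e::euclidean_space \<Rightarrow> 'b::real_normed_algebra"
  shows "open S \<Longrightarrow> smooth_on S f \<Longrightarrow> smooth_on S g \<Longrightarrow> smooth_on S (\<lambda>x. f x * g x)"
  by (rule smooth_on_bilinear[OF bounded_bilinear_mult])

text \<open>Tangent sets consist of velocities of curves, and their linearity is not automatic; for
  the manifolds in question it follows from explicit equations for the tangent vectors.\<close>

locale tangent_spaces =
  fixes M :: "'e::euclidean_space set"
  assumes subspace_tangent: "x \<in> M \<Longrightarrow> subspace (tangent M x)"
begin

lemma forms_zero: "(\<lambda>x vs. 0) \<in> forms M"
  by (rule formsI[OF subspace_tangent])
     (auto intro!: exI[of _ "\<lambda>x vs. 0"] local_extensionI[of UNIV] alt_zero)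

lemma forms_plus:
  assumes "\<omega> \<in> forms M" "\<eta> \<in> forms M" shows "form_plus \<omega> \<eta> \<in> forms M"
proof (rule formsI[OF subspace_tangent])
  fix x assume "x \<in> M"
  then obtain \<omega>' \<eta>' U where x: "x \<in> U" and e: "extends_on M U \<omega> \<omega>'" "extends_on M U \<eta> \<eta>'"
    by (rule local_extensions_common[OF assms])
  note * = x extends_onD[OF e(1)] extends_onD[OF e(2)]
  show "\<exists>\<zeta>. local_extension M (form_plus \<omega> \<eta>) x \<zeta>"
    by (intro exI[of _ "\<lambda>y vs. \<omega>' y vs + \<eta>' y vs"] local_extensionI[of U])
       (simp_all add: * alt_add smooth_on_add form_plus_def)
qed (auto simp: form_plus_def forms_outside[OF assms(1)] forms_outside[OF assms(2)])

lemma forms_wedge: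
  assumes "\<omega> \<in> forms M" "\<eta> \<in> forms M" shows "wedge \<omega> \<eta> \<in> forms M"
proof (rule formsI[OF subspace_tangent])
  fix x assume "x \<in> M"
  then obtain \<omega>' \<eta>' U where x: "x \<in> U" and e: "extends_on M U \<omega> \<omega>'" "extends_on M U \<eta> \<eta>'"
    by (rule local_extensions_common[OF assms])
  note * = x extends_onD[OF e(1)] extends_onD[OF e(2)]
  have "smooth_on U (\<lambda>y. wedge \<omega>' \<eta>' y vs)" for vs
    unfolding wedge_def by (intro smooth_on_sum smooth_on_mult smooth_on_const *)
  moreover have "wedge \<omega> \<eta> y vs = wedge \<omega>' \<eta>' y vs"
    if "y \<in> U" "y \<in> M" "set vs \<subseteq> tangent M y" for y vs
    by (rule wedge_local[OF that(3)]) (use * that in auto)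
  ultimately show "\<exists>\<zeta>. local_extension M (wedge \<omega> \<eta>) x \<zeta>"
    by (intro exI[of _ "wedge \<omega>' \<eta>'"] local_extensionI[of U]) (simp_all add: * alt_wedge)
next
  fix x vs assume out: "x \<notin> M \<or> \<not> set vs \<subseteq> tangent M x"
  \<comment> \<open>Every argument goes to one of the two factors, so a non-tangent argument makes
    one factor zero.\<close>
  have "\<omega> x (nths vs S) * \<eta> x (nths vs (- S)) = 0" for S
  proof (cases "x \<in> M")
    case True
    have "set vs \<subseteq> set (nths vs S) \<union> set (nths vs (- S))"
      by (auto simp: set_nths in_set_conv_nth) metis
    then have "\<not> set (nths vs S) \<subseteq> tangent M x \<or> \<not> set (nths vs (- S)) \<subseteq> tangent M x"
      using out True by blast
    with forms_outside[OF assms(1), of x "nths vs S"] forms_outside[OF assms(2), of x "nths vs (- S)"]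
    show ?thesis by auto
  qed (simp add: forms_outside[OF assms(1)])
  then show "wedge \<omega> \<eta> x vs = 0"
    unfolding wedge_def mult.assoc by (intro sum.neutral) simp
qed

lemma forms_homogeneous:
  assumes "\<omega> \<in> forms M" shows "homogeneous_part k \<omega> \<in> forms M"
proof (rule formsI[OF subspace_tangent])
  fix x assume "x \<in> M"
  then obtain \<eta> U where x: "x \<in> U" and e: "extends_on M U \<omega> \<eta>"
    by (rule formsE[OF assms])
  note * = x extends_onD[OF e]
  have "smooth_on U (\<lambda>y. if length vs = k then \<eta> y vs else 0)" for vs
    by (cases "length vs = k") (auto simp: *)
  then show "\<exists>\<zeta>. local_extension M (homogeneous_part k \<omega>) x \<zeta>"
    by (intro exI[of _ "\<lambda>y vs. if length vs = k then \<eta> y vs else 0"] local_extensionI[of U])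
       (simp_all add: * alt_homogeneous homogeneous_part_def)
qed (auto simp: homogeneous_part_def forms_outside[OF assms])

lemma forms_one_form:
  fixes \<phi> :: "'e \<Rightarrow> 'e \<Rightarrow> 'b::real_normed_field"
  assumes U: "open U" "M \<subseteq> U" and lin: "\<And>x. x \<in> U \<Longrightarrow> linear (\<phi> x)"
    and smooth: "\<And>v. smooth_on U (\<lambda>x. \<phi> x v)"
  shows "one_form M \<phi> \<in> forms M"
proof (rule formsI[OF subspace_tangent])
  fix x assume x: "x \<in> M"
  have "smooth_on U (\<lambda>y. if length vs = 1 then \<phi> y (hd vs) else 0)" for vs
    by (cases "length vs = 1") (auto simp: smooth)
  then show "\<exists>\<zeta>. local_extension M (one_form M \<phi>) x \<zeta>"
    by (intro exI[of _ "\<lambda>y vs. if length vs = 1 then \<phi> y (hd vs) else 0"] local_extensionI[of U])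
       (use U x alt_one[OF lin] in \<open>auto simp: one_form_def\<close>)
qed (auto simp: one_form_def)

lemma forms_zero_form:
  fixes f :: "'e \<Rightarrow> 'b::real_normed_field"
  assumes U: "open U" "M \<subseteq> U" and smooth: "smooth_on U f"
  shows "(\<lambda>x vs. if x \<in> M \<and> vs = [] then f x else 0) \<in> forms M"
proof (rule formsI[OF subspace_tangent])
  fix x assume x: "x \<in> M"
  have "alt (\<lambda>vs. if vs = [] then f y else 0)" for y
    by (rule altI) (auto intro: linear_zero_fun)
  moreover have "smooth_on U (\<lambda>y. if vs = [] then f y else 0)" for vs :: "'e list"
    by (cases "vs = []") (auto simp: smooth)
  ultimately show "\<exists>\<zeta>. local_extension M (\<lambda>x vs. if x \<in> M \<and> vs = [] then f x else 0) x \<zeta>"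
    by (intro exI[of _ "\<lambda>y vs. if vs = [] then f y else 0"] local_extensionI[of U])
       (use U x in \<open>auto\<close>)
qed auto

text \<open>A scalar acts as the wedge product with a constant 0-form, cut off outside
  \<open>M\<close>, where the forms in \<open>I\<close> vanish as well. With complex
  \<open>c\<close> it serves to take real and imaginary parts of generators.\<close>

lemma graded_ideal_scale:
  fixes c :: "'b::real_normed_field"
  assumes "graded_ideal M I" "\<omega> \<in> I"
  shows "(\<lambda>x vs. c * \<omega> x vs) \<in> I"
proof -
  let ?c = "\<lambda>x vs. if x \<in> M \<and> vs = [] then c else 0 :: 'b"
  have "wedge ?c \<omega> \<in> I"
    using assms forms_zero_form[of UNIV "\<lambda>x. c", OF _ _ smooth_on_const] unfolding graded_ideal_def by auto
  moreover have "\<omega> x vs = 0" if "x \<notin> M" for x vs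
    using assms that unfolding graded_ideal_def by (blast intro: forms_outside)
  then have "wedge ?c \<omega> x vs = c * \<omega> x vs" for x vs
    by (subst wedge_degree0) auto
  then have "wedge ?c \<omega> = (\<lambda>x vs. c * \<omega> x vs)" by (intro ext)
  ultimately show ?thesis by simp
qed

lemma graded_ideal_sum:
  assumes "graded_ideal M I" "\<And>i. i \<in> A \<Longrightarrow> \<omega> i \<in> I"
  shows "(\<lambda>x vs. \<Sum>i\<in>A. \<omega> i x vs) \<in> I"
  using assms(2)
proof (induction A rule: infinite_finite_induct)
  case (insert a A)
  then have "form_plus (\<omega> a) (\<lambda>x vs. \<Sum>i\<in>A. \<omega> i x vs) \<in> I"
    using assms(1) unfolding graded_ideal_def by blast
  with insert show ?case by (simp add: form_plus_def)
qed (use assms(1) in \<open>auto simp: graded_ideal_def\<close>)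

lemma graded_ideal_forms: "graded_ideal M (forms M)"
  unfolding graded_ideal_def by (auto intro: forms_zero forms_plus forms_wedge forms_homogeneous)

lemma forms_scale: "\<omega> \<in> forms M \<Longrightarrow> (\<lambda>x vs. c * \<omega> x vs) \<in> forms M"
  by (rule graded_ideal_scale[OF graded_ideal_forms])

lemma sum_homogeneous_parts:
  assumes "\<omega> \<in> forms M"
  shows "\<omega> = (\<lambda>x vs. \<Sum>k\<le>DIM('e). homogeneous_part k \<omega> x vs)"
proof (intro ext)
  fix x vs
  have "\<omega> x vs = 0" if big: "length vs > DIM('e)"
  proof (cases "x \<in> M \<and> set vs \<subseteq> tangent M x")
    case True
    then obtain \<eta> U where "x \<in> U" "extends_on M U \<omega> \<eta>"
      using formsE[OF assms] by metis
    then show ?thesis using True extends_onD(2,4) alt_degree_bound[OF _ big] by metis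
  qed (use forms_outside[OF assms] in blast)
  then show "\<omega> x vs = (\<Sum>k\<le>DIM('e). homogeneous_part k \<omega> x vs)"
    by (cases "length vs > DIM('e)") (auto simp: homogeneous_part_def)
qed

end

text \<open>Smoothness of a form is given for constant arguments; expanding one varying argument at
  a time in \<open>Basis\<close> reduces to these.\<close>

lemma smooth_on_alt_fields:
  fixes \<eta> :: "'e::euclidean_space \<Rightarrow> 'f::euclidean_space list \<Rightarrow> 'b::real_normed_field"
  assumes U: "open U" and alt: "\<And>y. y \<in> U \<Longrightarrow> alt (\<eta> y)" and smooth: "\<And>vs. smooth_on U (\<lambda>y. \<eta> y vs)"
    and Z: "\<And>Z. Z \<in> set Zs \<Longrightarrow> smooth_on U Z"
  shows "smooth_on U (\<lambda>y. \<eta> y (map (\<lambda>Z. Z y) Zs))"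
  using alt smooth Z
proof (induction Zs arbitrary: \<eta>)
  case (Cons Z Zs)
  have "smooth_on U (\<lambda>y. \<eta> y (b # map (\<lambda>Z. Z y) Zs))" for b
    by (rule Cons.IH[of "\<lambda>y us. \<eta> y (b # us)"]) (use Cons.prems in \<open>auto intro: alt_Cons\<close>)
  moreover have "smooth_on U (\<lambda>y. Z y \<bullet> b)" for b
    using Cons.prems(3) by (auto intro: smooth_on_linear[OF bounded_linear_inner_left U])
  ultimately have "smooth_on U (\<lambda>y. \<Sum>b\<in>Basis. (Z y \<bullet> b) *\<^sub>R \<eta> y (b # map (\<lambda>Z. Z y) Zs))"
    by (intro smooth_on_sum[OF U] smooth_on_bilinear[OF bounded_bilinear_scaleR U])
  then show ?case
    by (rule smooth_on_cong[OF U, rotated]) (use alt_expand[OF Cons.prems(1)] in simp)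
qed simp

text \<open>Covers two constructions at once: with \<open>F\<close> the identity it is contraction
  with the fields \<open>Zs\<close> and composition with \<open>L\<close>; with \<open>Zs\<close>
  empty and \<open>L\<close> the derivative of \<open>F\<close> it is the pullback.\<close>

lemma forms_transport:
  fixes F :: "'e::euclidean_space \<Rightarrow> 'f::euclidean_space" and \<theta> :: "('f, 'b::real_normed_field) form"
  assumes \<theta>: "\<theta> \<in> forms N" and sub: "\<And>x. x \<in> M \<Longrightarrow> subspace (tangent M x)"
    and U: "open U" "M \<subseteq> U" and F: "smooth_on U F" "F ` M \<subseteq> N"
    and Z: "\<And>Z. Z \<in> set Zs \<Longrightarrow> smooth_on U Z" "\<And>Z x. Z \<in> set Zs \<Longrightarrow> x \<in> M \<Longrightarrow> Z x \<in> tangent N (F x)"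
    and L: "\<And>x. x \<in> U \<Longrightarrow> linear (L x)" "\<And>v. smooth_on U (\<lambda>x. L x v)"
      "\<And>x v. x \<in> M \<Longrightarrow> v \<in> tangent M x \<Longrightarrow> L x v \<in> tangent N (F x)"
  shows "(\<lambda>x vs. if x \<in> M \<and> set vs \<subseteq> tangent M x
      then \<theta> (F x) (map (\<lambda>Z. Z x) Zs @ map (L x) vs) else 0) \<in> forms M" (is "?\<omega> \<in> _")
proof (rule formsI[OF sub])
  fix x assume x: "x \<in> M"
  then have "F x \<in> N" using F(2) by auto
  then obtain \<eta> V where Fx: "F x \<in> V" and e: "extends_on N V \<theta> \<eta>" by (rule formsE[OF \<theta>])
  note V = extends_onD(1)[OF e] Fx extends_onD(2-4)[OF e]
  define W where "W = F -` V \<inter> U"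
  have "continuous_on U F" using F(1) unfolding smooth_on_def by (metis ck_on.simps(1))
  then have W: "open W" "W \<subseteq> U" "x \<in> W" "F ` W \<subseteq> V"
    using continuous_on_open_vimage[OF U(1)] V(1,2) U x unfolding W_def by auto
  have smW: "smooth_on W (\<lambda>y. \<eta> (F y) vs)" for vs
    by (rule smooth_on_compose[OF W(1) V(1) W(4) smooth_on_subset[OF F(1) W(2)] V(4)])
  have FW: "F y \<in> V" if "y \<in> W" for y using W(4) that by blast
  note altW = V(3)[OF FW]
  have "smooth_on W (\<lambda>y. \<eta> (F y) (map (\<lambda>Z. Z y) (Zs @ map (\<lambda>v x. L x v) vs)))" for vs
    by (rule smooth_on_alt_fields[OF W(1) altW smW])
       (use smooth_on_subset[OF Z(1) W(2)] smooth_on_subset[OF L(2) W(2)] in auto)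
  then have smooth: "smooth_on W (\<lambda>y. \<eta> (F y) (map (\<lambda>Z. Z y) Zs @ map (L y) vs))" for vs
    by (simp add: o_def)
  show "\<exists>\<zeta>. local_extension M ?\<omega> x \<zeta>"
  proof (intro exI[of _ "\<lambda>y vs. \<eta> (F y) (map (\<lambda>Z. Z y) Zs @ map (L y) vs)"] local_extensionI[of W])
    fix y vs assume y: "y \<in> W" "y \<in> M" "set vs \<subseteq> tangent M y"
    have "set (map (\<lambda>Z. Z y) Zs @ map (L y) vs) \<subseteq> tangent N (F y)"
      using Z(2) L(3) y by auto
    then show "?\<omega> y vs = \<eta> (F y) (map (\<lambda>Z. Z y) Zs @ map (L y) vs)"
      using y F(2) V(5)[OF FW[OF y(1)]] by (simp add: image_subset_iff)
  next
    fix y assume y: "y \<in> W"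
    then have "alt (\<lambda>us. \<eta> (F y) (map (\<lambda>Z. Z y) Zs @ us))"
      by (intro alt_append altW)
    then show "alt (\<lambda>vs. \<eta> (F y) (map (\<lambda>Z. Z y) Zs @ map (L y) vs))"
      by (rule alt_map) (use L(1) y W(2) in auto)
  qed (use W smooth in auto)
qed auto

subsection \<open>The exterior derivative\<close>

lemma euclidean_d_Nil [simp]: "euclidean_d \<omega> x [] = 0"
  by (simp add: euclidean_d_def)

lemma euclidean_d_Cons:
  "euclidean_d \<omega> x (v # vs) =
    frechet_derivative (\<lambda>y. \<omega> y vs) (at x) v - euclidean_d (\<lambda>y us. \<omega> y (v # us)) x vs"
  by (simp add: euclidean_d_def sum.lessThan_Suc_shift sum_negf del: sum.lessThan_Suc)

lemma frechet_derivative_zero: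
  assumes "open U" "x \<in> U" "\<And>y. y \<in> U \<Longrightarrow> f y = 0"
  shows "frechet_derivative f (at x) = (\<lambda>h. 0)"
proof -
  have "(f has_derivative (\<lambda>h. 0)) (at x)"
    by (rule has_derivative_transform_within_open[OF has_derivative_const assms(1,2)])
       (simp add: assms(3))
  then show ?thesis by (metis frechet_derivative_at)
qed

lemma frechet_derivative_slot:
  fixes \<eta> :: "'e::euclidean_space \<Rightarrow> 'f::euclidean_space list \<Rightarrow> 'b::real_normed_field"
  assumes U: "open U" "x \<in> U" and alt: "\<And>y. y \<in> U \<Longrightarrow> alt (\<eta> y)"
    and smooth: "\<And>vs. smooth_on U (\<lambda>y. \<eta> y vs)"
  shows "linear (\<lambda>u. frechet_derivative (\<lambda>y. \<eta> y (as @ u # bs)) (at x) h)"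
proof (rule linear_slotI)
  fix c d :: real and u w
  let ?D = "\<lambda>u. frechet_derivative (\<lambda>y. \<eta> y (as @ u # bs)) (at x)"
  have D: "((\<lambda>y. \<eta> y (as @ u # bs)) has_derivative ?D u) (at x)" for u
    by (rule smooth_on_has_derivative[OF smooth U(2)])
  have "((\<lambda>y. c *\<^sub>R \<eta> y (as @ u # bs) + d *\<^sub>R \<eta> y (as @ w # bs)) has_derivative
      (\<lambda>h. c *\<^sub>R ?D u h + d *\<^sub>R ?D w h)) (at x)"
    by (intro has_derivative_add has_derivative_scaleR_right D)
  then have "((\<lambda>y. \<eta> y (as @ (c *\<^sub>R u + d *\<^sub>R w) # bs)) has_derivative
      (\<lambda>h. c *\<^sub>R ?D u h + d *\<^sub>R ?D w h)) (at x)"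
    by (rule has_derivative_transform_within_open[OF _ U]) (simp add: alt_linear[OF alt])
  from fun_cong[OF frechet_derivative_at[OF this], of h]
  show "?D (c *\<^sub>R u + d *\<^sub>R w) h = c *\<^sub>R ?D u h + d *\<^sub>R ?D w h" by simp
qed

lemma euclidean_d_slot_linear:
  fixes G :: "'e::euclidean_space \<Rightarrow> 'e \<Rightarrow> 'e list \<Rightarrow> 'b::real_normed_field"
  assumes "\<And>us h. linear (\<lambda>u. frechet_derivative (\<lambda>y. G u y us) (at x) h)"
  shows "linear (\<lambda>u. euclidean_d (G u) x vs)"
  using assms
proof (induction vs arbitrary: G)
  case (Cons v vs)
  have "linear (\<lambda>u. euclidean_d (\<lambda>y us. G u y (v # us)) x vs)"
    by (rule Cons.IH) (rule Cons.prems)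
  then show ?case unfolding euclidean_d_Cons
    by (intro linear_compose_sub Cons.prems)
qed (simp add: linear_zero_fun)

text \<open>With two equal adjacent arguments \<open>z\<close>, the two terms that differentiate
  along \<open>z\<close> cancel by sign; all others differentiate a function that vanishes near
  \<open>x\<close>.\<close>

lemma alt_euclidean_d:
  fixes \<eta> :: "'e::euclidean_space \<Rightarrow> 'e list \<Rightarrow> 'b::real_normed_field"
  assumes U: "open U" "x \<in> U" and "\<And>y. y \<in> U \<Longrightarrow> alt (\<eta> y)" "\<And>vs. smooth_on U (\<lambda>y. \<eta> y vs)"
  shows "alt (euclidean_d \<eta> x)"
proof (rule altI)
  fix as bs
  show "linear (\<lambda>u. euclidean_d \<eta> x (as @ u # bs))"
    using assms(3,4)
  proof (induction as arbitrary: \<eta>)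
    case Nil
    have "linear (frechet_derivative (\<lambda>y. \<eta> y bs) (at x))"
      by (rule has_derivative_linear[OF smooth_on_has_derivative[OF Nil(2) U(2)]])
    moreover have "linear (\<lambda>u. euclidean_d (\<lambda>y us. \<eta> y (u # us)) x bs)"
      using frechet_derivative_slot[OF U Nil, of "[]"] by (intro euclidean_d_slot_linear) simp
    ultimately show ?case unfolding append_Nil euclidean_d_Cons by (intro linear_compose_sub)
  next
    case (Cons a as)
    show ?case unfolding append_Cons euclidean_d_Cons
      by (intro linear_compose_sub frechet_derivative_slot[OF U] Cons alt_Cons)
  qed
next
  fix as bs and z :: 'e
  show "euclidean_d \<eta> x (as @ z # z # bs) = 0"
    using assms(3,4)
  proof (induction as arbitrary: \<eta>)
    case Nil
    have "euclidean_d (\<lambda>y us. \<eta> y (z # z # us)) x bs = euclidean_d (\<lambda>y us. 0) x bs"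
      unfolding euclidean_d_def
    proof (intro sum.cong refl arg_cong2[of _ _ _ _ times])
      fix i
      have "frechet_derivative (\<lambda>y. \<eta> y (z # z # us)) (at x) = (\<lambda>h. 0)" for us
        using alt_adjacent[OF Nil(1), of _ "[]"] by (intro frechet_derivative_zero[OF U]) simp
      then show "frechet_derivative (\<lambda>y. \<eta> y (z # z # take i bs @ drop (Suc i) bs)) (at x) (bs ! i) =
          frechet_derivative (\<lambda>y. 0) (at x) (bs ! i)" by simp
    qed
    also have "\<dots> = 0" by (simp add: euclidean_d_def)
    finally show ?case by (simp add: euclidean_d_Cons)
  next
    case (Cons a as)
    have "frechet_derivative (\<lambda>y. \<eta> y (as @ z # z # bs)) (at x) = (\<lambda>h. 0)"
      using alt_adjacent[OF Cons.prems(1)] by (intro frechet_derivative_zero[OF U])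
    then show ?case by (simp add: euclidean_d_Cons Cons alt_Cons)
  qed
qed

text \<open>\<open>alg_d\<close> is the algebraic part of the exterior derivative, applied to a family of
  directional derivatives; \<open>der L\<close> extends an endomorphism to a derivation.\<close>
primrec alg_d :: "('e \<Rightarrow> 'e list \<Rightarrow> 'b::real_normed_field) \<Rightarrow> 'e list \<Rightarrow> 'b" where
  "alg_d G [] = 0"
| "alg_d G (v # vs) = G v vs - alg_d (\<lambda>a us. G a (v # us)) vs"

primrec der :: "('e \<Rightarrow> 'e) \<Rightarrow> ('e list \<Rightarrow> 'b::real_normed_field) \<Rightarrow> 'e list \<Rightarrow> 'b" where
  "der L \<phi> [] = 0"
| "der L \<phi> (v # vs) = \<phi> (L v # vs) + der L (\<lambda>us. \<phi> (v # us)) vs"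

lemma euclidean_d_eq_alg_d:
  "euclidean_d \<omega> x vs = alg_d (\<lambda>v us. frechet_derivative (\<lambda>y. \<omega> y us) (at x) v) vs"
  by (induction vs arbitrary: \<omega>) (simp_all add: euclidean_d_Cons)

lemma alg_d_cong:
  "(\<And>v us. v \<in> T \<Longrightarrow> set us \<subseteq> T \<Longrightarrow> G v us = H v us) \<Longrightarrow> set vs \<subseteq> T \<Longrightarrow> alg_d G vs = alg_d H vs"
proof (induction vs arbitrary: G H)
  case (Cons v vs)
  have "alg_d (\<lambda>a us. G a (v # us)) vs = alg_d (\<lambda>a us. H a (v # us)) vs"
    by (rule Cons.IH, rule Cons.prems(1)) (use Cons.prems(2) in auto)
  with Cons.prems(1)[of v vs] Cons.prems(2) show ?case by simp
qed simp

lemma alg_d_uminus: "alg_d (\<lambda>v us. - G v us) vs = - alg_d G vs"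
  by (induction vs arbitrary: G) simp_all

lemma alg_d_add: "alg_d (\<lambda>v us. G v us + H v us) vs = alg_d G vs + alg_d H vs"
  by (induction vs arbitrary: G H) simp_all

lemma alg_d_diff: "alg_d (\<lambda>v us. G v us - H v us) vs = alg_d G vs - alg_d H vs"
  by (induction vs arbitrary: G H) simp_all

text \<open>Moving \<open>L a\<close> past \<open>v\<close> costs the same sign as the recursion of
  \<open>alg_d\<close>, so the alternating sum becomes the plain sum over the positions of
  \<open>L\<close>.\<close>

lemma alg_d_contract:
  assumes "alt \<phi>"
  shows "alg_d (\<lambda>a us. \<phi> (L a # us)) vs = der L \<phi> vs"
  using assms
proof (induction vs arbitrary: \<phi>)
  case (Cons v vs)
  have "(\<lambda>a us. \<phi> (L a # v # us)) = (\<lambda>a us. - \<phi> (v # L a # us))"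
    using alt_swap[OF Cons.prems, of "[]" "L _" v] by (intro ext) simp
  then have "alg_d (\<lambda>a us. \<phi> (L a # v # us)) vs = - alg_d (\<lambda>a us. \<phi> (v # L a # us)) vs"
    by (simp only: alg_d_uminus)
  also have "\<dots> = - der L (\<lambda>us. \<phi> (v # us)) vs"
    using Cons.IH[OF alt_Cons[OF Cons.prems]] by simp
  finally show ?case by simp
qed simp

lemma der_cong: "(\<And>v. v \<in> T \<Longrightarrow> L v = L' v) \<Longrightarrow> set vs \<subseteq> T \<Longrightarrow> der L \<phi> vs = der L' \<phi> vs"
proof (induction vs arbitrary: \<phi>)
  case (Cons v vs)
  from Cons.IH[OF Cons.prems(1)] Cons.prems(1)[of v] Cons.prems(2) show ?case by simp
qed simp

text \<open>Each pair of arguments contributes through \<open>B a v\<close> and \<open>B v a\<close>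
  with opposite signs. The second fundamental form will take the place of \<open>B\<close>.\<close>

lemma alg_d_der_symmetric:
  assumes "\<And>u v. u \<in> T \<Longrightarrow> v \<in> T \<Longrightarrow> B u v = B v u" "alt \<phi>" "set vs \<subseteq> T"
  shows "alg_d (\<lambda>a us. der (B a) \<phi> us) vs = 0"
  using assms(2,3)
proof (induction vs arbitrary: \<phi>)
  case (Cons v vs)
  have v: "v \<in> T" "set vs \<subseteq> T" using Cons.prems by auto
  have "alg_d (\<lambda>a us. der (B a) \<phi> (v # us)) vs =
      alg_d (\<lambda>a us. \<phi> (B a v # us)) vs + alg_d (\<lambda>a us. der (B a) (\<lambda>us. \<phi> (v # us)) us) vs"
    by (simp add: alg_d_add)
  also have "alg_d (\<lambda>a us. \<phi> (B a v # us)) vs = der (\<lambda>a. B a v) \<phi> vs"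
    by (rule alg_d_contract[OF Cons.prems(1)])
  also have "\<dots> = der (B v) \<phi> vs"
    by (rule der_cong[of T]) (use v assms(1) in auto)
  also have "alg_d (\<lambda>a us. der (B a) (\<lambda>us. \<phi> (v # us)) us) vs = 0"
    by (rule Cons.IH[OF alt_Cons[OF Cons.prems(1)] v(2)])
  finally show ?case by simp
qed simp

lemma der_linear:
  assumes "\<And>us. linear (\<lambda>u. \<phi> u us)"
  shows "linear (\<lambda>u. der L (\<phi> u) us)"
  using assms
proof (induction us arbitrary: \<phi>)
  case (Cons v us)
  have "linear (\<lambda>u. der L (\<lambda>us. \<phi> u (v # us)) us)" by (rule Cons.IH) (rule Cons.prems)
  then show ?case by (simp add: linear_compose_add Cons.prems)
qed (simp add: linear_zero_fun)

lemma linear_basis_sum: "linear f \<Longrightarrow> f u = (\<Sum>b\<in>Basis. (u \<bullet> b) *\<^sub>R f b)"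
  for f :: "'e::euclidean_space \<Rightarrow> 'b::real_vector"
  by (metis (no_types, lifting) euclidean_representation linear_scale linear_sum sum.cong)

text \<open>Product rule for a form evaluated on fields \<open>Y y u\<close> with value
  \<open>u\<close> at \<open>x\<close>: the first summand differentiates the form, the derivation
  \<open>der\<close> the arguments.\<close>

lemma has_derivative_alt_fields:
  fixes \<eta> :: "'e::euclidean_space \<Rightarrow> 'e list \<Rightarrow> 'b::real_normed_field"
  assumes U: "open U" "x \<in> U" and alt: "\<And>y. y \<in> U \<Longrightarrow> alt (\<eta> y)"
    and smooth: "\<And>vs. smooth_on U (\<lambda>y. \<eta> y vs)"
    and Y: "\<And>u. u \<in> set us \<Longrightarrow> ((\<lambda>y. Y y u) has_derivative (\<lambda>h. Y' h u)) (at x)"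
      "\<And>u. u \<in> set us \<Longrightarrow> Y x u = u"
  shows "((\<lambda>y. \<eta> y (map (Y y) us)) has_derivative
    (\<lambda>h. frechet_derivative (\<lambda>y. \<eta> y us) (at x) h + der (Y' h) (\<eta> x) us)) (at x)"
  using alt smooth Y
proof (induction us arbitrary: \<eta>)
  case Nil
  show ?case using smooth_on_has_derivative[OF Nil(2)[of "[]"] U(2)] by simp
next
  case (Cons u us)
  let ?D = "\<lambda>vs. frechet_derivative (\<lambda>y. \<eta> y vs) (at x)"
  have map: "map (Y x) us = us" using Cons.prems(4) by (simp add: map_idI)
  have IH: "((\<lambda>y. \<eta> y (b # map (Y y) us)) has_derivative
      (\<lambda>h. ?D (b # us) h + der (Y' h) (\<lambda>vs. \<eta> x (b # vs)) us)) (at x)" for b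
    by (rule Cons.IH[of "\<lambda>y vs. \<eta> y (b # vs)"]) (use Cons.prems in \<open>auto intro: alt_Cons\<close>)
  have "((\<lambda>y. \<Sum>b\<in>Basis. (Y y u \<bullet> b) *\<^sub>R \<eta> y (b # map (Y y) us)) has_derivative
      (\<lambda>h. \<Sum>b\<in>Basis. (Y x u \<bullet> b) *\<^sub>R (?D (b # us) h + der (Y' h) (\<lambda>vs. \<eta> x (b # vs)) us)
        + (Y' h u \<bullet> b) *\<^sub>R \<eta> x (b # map (Y x) us))) (at x)"
    by (intro has_derivative_sum has_derivative_scaleR IH has_derivative_inner_left Cons.prems(3)) simp
  then have D: "((\<lambda>y. \<eta> y (Y y u # map (Y y) us)) has_derivative
      (\<lambda>h. \<Sum>b\<in>Basis. (Y x u \<bullet> b) *\<^sub>R (?D (b # us) h + der (Y' h) (\<lambda>vs. \<eta> x (b # vs)) us)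
        + (Y' h u \<bullet> b) *\<^sub>R \<eta> x (b # map (Y x) us))) (at x)"
    by (rule has_derivative_transform_within_open[OF _ U]) (rule alt_expand[OF Cons.prems(1), symmetric])
  have eq: "(\<Sum>b\<in>Basis. (Y x u \<bullet> b) *\<^sub>R (?D (b # us) h + der (Y' h) (\<lambda>vs. \<eta> x (b # vs)) us)
        + (Y' h u \<bullet> b) *\<^sub>R \<eta> x (b # map (Y x) us)) =
      ?D (u # us) h + der (Y' h) (\<eta> x) (u # us)" for h
  proof -
    have alt: "alt (\<eta> x)" by (rule Cons.prems(1)[OF U(2)])
    have 1: "?D (u # us) h = (\<Sum>b\<in>Basis. (u \<bullet> b) *\<^sub>R ?D (b # us) h)"
      by (rule linear_basis_sum) (use frechet_derivative_slot[OF U Cons.prems(1,2), of "[]"] in simp)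
    have 2: "der (Y' h) (\<lambda>vs. \<eta> x (u # vs)) us =
        (\<Sum>b\<in>Basis. (u \<bullet> b) *\<^sub>R der (Y' h) (\<lambda>vs. \<eta> x (b # vs)) us)"
      by (rule linear_basis_sum, rule der_linear) (use alt_slot_linear[OF alt, of "[]"] in simp)
    have 3: "\<eta> x (Y' h u # us) = (\<Sum>b\<in>Basis. (Y' h u \<bullet> b) *\<^sub>R \<eta> x (b # us))"
      by (rule alt_expand[OF alt])
    show ?thesis
      using Cons.prems(4)[of u]
      by (simp add: map der.simps 1 2 3 scaleR_add_right sum.distrib)
  qed
  show ?case
    using has_derivative_eq_rhs[OF D ext[OF eq]] by simp
qed

section \<open>Derivatives along curves in a submanifold\<close>

lemma has_derivative_along_tangent:
  assumes f: "(f has_derivative f') (at x within M)" and v: "v \<in> tangent M x"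
  obtains c where "\<forall>t. c t \<in> M" "c 0 = x" "(c has_vector_derivative v) (at 0)"
    "((\<lambda>t. f (c t)) has_vector_derivative f' v) (at 0)"
proof -
  obtain c where c: "\<forall>t. c t \<in> M" "c 0 = x" "(c has_vector_derivative v) (at 0)"
    using v unfolding tangent_def by blast
  have "(f has_derivative f') (at (c 0) within c ` UNIV)"
    using has_derivative_subset[OF f, of "range c"] c(1,2) by (simp add: image_subset_iff)
  then have "((f \<circ> c) has_vector_derivative f' v) (at 0)"
    using vector_derivative_diff_chain_within[of c v 0 UNIV f f'] c(3) by simp
  then show thesis using c by (intro that[of c]) (simp_all add: o_def)
qed

text \<open>A derivative within \<open>M\<close> need not be unique on the ambient space. Along a
  curve in \<open>M\<close>, however, the two composites agree near 0 and therefore have the same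
  velocity.\<close>

lemma derivative_unique_on_tangent:
  assumes "(f has_derivative f') (at x within M)" "(g has_derivative g') (at x within M)"
    "open U" "x \<in> U" "\<And>y. y \<in> U \<inter> M \<Longrightarrow> f y = g y" "v \<in> tangent M x"
  shows "f' v = g' v"
proof -
  have "((\<lambda>y. f y - g y) has_derivative (\<lambda>h. f' h - g' h)) (at x within M)"
    by (intro has_derivative_diff assms)
  then obtain c where c: "\<forall>t. c t \<in> M" "c 0 = x" "(c has_vector_derivative v) (at 0)"
    "((\<lambda>t. f (c t) - g (c t)) has_vector_derivative f' v - g' v) (at 0)"
    by (rule has_derivative_along_tangent[OF _ assms(6)])
  have "isCont c 0" using c(3) has_vector_derivative_continuous by blast
  then have "\<forall>\<^sub>F t in at 0. c t \<in> U"
    using c(2) assms(3,4) unfolding isCont_def tendsto_def by auto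
  then have ev: "\<forall>\<^sub>F t in at 0. f (c t) - g (c t) = 0"
    by (rule eventually_mono) (use c(1) assms(5) in auto)
  have "((\<lambda>t. 0) has_vector_derivative f' v - g' v) (at 0)"
    unfolding has_vector_derivative_def
    by (rule has_derivative_transform_eventually[OF c(4)[unfolded has_vector_derivative_def] ev])
       (use c(1,2) assms(4,5) in auto)
  then show ?thesis
    using vector_derivative_unique_at[OF _ has_vector_derivative_const] by force
qed

lemma derivative_tangent:
  assumes "(f has_derivative f') (at x within M)" "f ` M \<subseteq> N" "v \<in> tangent M x"
  shows "f' v \<in> tangent N (f x)"
proof -
  obtain c where "\<forall>t. c t \<in> M" "c 0 = x" "((\<lambda>t. f (c t)) has_vector_derivative f' v) (at 0)"
    by (rule has_derivative_along_tangent[OF assms(1,3)])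
  then show ?thesis
    unfolding tangent_def using assms(2) by (auto intro!: exI[of _ "\<lambda>t. f (c t)"])
qed

text \<open>The symmetry assumption says that \<open>pr' x\<close> restricts to the second fundamental form.\<close>
locale projected_manifold = tangent_spaces M for M :: "'e::euclidean_space set" +
  fixes pr :: "'e \<Rightarrow> 'e \<Rightarrow> 'e" and pr' :: "'e \<Rightarrow> 'e \<Rightarrow> 'e \<Rightarrow> 'e"
  assumes pr_tangent: "x \<in> M \<Longrightarrow> pr x v \<in> tangent M x"
    and pr_ident: "x \<in> M \<Longrightarrow> v \<in> tangent M x \<Longrightarrow> pr x v = v"
    and pr_derivative: "((\<lambda>y. pr y v) has_derivative (\<lambda>h. pr' x h v)) (at x)"
    and pr'_symmetric: "x \<in> M \<Longrightarrow> u \<in> tangent M x \<Longrightarrow> v \<in> tangent M x \<Longrightarrow> pr' x u v = pr' x v u"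
begin

text \<open>Replacing the constant arguments \<open>us\<close> by \<open>map (pr y) us\<close> gives
  a function that is zero on \<open>M\<close>, so the derivative of \<eta> in a tangent direction is
  minus the term from differentiating \<open>pr\<close>. That term is symmetric in two tangent
  vectors and drops out under alternation.\<close>

lemma euclidean_d_vanishes:
  fixes \<eta> :: "('e, 'b::real_normed_field) form"
  assumes U: "open U" "x \<in> U" and alt: "\<And>y. y \<in> U \<Longrightarrow> alt (\<eta> y)"
    and smooth: "\<And>vs. smooth_on U (\<lambda>y. \<eta> y vs)" and x: "x \<in> M"
    and zero: "\<And>y vs. y \<in> U \<Longrightarrow> y \<in> M \<Longrightarrow> set vs \<subseteq> tangent M y \<Longrightarrow> \<eta> y vs = 0"
    and vs: "set vs \<subseteq> tangent M x"
  shows "euclidean_d \<eta> x vs = 0"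
proof -
  have "frechet_derivative (\<lambda>y. \<eta> y us) (at x) v = - der (pr' x v) (\<eta> x) us"
    if v: "v \<in> tangent M x" and us: "set us \<subseteq> tangent M x" for v us
  proof -
    have D: "((\<lambda>y. \<eta> y (map (pr y) us)) has_derivative
        (\<lambda>h. frechet_derivative (\<lambda>y. \<eta> y us) (at x) h + der (pr' x h) (\<eta> x) us)) (at x)"
      by (rule has_derivative_alt_fields[OF U alt smooth pr_derivative])
         (use us x pr_ident in auto)
    have "frechet_derivative (\<lambda>y. \<eta> y us) (at x) v + der (pr' x v) (\<eta> x) us = 0"
    proof (rule derivative_unique_on_tangent[OF has_derivative_at_withinI[OF D] has_derivative_const U _ v])
      show "\<eta> y (map (pr y) us) = 0" if "y \<in> U \<inter> M" for y
        by (rule zero) (use that pr_tangent in auto)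
    qed
    then show ?thesis by (simp add: eq_neg_iff_add_eq_0)
  qed
  then have "euclidean_d \<eta> x vs = alg_d (\<lambda>v us. - der (pr' x v) (\<eta> x) us) vs"
    unfolding euclidean_d_eq_alg_d by (intro alg_d_cong[OF _ vs]) auto
  also have "\<dots> = 0"
    using alg_d_der_symmetric[OF pr'_symmetric[OF x] alt[OF U(2)] vs] by (simp add: alg_d_uminus)
  finally show ?thesis .
qed

text \<open>Removes the choice in \<open>ext_d\<close>: two extensions differ by a form to which
  \<open>euclidean_d_vanishes\<close> applies.\<close>

lemma ext_d_eq:
  fixes \<omega> :: "('e, 'b::real_normed_field) form"
  assumes e: "extends_on M U \<omega> \<eta>" and x: "x \<in> U" "x \<in> M" and vs: "set vs \<subseteq> tangent M x"
  shows "ext_d M \<omega> x vs = euclidean_d \<eta> x vs"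
proof -
  define \<zeta> where "\<zeta> = (SOME \<zeta>. local_extension M \<omega> x \<zeta>)"
  have "local_extension M \<omega> x \<zeta>"
    unfolding \<zeta>_def by (rule someI[of _ \<eta>]) (use e x local_extension_iff in blast)
  then obtain V where V: "x \<in> V" "extends_on M V \<omega> \<zeta>" unfolding local_extension_iff by blast
  let ?W = "U \<inter> V"
  have W: "open ?W" "x \<in> ?W" using extends_onD(1)[OF e] extends_onD(1)[OF V(2)] x V by auto
  have e': "extends_on M ?W \<omega> \<eta>" "extends_on M ?W \<omega> \<zeta>"
    using extends_on_subset[OF e W(1)] extends_on_subset[OF V(2) W(1)] by auto
  let ?\<delta> = "\<lambda>y vs. \<eta> y vs + - 1 * \<zeta> y vs"
  have "euclidean_d ?\<delta> x vs = 0"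
  proof (rule euclidean_d_vanishes[OF W])
    show "alt (?\<delta> y)" if "y \<in> ?W" for y
      by (intro alt_add alt_mult extends_onD(2)[OF e'(1) that] extends_onD(2)[OF e'(2) that])
    show "smooth_on ?W (\<lambda>y. ?\<delta> y vs)" for vs
      by (intro smooth_on_add smooth_on_mult smooth_on_const W(1) extends_onD(3)[OF e'(1)] extends_onD(3)[OF e'(2)])
    show "?\<delta> y vs = 0" if "y \<in> ?W" "y \<in> M" "set vs \<subseteq> tangent M y" for y vs
      using extends_onD(4)[OF e'(1) that] extends_onD(4)[OF e'(2) that] by simp
  qed (use x vs in auto)
  moreover have "frechet_derivative (\<lambda>y. ?\<delta> y us) (at x) v =
      frechet_derivative (\<lambda>y. \<eta> y us) (at x) v + - frechet_derivative (\<lambda>y. \<zeta> y us) (at x) v" for us v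
  proof -
    have "((\<lambda>y. ?\<delta> y us) has_derivative (\<lambda>h. frechet_derivative (\<lambda>y. \<eta> y us) (at x) h
        + - 1 * frechet_derivative (\<lambda>y. \<zeta> y us) (at x) h)) (at x)"
      by (intro has_derivative_add has_derivative_mult_right
          smooth_on_has_derivative[OF extends_onD(3)[OF e'(1)] W(2)]
          smooth_on_has_derivative[OF extends_onD(3)[OF e'(2)] W(2)])
    from fun_cong[OF frechet_derivative_at[OF this], of v] show ?thesis by simp
  qed
  ultimately have "euclidean_d \<eta> x vs = euclidean_d \<zeta> x vs"
    by (simp add: euclidean_d_eq_alg_d alg_d_diff)
  then show ?thesis using x vs by (simp add: ext_d_def \<zeta>_def)
qed

lemma forms_ext_d:
  fixes \<omega> :: "('e, 'b::real_normed_field) form"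
  assumes "\<omega> \<in> forms M"
  shows "ext_d M \<omega> \<in> forms M"
proof (rule formsI[OF subspace_tangent])
  fix x assume "x \<in> M"
  then obtain \<eta> U where x: "x \<in> U" and e: "extends_on M U \<omega> \<eta>" by (rule formsE[OF assms])
  note E = extends_onD[OF e]
  have "smooth_on U (\<lambda>y. euclidean_d \<eta> y vs)" for vs
    unfolding euclidean_d_def
    by (intro smooth_on_sum smooth_on_mult smooth_on_const smooth_on_frechet_derivative E(1,3))
  then show "\<exists>\<zeta>. local_extension M (ext_d M \<omega>) x \<zeta>"
    by (intro exI[of _ "euclidean_d \<eta>"] local_extensionI[of U])
       (auto simp: x E(1) ext_d_eq[OF e] intro!: alt_euclidean_d[OF E(1) _ E(2,3)])
qed (auto simp: ext_d_def)

lemma ext_d_degree0: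
  assumes \<omega>: "\<omega> \<in> forms M" and zero: "\<And>y. y \<in> M \<Longrightarrow> \<omega> y [] = 0"
    and x: "x \<in> M" and v: "v \<in> tangent M x"
  shows "ext_d M \<omega> x [v] = 0"
proof -
  obtain \<eta> U where U: "x \<in> U" and e: "extends_on M U \<omega> \<eta>" by (rule formsE[OF \<omega> x])
  have "frechet_derivative (\<lambda>y. \<eta> y []) (at x) v = 0"
  proof (rule derivative_unique_on_tangent[OF has_derivative_at_withinI[OF
          smooth_on_has_derivative[OF extends_onD(3)[OF e] U]] has_derivative_const
          extends_onD(1)[OF e] U _ v])
    show "\<eta> y [] = 0" if "y \<in> U \<inter> M" for y
      using extends_onD(4)[OF e, of y "[]"] zero that by simp
  qed
  then show ?thesis using ext_d_eq[OF e U x, of "[v]"] v by (simp add: euclidean_d_Cons)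
qed

text \<open>For a 1-form that annihilates a distribution, the usual formula
  \<open>d\<omega>(v1, v2) = - \<omega>([Y1, Y2])\<close>, where the bracket of the extensions \<open>Y\<close> of \<open>v1\<close>, \<open>v2\<close> is
  computed in the ambient space.\<close>
lemma ext_d_bracket:
  assumes \<omega>: "\<omega> \<in> forms M" and x: "x \<in> M"
    and Y: "\<And>i y. y \<in> M \<Longrightarrow> Y i y \<in> tangent M y" "\<And>i y. y \<in> M \<Longrightarrow> \<omega> y [Y i y] = 0"
      "\<And>i::bool. (Y i has_derivative Y' i) (at x)"
    and b: "Y' True (v False) - Y' False (v True) \<in> tangent M x"
    and v: "\<And>i. Y i x = v i"
  shows "ext_d M \<omega> x [v True, v False] = \<omega> x [Y' True (v False) - Y' False (v True)]"
proof -
  obtain \<eta> U where U: "x \<in> U" and e: "extends_on M U \<omega> \<eta>" by (rule formsE[OF \<omega> x])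
  note E = extends_onD[OF e]
  have vT: "v i \<in> tangent M x" for i using Y(1)[OF x, of i] v by simp
  have D: "frechet_derivative (\<lambda>y. \<eta> y [v i]) (at x) h = - \<eta> x [Y' i h]" if h: "h \<in> tangent M x" for i h
  proof -
    have "((\<lambda>y. \<eta> y (map (\<lambda>u. Y i y) [v i])) has_derivative
        (\<lambda>h. frechet_derivative (\<lambda>y. \<eta> y [v i]) (at x) h + der (\<lambda>u. Y' i h) (\<eta> x) [v i])) (at x)"
      by (rule has_derivative_alt_fields[OF E(1) U E(2,3)]) (use Y(3) v in auto)
    then have "((\<lambda>y. \<eta> y [Y i y]) has_derivative
        (\<lambda>h. frechet_derivative (\<lambda>y. \<eta> y [v i]) (at x) h + \<eta> x [Y' i h])) (at x)" by simp
    then have "frechet_derivative (\<lambda>y. \<eta> y [v i]) (at x) h + \<eta> x [Y' i h] = 0"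
    proof (rule derivative_unique_on_tangent[OF has_derivative_at_withinI has_derivative_const E(1) U _ h])
      show "\<eta> y [Y i y] = 0" if "y \<in> U \<inter> M" for y
        using E(4)[of y "[Y i y]"] Y(1,2) that by simp
    qed
    then show ?thesis by (simp add: eq_neg_iff_add_eq_0)
  qed
  have "ext_d M \<omega> x [v True, v False] = - \<eta> x [Y' False (v True)] + \<eta> x [Y' True (v False)]"
    using ext_d_eq[OF e U x, of "[v True, v False]"] vT by (simp add: euclidean_d_Cons D)
  also have "\<dots> = \<eta> x [Y' True (v False) - Y' False (v True)]"
    using linear_diff[OF alt_slot_linear[OF E(2)[OF U], of "[]" "[]"]] by simp
  also have "\<dots> = \<omega> x [Y' True (v False) - Y' False (v True)]"
    using E(4)[OF U x] b by simp
  finally show ?thesis .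
qed

end

subsection \<open>Ideals given by pointwise conditions in degrees at most two\<close>

text \<open>In the last clause, forms of type (2,0) and (0,2) on a complex plane satisfy the
  equation, while forms of type (1,1) satisfy it with the opposite sign; so it says that the (1,1)
  part vanishes.\<close>

definition pointwise_cond ::
  "'e::euclidean_space set \<Rightarrow> ('e \<Rightarrow> 'e \<Rightarrow> 'e) \<Rightarrow> ('e \<Rightarrow> 'e \<Rightarrow> 'e) \<Rightarrow> ('e, 'b::real_normed_field) form \<Rightarrow> bool" where
  "pointwise_cond M d J \<omega> \<longleftrightarrow> (\<forall>x\<in>M. \<omega> x [] = 0 \<and> (\<forall>v. \<omega> x [d x v] = 0) \<and>
    (\<forall>v w. \<omega> x [J x (d x v), d x w] = \<omega> x [d x v, J x (d x w)]))"

lemma forms_point: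
  assumes "\<omega> \<in> forms M" "x \<in> M"
  obtains \<phi> where "alt \<phi>" "\<forall>vs. set vs \<subseteq> tangent M x \<longrightarrow> \<omega> x vs = \<phi> vs"
proof -
  obtain \<eta> U where "x \<in> U" "extends_on M U \<omega> \<eta>" by (rule formsE[OF assms])
  then show thesis by (intro that[of "\<eta> x"]) (auto simp: extends_on_def assms(2))
qed

context tangent_spaces
begin

text \<open>A product evaluated on two vectors of the distribution involves \<omega> in degrees at
  most two. The 1-form part of \<omega> vanishes on \<open>J x (d x v)\<close> too, since
  \<open>d x\<close> fixes this vector, so only a function times the 2-form part survives.\<close>

lemma graded_ideal_pointwise_cond:
  assumes "\<And>x v. x \<in> M \<Longrightarrow> d x (J x (d x v)) = J x (d x v)"
  shows "graded_ideal M {\<omega> \<in> forms M. pointwise_cond M d J (\<omega> :: ('e, 'b::real_normed_field) form)}"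
proof -
  have Jd: "\<omega> x [J x (d x v)] = 0" if "pointwise_cond M d J \<omega>" "x \<in> M" for \<omega> :: "('e, 'b) form" and x v
    using that assms unfolding pointwise_cond_def by metis
  have w: "pointwise_cond M d J (wedge \<eta> \<omega>)" "pointwise_cond M d J (wedge \<omega> \<eta>)"
    if "pointwise_cond M d J \<omega>" for \<eta> \<omega> :: "('e, 'b) form"
    using that Jd[OF that] by (auto simp: pointwise_cond_def wedge_Cons)
  show ?thesis
    unfolding graded_ideal_def
    using forms_zero forms_plus forms_wedge forms_homogeneous w
    by (auto simp: pointwise_cond_def form_plus_def homogeneous_part_def)
qed

definition contraction ::
  "('e \<Rightarrow> 'e) list \<Rightarrow> ('e \<Rightarrow> 'e \<Rightarrow> 'e) \<Rightarrow> ('e, 'b::real_normed_field) form \<Rightarrow> ('e, 'b) form" where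
  "contraction Zs L \<omega> = (\<lambda>x vs. if x \<in> M \<and> set vs \<subseteq> tangent M x
      then \<omega> x (map (\<lambda>Z. Z x) Zs @ map (L x) vs) else 0)"

lemma forms_contraction:
  assumes "\<omega> \<in> forms M" "\<And>Z. Z \<in> set Zs \<Longrightarrow> smooth_on UNIV Z"
    "\<And>Z x. Z \<in> set Zs \<Longrightarrow> x \<in> M \<Longrightarrow> Z x \<in> tangent M x"
    "\<And>x. linear (L x)" "\<And>v. smooth_on UNIV (\<lambda>x. L x v)"
    "\<And>x v. x \<in> M \<Longrightarrow> v \<in> tangent M x \<Longrightarrow> L x v \<in> tangent M x"
  shows "contraction Zs L \<omega> \<in> forms M"
  unfolding contraction_def
  by (rule forms_transport[where F = "\<lambda>x. x" and U = UNIV and N = M])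
     (use assms subspace_tangent in \<open>auto intro: smooth_on_ident\<close>)

end

section \<open>Forms of degree three on a complex plane\<close>

lemma alt_permute3:
  assumes "alt \<phi>"
  shows "\<phi> [b, a, c] = - \<phi> [a, b, c]" "\<phi> [c, a, b] = \<phi> [a, b, c]" "\<phi> [a, c, b] = - \<phi> [a, b, c]"
  using alt_swap[OF assms, of "[]" b a "[c]"] alt_swap[OF assms, of "[]" c a "[b]"]
    alt_swap[OF assms, of "[a]" c b "[]"] by auto

lemma alt_linear3:
  assumes "alt \<phi>"
  shows "linear (\<lambda>u. \<phi> [u, b, c])" "linear (\<lambda>u. \<phi> [a, u, c])" "linear (\<lambda>u. \<phi> [a, b, u])"
  using alt_slot_linear[OF assms, of "[]" "[b, c]"] alt_slot_linear[OF assms, of "[a]" "[c]"]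
    alt_slot_linear[OF assms, of "[a, b]" "[]"] by auto

lemma alt_repeat3: "alt \<phi> \<Longrightarrow> \<phi> [a, a, c] = 0" "alt \<phi> \<Longrightarrow> \<phi> [a, c, a] = 0" "alt \<phi> \<Longrightarrow> \<phi> [c, a, a] = 0"
  by (rule alt_repeat; simp)+

text \<open>A complex plane carries no forms of type (3,0).\<close>
lemma three_form_complex_plane:
  fixes \<phi> :: "'e::euclidean_space list \<Rightarrow> real"
  assumes \<phi>: "alt \<phi>" and J: "linear J" and a: "J (J a) = - a" and b: "J (J b) = - b"
    and u: "\<And>i::nat. \<exists>r s t q. u i = r *\<^sub>R a + s *\<^sub>R J a + t *\<^sub>R b + q *\<^sub>R J b"
  shows "\<phi> [u 0, J (u 1), J (u 2)] + \<phi> [J (u 0), u 1, J (u 2)] + \<phi> [J (u 0), J (u 1), u 2]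
    = \<phi> [u 0, u 1, u 2]"
proof -
  \<comment> \<open>\<open>T\<close> is four times the part of type (3,0) + (0,3): such forms change
    sign when two arguments are multiplied by \<open>J\<close>, while on types (2,1) and (1,2) the
    three subtracted terms add up to \<phi>.\<close>
  define T where "T = (\<lambda>x y z. \<phi> [x, y, z] - \<phi> [x, J y, J z] - \<phi> [J x, y, J z] - \<phi> [J x, J y, z])"
  note lin = alt_linear3[OF \<phi>]
  note Jlin = linear_add[OF J] linear_scale[OF J]
  note alin = lin[THEN linear_add] lin[THEN linear_scale]
  have T1: "linear (\<lambda>x. T x y z)" for y z
    by (rule linear_slotI) (simp add: T_def Jlin alin algebra_simps)
  have T2: "linear (\<lambda>y. T x y z)" for x z
    by (rule linear_slotI) (simp add: T_def Jlin alin algebra_simps)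
  have T3: "linear (\<lambda>z. T x y z)" for x y
    by (rule linear_slotI) (simp add: T_def Jlin alin algebra_simps)
  note Tlin = T1[THEN linear_add] T1[THEN linear_scale] T2[THEN linear_add] T2[THEN linear_scale]
    T3[THEN linear_add] T3[THEN linear_scale]
  have swap: "T y x z = - T x y z" "T x z y = - T x y z" for x y z
    unfolding T_def
    using alt_permute3(1)[OF \<phi>, of y x z] alt_permute3(1)[OF \<phi>, of y "J x" "J z"]
      alt_permute3(1)[OF \<phi>, of "J y" x "J z"] alt_permute3(1)[OF \<phi>, of "J y" "J x" z]
      alt_permute3(3)[OF \<phi>, of x z y] alt_permute3(3)[OF \<phi>, of x "J z" "J y"]
      alt_permute3(3)[OF \<phi>, of "J x" "J z" y] alt_permute3(3)[OF \<phi>, of "J x" z "J y"]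
    by linarith+
  have neg: "\<phi> [- x, y, z] = - \<phi> [x, y, z]" "\<phi> [x, - y, z] = - \<phi> [x, y, z]" for x y z
    using linear_neg[OF lin(1)] linear_neg[OF lin(2)] by auto
  have rep: "T x x z = 0" for x z using swap(1)[of x x z] by simp
  have pair: "T c (J c) z = 0" if "J (J c) = - c" for c z
    unfolding T_def that neg
    using alt_repeat3[OF \<phi>] alt_permute3(1)[OF \<phi>, of "J c" c z] by simp
  have line: "T (r *\<^sub>R c + s *\<^sub>R J c) (r' *\<^sub>R c + s' *\<^sub>R J c) z = 0" if "J (J c) = - c" for c r s r' s' z
    using pair[OF that, of z] swap(1)[of "J c" c z] by (simp add: Tlin rep)
  define A where "A = (\<lambda>c x. \<exists>r s. x = r *\<^sub>R c + s *\<^sub>R J c)"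
  have same: "T x y z = 0" "T x z y = 0" "T z x y = 0" if "A c x" "A c y" "J (J c) = - c" for c x y z
  proof -
    show 1: "T x y z = 0" using that line unfolding A_def by blast
    show 2: "T x z y = 0" using 1 swap(2)[of x y z] by simp
    show "T z x y = 0" using 2 swap(1)[of z x y] by simp
  qed
  have "\<exists>x y. A a x \<and> A b y \<and> u i = x + y" for i
    using u[of i] unfolding A_def by (metis add.assoc)
  then obtain x y where xy: "\<And>i. A a (x i)" "\<And>i. A b (y i)" "\<And>i. u i = x i + y i" by metis
  \<comment> \<open>Each vector splits into components on the complex lines of \<open>a\<close> and
    \<open>b\<close>; among three components two lie on one line, where \<open>T\<close>
    vanishes.\<close>
  have "T (u 0) (u 1) (u 2) = 0"
    using same[OF xy(1) xy(1) a] same[OF xy(2) xy(2) b] by (simp add: xy(3) Tlin)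
  then show ?thesis unfolding T_def by simp
qed

lemma sum_inner_alt:
  fixes \<psi> :: "'e::euclidean_space \<Rightarrow> real"
  assumes "linear \<psi>"
  shows "(\<Sum>c\<in>Basis. (u \<bullet> c) * \<psi> c) = \<psi> u"
  using linear_basis_sum[OF assms, of u] by simp

text \<open>The \<open>Basis\<close> components of \<open>P\<close> act as a global coframe: the sum
  puts \<open>P\<close> of each argument in turn into the first slot of \<psi>.\<close>

lemma sum_wedge_contract2:
  fixes \<psi> :: "'e::euclidean_space \<Rightarrow> 'e list \<Rightarrow> real"
  assumes lin: "\<And>us. linear (\<lambda>c. \<psi> c us)"
  shows "(\<Sum>c\<in>Basis. wedge (\<lambda>x us. if length us = 1 then P (hd us) \<bullet> c else 0) (\<lambda>x. \<psi> c) x [a, b])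
    = \<psi> (P a) [b] - \<psi> (P b) [a]"
proof -
  have "wedge (\<lambda>x us. if length us = 1 then P (hd us) \<bullet> c else 0) (\<lambda>x. \<psi> c) x [a, b] =
      (P a \<bullet> c) * \<psi> c [b] - (P b \<bullet> c) * \<psi> c [a]" for c
    by (simp add: wedge_degree1)
  then show ?thesis by (simp add: sum_subtractf sum_inner_alt[OF lin])
qed

lemma sum_wedge_contract3:
  fixes \<psi> :: "'e::euclidean_space \<Rightarrow> 'e list \<Rightarrow> real"
  assumes lin: "\<And>us. linear (\<lambda>c. \<psi> c us)"
  shows "(\<Sum>c\<in>Basis. wedge (\<lambda>x us. if length us = 1 then P (hd us) \<bullet> c else 0) (\<lambda>x. \<psi> c) x [a, b, e])
    = \<psi> (P a) [b, e] - \<psi> (P b) [a, e] + \<psi> (P e) [a, b]"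
proof -
  have "wedge (\<lambda>x us. if length us = 1 then P (hd us) \<bullet> c else 0) (\<lambda>x. \<psi> c) x [a, b, e] =
      (P a \<bullet> c) * \<psi> c [b, e] - (P b \<bullet> c) * \<psi> c [a, e] + (P e \<bullet> c) * \<psi> c [a, b]" for c
    by (simp add: wedge_degree1)
  then show ?thesis by (simp add: sum_subtractf sum.distrib sum_inner_alt[OF lin])
qed

text \<open>The analogue of Euler's identity: contracting with a frame and multiplying by the dual
  coframe multiplies a form by its degree.\<close>

lemma sum_wedge_contract:
  fixes \<phi> :: "'e::euclidean_space list \<Rightarrow> real"
  assumes "alt \<phi>"
  shows "(\<Sum>c\<in>Basis. wedge (\<lambda>x us. if length us = 1 then P (hd us) \<bullet> c else 0)
      (\<lambda>x us. \<phi> (c # map P us)) x vs) = real (length vs) * \<phi> (map P vs)"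
  using assms
proof (induction vs arbitrary: \<phi>)
  case (Cons v vs)
  let ?l = "\<lambda>c x us. if length us = 1 then P (hd us) \<bullet> c else 0"
  have eq: "(\<lambda>x us. \<phi> (c # P v # map P us)) = (\<lambda>x us. - \<phi> (P v # c # map P us))" for c :: 'e
    using alt_swap[OF Cons.prems, of "[]" c "P v"] by (intro ext) simp
  have scale: "wedge (?l c) (\<lambda>x us. - \<psi> us) x vs = - wedge (?l c) (\<lambda>x. \<psi>) x vs" for c \<psi>
    by (simp add: wedge_def sum_negf)
  have "wedge (?l c) (\<lambda>x us. \<phi> (c # map P us)) x (v # vs) =
      (P v \<bullet> c) * \<phi> (c # map P vs) + wedge (?l c) (\<lambda>x us. \<phi> (P v # c # map P us)) x vs" for c
  proof -
    have "wedge (?l c) (\<lambda>x us. \<phi> (c # map P us)) x (v # vs) =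
        ?l c x [v] * \<phi> (c # map P vs) - wedge (?l c) (\<lambda>x us. \<phi> (c # map P (v # us))) x vs"
      by (rule wedge_degree1(2)) simp
    then show ?thesis unfolding list.map eq scale by simp
  qed
  then have "(\<Sum>c\<in>Basis. wedge (?l c) (\<lambda>x us. \<phi> (c # map P us)) x (v # vs)) =
      (\<Sum>c\<in>Basis. (P v \<bullet> c) * \<phi> (c # map P vs)) +
      (\<Sum>c\<in>Basis. wedge (?l c) (\<lambda>x us. \<phi> (P v # c # map P us)) x vs)"
    by (simp add: sum.distrib)
  also have "(\<Sum>c\<in>Basis. (P v \<bullet> c) * \<phi> (c # map P vs)) = \<phi> (P v # map P vs)"
    by (rule sum_inner_alt) (use alt_slot_linear[OF Cons.prems, of "[]"] in simp)
  also have "(\<Sum>c\<in>Basis. wedge (?l c) (\<lambda>x us. \<phi> (P v # c # map P us)) x vs) =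
      real (length vs) * \<phi> (P v # map P vs)"
    by (rule Cons.IH[OF alt_Cons[OF Cons.prems]])
  finally show ?case by (simp add: algebra_simps)
next
  case Nil
  show ?case by simp
qed

definition factors_through :: "'e::euclidean_space set \<Rightarrow> ('e \<Rightarrow> 'e \<Rightarrow> 'e) \<Rightarrow> ('e, 'b) form \<Rightarrow> bool" where
  "factors_through M p \<omega> \<longleftrightarrow>
    (\<forall>x\<in>M. \<forall>vs. set vs \<subseteq> tangent M x \<longrightarrow> \<omega> x (map (p x) vs) = \<omega> x vs)"

text \<open>In the following locale \<open>d x\<close> projects onto a complex plane with complex structure \<open>J x\<close>
  inside the range of the projection \<open>p x\<close>, and \<open>I\<close> is an ideal that contains all 1-forms
  annihilating these planes and, up to those, all 2-forms of type (2,0) + (0,2). Since every 3-form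
  on a complex plane is a sum of products with such 2-forms, \<open>I\<close> has no condition in degree three
  and higher. Only forms that factor through \<open>p\<close> are considered.\<close>
locale frame = tangent_spaces M for M :: "'e::euclidean_space set" +
  fixes p d J :: "'e \<Rightarrow> 'e \<Rightarrow> 'e" and I :: "('e, real) form set"
  assumes linear: "linear (p x)" "linear (d x)" "linear (J x)"
    and smooth: "smooth_on UNIV (\<lambda>x. p x v)" "smooth_on UNIV (\<lambda>x. d x v)"
      "smooth_on UNIV (\<lambda>x. J x (d x v))"
    and p_tangent: "x \<in> M \<Longrightarrow> p x v \<in> tangent M x"
    and proj: "x \<in> M \<Longrightarrow> p x (p x v) = p x v" "x \<in> M \<Longrightarrow> p x (d x v) = d x v"
      "x \<in> M \<Longrightarrow> d x (p x v) = d x v" "x \<in> M \<Longrightarrow> d x (d x v) = d x v"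
      "x \<in> M \<Longrightarrow> d x (J x (d x v)) = J x (d x v)" "x \<in> M \<Longrightarrow> J x (J x (d x v)) = - d x v"
    and plane: "x \<in> M \<Longrightarrow> \<exists>a b. d x a = a \<and> d x b = b \<and>
      (\<forall>v. \<exists>r s t q. d x v = r *\<^sub>R a + s *\<^sub>R J x a + t *\<^sub>R b + q *\<^sub>R J x b)"
    and ideal: "graded_ideal M I"
    and degree1: "\<omega> \<in> forms M \<Longrightarrow> factors_through M p \<omega> \<Longrightarrow> homogeneous_part 1 \<omega> = \<omega> \<Longrightarrow>
      (\<And>x v. x \<in> M \<Longrightarrow> \<omega> x [d x v] = 0) \<Longrightarrow> \<omega> \<in> I"
    and degree2: "\<omega> \<in> forms M \<Longrightarrow> factors_through M p \<omega> \<Longrightarrow> homogeneous_part 2 \<omega> = \<omega> \<Longrightarrow>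
      (\<And>x v w. x \<in> M \<Longrightarrow> \<omega> x [J x (d x v), d x w] = \<omega> x [d x v, J x (d x w)]) \<Longrightarrow>
      \<exists>\<tau>\<in>I. factors_through M p \<tau> \<and> (\<forall>x\<in>M. \<forall>v w. \<tau> x [d x v, d x w] = \<omega> x [d x v, d x w])"
begin

abbreviation admissible :: "('e, real) form \<Rightarrow> bool" where
  "admissible \<equiv> factors_through M p"


lemma d_tangent: "x \<in> M \<Longrightarrow> d x v \<in> tangent M x"
  using p_tangent proj(2) by metis

lemma Jd_tangent: "x \<in> M \<Longrightarrow> J x (d x v) \<in> tangent M x"
  using d_tangent proj(5) by metis

lemma admissibleD: "admissible \<omega> \<Longrightarrow> x \<in> M \<Longrightarrow> set vs \<subseteq> tangent M x \<Longrightarrow> \<omega> x (map (p x) vs) = \<omega> x vs"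
  unfolding factors_through_def by blast

lemma I_forms: "\<omega> \<in> I \<Longrightarrow> \<omega> \<in> forms M"
  and I_plus: "\<omega> \<in> I \<Longrightarrow> \<eta> \<in> I \<Longrightarrow> form_plus \<omega> \<eta> \<in> I"
  and I_wedge: "\<omega> \<in> I \<Longrightarrow> \<eta> \<in> forms M \<Longrightarrow> wedge \<omega> \<eta> \<in> I" "\<omega> \<in> I \<Longrightarrow> \<eta> \<in> forms M \<Longrightarrow> wedge \<eta> \<omega> \<in> I"
  and I_homogeneous: "\<omega> \<in> I \<Longrightarrow> homogeneous_part k \<omega> \<in> I"
  and I_zero: "(\<lambda>x vs. 0) \<in> I"
  using ideal unfolding graded_ideal_def by blast+

abbreviation comp :: "('e \<Rightarrow> 'e \<Rightarrow> 'e) \<Rightarrow> 'e \<Rightarrow> ('e, real) form" where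
  "comp P c \<equiv> one_form M (\<lambda>x v. P x v \<bullet> c)"

abbreviation n :: "'e \<Rightarrow> 'e \<Rightarrow> 'e" where "n x v \<equiv> p x v - d x v"

lemma linear_n: "linear (n x)" by (intro linear_compose_sub linear)

lemma smooth_n: "smooth_on UNIV (\<lambda>x. n x v)"
  using smooth_on_add[OF open_UNIV smooth(1)[of v] smooth_on_linear[OF bounded_linear_minus[OF bounded_linear_ident] open_UNIV smooth(2)[of v]]]
  by simp

lemma forms_comp:
  assumes "\<And>x. linear (P x)" "\<And>v. smooth_on UNIV (\<lambda>x. P x v)"
  shows "comp P c \<in> forms M"
proof (rule forms_one_form[of UNIV])
  show "linear (\<lambda>v. P x v \<bullet> c)" for x
    by (rule linear_slotI) (simp add: linear_add[OF assms(1)] linear_scale[OF assms(1)] inner_add_left)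
  show "smooth_on UNIV (\<lambda>x. P x v \<bullet> c)" for v
    by (rule smooth_on_linear[OF bounded_linear_inner_left open_UNIV assms(2)])
qed auto

lemmas forms_comps = forms_comp[OF linear(1) smooth(1)] forms_comp[OF linear(2) smooth(2)]
  forms_comp[OF linear_n smooth_n]

lemma comp_n: "comp n c \<in> I"
proof (rule degree1)
  show "admissible (comp n c)"
    unfolding factors_through_def
  proof (intro ballI allI impI)
    fix x vs assume x: "x \<in> M" "set vs \<subseteq> tangent M x"
    then show "comp n c x (map (p x) vs) = comp n c x vs"
      by (cases vs) (auto simp: one_form_def p_tangent proj)
  qed
  show "homogeneous_part 1 (comp n c) = comp n c"
    by (auto simp: homogeneous_part_def one_form_def fun_eq_iff)
  show "comp n c x [d x v] = 0" if "x \<in> M" for x v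
    using that by (simp add: one_form_def d_tangent proj)
qed (rule forms_comps)

lemma forms_con:
  assumes "\<omega> \<in> forms M"
  shows "contraction [\<lambda>x. p x c] (\<lambda>x v. v) \<omega> \<in> forms M"
    "contraction [\<lambda>x. p x c] d \<omega> \<in> forms M"
    "contraction [\<lambda>x. p x c] (\<lambda>x v. J x (d x v)) \<omega> \<in> forms M"
  by (rule forms_contraction[OF assms];
      auto simp: smooth p_tangent d_tangent Jd_tangent linear
        intro: linear_id[unfolded id_def] linear_compose[OF linear(2,3), unfolded o_def])+

lemma sum_wedge_at:
  assumes x: "x \<in> M" "set vs \<subseteq> tangent M x"
    and eq: "\<And>c us. set us \<subseteq> tangent M x \<Longrightarrow> \<mu> c x us = \<psi> c us"
  shows "(\<Sum>c\<in>Basis. wedge (comp P c) (\<mu> c) x vs) =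
    (\<Sum>c\<in>Basis. wedge (\<lambda>x' us. if length us = 1 then P x (hd us) \<bullet> c else 0) (\<lambda>x. \<psi> c) x vs)"
  by (rule sum.cong[OF refl], rule wedge_local[OF x(2)]) (use x eq in \<open>auto simp: one_form_def\<close>)

lemma homogeneous_partI:
  assumes "homogeneous_part k \<omega> = \<omega>" "homogeneous_part k \<eta> \<in> I" "\<omega> \<in> forms M" "\<eta> \<in> forms M"
    and "\<And>x vs. x \<in> M \<Longrightarrow> set vs \<subseteq> tangent M x \<Longrightarrow> length vs = k \<Longrightarrow> \<omega> x vs = \<eta> x vs"
  shows "\<omega> \<in> I"
proof -
  have "homogeneous_part k \<omega> x vs = homogeneous_part k \<eta> x vs" for x vs
    using assms(5)[of x vs] forms_outside[OF assms(3), of x vs] forms_outside[OF assms(4), of x vs]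
    by (cases "x \<in> M \<and> set vs \<subseteq> tangent M x") (auto simp: homogeneous_part_def)
  then have "\<omega> = homogeneous_part k \<eta>" using assms(1) by (metis ext)
  with assms(2) show ?thesis by simp
qed

lemma homogeneous_zero: "homogeneous_part k \<omega> = \<omega> \<Longrightarrow> length vs \<noteq> k \<Longrightarrow> \<omega> x vs = 0"
  by (metis homogeneous_part_def)

text \<open>A 2-form that is zero on the planes is a combination of the forms
  \<open>comp n c\<close>, which annihilate the planes, because n = p - d measures the change from
  the values on \<open>d\<close> to those on \<open>p\<close>.\<close>

lemma degree2_vanishing:
  assumes \<omega>: "\<omega> \<in> forms M" "admissible \<omega>" and hom: "homogeneous_part 2 \<omega> = \<omega>"
    and zero: "\<And>x v w. x \<in> M \<Longrightarrow> \<omega> x [d x v, d x w] = 0"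
  shows "\<omega> \<in> I"
proof -
  \<comment> \<open>The mean of the contractions with second argument \<open>v\<close> and with
    \<open>d x v\<close>: antisymmetrising \<phi>(n v, p w) + \<phi>(n v, d w) gives 2 (\<phi>(p v,
    p w) - \<phi>(d v, d w)).\<close>
  let ?\<mu> = "\<lambda>c. form_plus (\<lambda>x vs. 1 / 2 * contraction [\<lambda>x. p x c] (\<lambda>x v. v) \<omega> x vs)
    (\<lambda>x vs. 1 / 2 * contraction [\<lambda>x. p x c] d \<omega> x vs)"
  let ?\<eta> = "\<lambda>x vs. \<Sum>c\<in>Basis. wedge (comp n c) (?\<mu> c) x vs"
  have I: "?\<eta> \<in> I"
    by (intro graded_ideal_sum[OF ideal] I_wedge comp_n forms_plus forms_scale forms_con[OF \<omega>(1)])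
  show ?thesis
  proof (rule homogeneous_partI[OF hom I_homogeneous[OF I] \<omega>(1) I_forms[OF I]])
    fix x vs assume x: "x \<in> M" "set vs \<subseteq> tangent M x" "length vs = 2"
    then obtain v w where vs: "vs = [v, w]" by (auto simp: length_Suc_conv numeral_2_eq_2)
    have T: "v \<in> tangent M x" "w \<in> tangent M x" using x vs by auto
    note t = T p_tangent[OF x(1)] d_tangent[OF x(1)]
    obtain \<phi> where \<phi>: "alt \<phi>" "\<forall>vs. set vs \<subseteq> tangent M x \<longrightarrow> \<omega> x vs = \<phi> vs"
      by (rule forms_point[OF \<omega>(1) x(1)])
    define \<psi> where "\<psi> = (\<lambda>c us. 1 / 2 * (\<phi> (p x c # us) + \<phi> (p x c # map (d x) us)))"
    have lin: "linear (\<lambda>u. \<phi> [u, z])" "linear (\<lambda>u. \<phi> [z, u])" for z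
      using alt_slot_linear[OF \<phi>(1), of "[]" "[z]"] alt_slot_linear[OF \<phi>(1), of "[z]" "[]"] by auto
    have lin\<psi>: "linear (\<lambda>c. \<psi> c us)" for us
    proof (rule linear_slotI)
      have "linear (\<lambda>c. \<phi> (p x c # ws))" for ws
        using linear_compose[OF linear(1) alt_slot_linear[OF \<phi>(1), of "[]" ws]] by (simp add: o_def)
      note L = this[THEN linear_add] this[THEN linear_scale]
      show "\<psi> (r *\<^sub>R u + s *\<^sub>R w) us = r *\<^sub>R \<psi> u us + s *\<^sub>R \<psi> w us" for r s u w
        unfolding \<psi>_def by (simp add: L algebra_simps)
    qed
    have p\<phi>: "\<phi> [u, z] = \<phi> [p x u, p x z]" if "u \<in> tangent M x" "z \<in> tangent M x" for u z
      using admissibleD[OF \<omega>(2) x(1), of "[u, z]"] \<phi>(2) that t by simp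
    have n_tangent: "n x u \<in> tangent M x" for u
      using subspace_tangent[OF x(1)] t by (simp add: subspace_diff)
    have pn: "p x (n x u) = n x u" for u
      using linear_diff[OF linear(1)] proj(1,2)[OF x(1)] by simp
    have "?\<eta> x vs = (\<Sum>c\<in>Basis. wedge (\<lambda>x' us. if length us = 1 then n x (hd us) \<bullet> c else 0) (\<lambda>x. \<psi> c) x vs)"
    proof (rule sum_wedge_at[OF x(1,2)])
      show "?\<mu> c x us = \<psi> c us" if "set us \<subseteq> tangent M x" for c us
        using that \<phi>(2) x t by (auto simp: form_plus_def contraction_def \<psi>_def image_subset_iff algebra_simps)
    qed
    also have "\<dots> = \<psi> (n x v) [w] - \<psi> (n x w) [v]"
      unfolding vs by (rule sum_wedge_contract2[OF lin\<psi>])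
    also have "\<dots> = \<phi> [p x v, p x w] - \<phi> [d x v, d x w]"
    proof -
      have "\<phi> [n x u, z] = \<phi> [p x u, p x z] - \<phi> [d x u, p x z]" if "z \<in> tangent M x" for u z
        using p\<phi>[OF n_tangent that] linear_diff[OF lin(1)] by (simp only: pn)
      moreover have "\<phi> [n x u, d x z] = \<phi> [p x u, d x z] - \<phi> [d x u, d x z]" for u z
        using linear_diff[OF lin(1)] by simp
      moreover have "\<phi> [u, z] = - \<phi> [z, u]" for u z
        using alt_swap[OF \<phi>(1), of "[]" u z "[]"] by simp
      note this[of "p x w" "p x v"] this[of "d x w" "p x v"] this[of "p x w" "d x v"] this[of "d x w" "d x v"]
      ultimately show ?thesis
        unfolding \<psi>_def by (simp only: pn T list.map) (simp add: algebra_simps)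
    qed
    also have "\<dots> = \<omega> x vs"
      using zero[OF x(1), of v w] \<phi>(2) t p\<phi>[OF T] vs by simp
    finally show "\<omega> x vs = ?\<eta> x vs" by simp
  qed
qed

text \<open>The assumption \<open>degree2\<close> supplies a member of the ideal that agrees with
  \<omega> on the planes; the difference vanishes there.\<close>

lemma degree2_in_ideal:
  assumes \<omega>: "\<omega> \<in> forms M" "admissible \<omega>" and hom: "homogeneous_part 2 \<omega> = \<omega>"
    and J: "\<And>x v w. x \<in> M \<Longrightarrow> \<omega> x [J x (d x v), d x w] = \<omega> x [d x v, J x (d x w)]"
  shows "\<omega> \<in> I"
proof -
  obtain \<tau>' where \<tau>': "\<tau>' \<in> I" "admissible \<tau>'"
    "\<And>x v w. x \<in> M \<Longrightarrow> \<tau>' x [d x v, d x w] = \<omega> x [d x v, d x w]"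
    using degree2[OF assms] by blast
  define \<tau> where "\<tau> = homogeneous_part 2 \<tau>'"
  have \<tau>: "\<tau> \<in> I" unfolding \<tau>_def by (rule I_homogeneous[OF \<tau>'(1)])
  let ?\<delta> = "form_plus \<omega> (\<lambda>x vs. - 1 * \<tau> x vs)"
  have "?\<delta> \<in> I"
  proof (rule degree2_vanishing)
    show "?\<delta> \<in> forms M" by (intro forms_plus \<omega> forms_scale I_forms \<tau>)
    show "admissible ?\<delta>"
      using \<omega>(2) \<tau>'(2) unfolding factors_through_def by (auto simp: form_plus_def \<tau>_def homogeneous_part_def)
    show "homogeneous_part 2 ?\<delta> = ?\<delta>"
      using homogeneous_zero[OF hom] by (auto simp: form_plus_def \<tau>_def homogeneous_part_def fun_eq_iff)
    show "?\<delta> x [d x v, d x w] = 0" if "x \<in> M" for x v w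
      using \<tau>'(3)[OF that] by (simp add: form_plus_def \<tau>_def homogeneous_part_def)
  qed
  from I_plus[OF this \<tau>] show ?thesis by (simp add: form_plus_def)
qed

lemma degree3_in_ideal:
  assumes \<omega>: "\<omega> \<in> forms M" "admissible \<omega>" and hom: "homogeneous_part 3 \<omega> = \<omega>"
  shows "\<omega> \<in> I"
proof -
  define \<iota> where "\<iota> = (\<lambda>c. contraction [\<lambda>x. p x c] (\<lambda>x v. v) \<omega>)"
  define \<kappa> where "\<kappa> = (\<lambda>c. contraction [\<lambda>x. p x c] d \<omega>)"
  define m where "m = (\<lambda>c. contraction [\<lambda>x. p x c] (\<lambda>x v. J x (d x v)) \<omega>)"
  note defs = \<iota>_def \<kappa>_def m_def
  have F: "\<iota> c \<in> forms M" "\<kappa> c \<in> forms M" "m c \<in> forms M" for c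
    unfolding defs by (rule forms_con[OF \<omega>(1)])+
  have A: "admissible (\<iota> c)" "admissible (\<kappa> c)" "admissible (m c)" for c
  proof -
    have "\<omega> x (p x c # map (p x) vs) = \<omega> x (p x c # vs)" if "x \<in> M" "set vs \<subseteq> tangent M x" for x vs
      using admissibleD[OF \<omega>(2), of x "p x c # vs"] that by (simp add: p_tangent proj)
    then show "admissible (\<iota> c)" "admissible (\<kappa> c)" "admissible (m c)"
      by (auto simp: factors_through_def defs contraction_def p_tangent proj o_def image_subset_iff)
  qed
  have H: "homogeneous_part 2 (\<iota> c) = \<iota> c" "homogeneous_part 2 (\<kappa> c) = \<kappa> c" "homogeneous_part 2 (m c) = m c" for c
    using homogeneous_zero[OF hom] by (auto simp: defs homogeneous_part_def contraction_def fun_eq_iff)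
  define \<alpha> where "\<alpha> = (\<lambda>c. form_plus (\<iota> c) (\<lambda>x vs. - 1 * \<kappa> c x vs))"
  \<comment> \<open>Subtracting the values on arguments rotated by \<open>J\<close> removes the
    (1,1) part, so \<open>\<beta> c\<close> satisfies the condition in degree two, while
    \<open>\<alpha> c\<close> vanishes on the planes.\<close>
  define \<beta> where "\<beta> = (\<lambda>c. form_plus (\<kappa> c) (\<lambda>x vs. - 1 * m c x vs))"
  have ad: "admissible (form_plus \<xi> (\<lambda>x vs. - 1 * \<zeta> x vs))" if "admissible \<xi>" "admissible \<zeta>" for \<xi> \<zeta>
    using that by (auto simp: factors_through_def form_plus_def)
  have ho: "homogeneous_part 2 (form_plus \<xi> (\<lambda>x vs. - 1 * \<zeta> x vs)) = form_plus \<xi> (\<lambda>x vs. - 1 * \<zeta> x vs)"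
    if "homogeneous_part 2 \<xi> = \<xi>" "homogeneous_part 2 \<zeta> = \<zeta>" for \<xi> \<zeta> :: "('e, real) form"
    using homogeneous_zero[OF that(1)] homogeneous_zero[OF that(2)]
    by (auto simp: form_plus_def homogeneous_part_def fun_eq_iff)
  have \<alpha>: "\<alpha> c \<in> I" for c
    unfolding \<alpha>_def
  proof (rule degree2_vanishing[OF _ ad[OF A(1,2)] ho[OF H(1,2)]])
    show "form_plus (\<iota> c) (\<lambda>x vs. - 1 * \<kappa> c x vs) \<in> forms M" by (intro forms_plus forms_scale F)
    show "form_plus (\<iota> c) (\<lambda>x vs. - 1 * \<kappa> c x vs) x [d x v, d x w] = 0" if "x \<in> M" for x v w
      using that by (simp add: form_plus_def defs contraction_def d_tangent proj)
  qed
  have \<beta>: "\<beta> c \<in> I" for c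
    unfolding \<beta>_def
  proof (rule degree2_in_ideal[OF _ ad[OF A(2,3)] ho[OF H(2,3)]])
    show "form_plus (\<kappa> c) (\<lambda>x vs. - 1 * m c x vs) \<in> forms M" by (intro forms_plus forms_scale F)
    fix x v w assume x: "x \<in> M"
    obtain \<phi> where \<phi>: "alt \<phi>" "\<forall>vs. set vs \<subseteq> tangent M x \<longrightarrow> \<omega> x vs = \<phi> vs"
      by (rule forms_point[OF \<omega>(1) x])
    have "\<phi> [a, - b, e] = - \<phi> [a, b, e]" "\<phi> [a, b, - e] = - \<phi> [a, b, e]" for a b e
      using linear_neg[OF alt_linear3(2)[OF \<phi>(1)]] linear_neg[OF alt_linear3(3)[OF \<phi>(1)]] by auto
    moreover have "- d x v \<in> tangent M x" for v
      using subspace_neg[OF subspace_tangent[OF x] d_tangent[OF x]] .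
    ultimately show "form_plus (\<kappa> c) (\<lambda>x vs. - 1 * m c x vs) x [J x (d x v), d x w] =
        form_plus (\<kappa> c) (\<lambda>x vs. - 1 * m c x vs) x [d x v, J x (d x w)]"
      using x \<phi>(2) by (simp add: form_plus_def defs contraction_def d_tangent Jd_tangent p_tangent proj)
  qed
  \<comment> \<open>Let K be the alternating sum of \<omega>(p a, d b, d e) and D = \<omega>(d a, d
    b, d e). The three sums equal 3 \<omega> - K, K - 3 D and, by the absence of (3,0) forms, 3 D -
    D; the factors 1/3, 1/3 and 1/2 combine them to \<omega>.\<close>
  let ?\<eta> = "form_plus (\<lambda>x vs. 1 / 3 * (\<Sum>c\<in>Basis. wedge (comp p c) (\<alpha> c) x vs))
    (form_plus (\<lambda>x vs. 1 / 3 * (\<Sum>c\<in>Basis. wedge (comp n c) (\<kappa> c) x vs))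
      (\<lambda>x vs. 1 / 2 * (\<Sum>c\<in>Basis. wedge (comp d c) (\<beta> c) x vs)))"
  have I: "?\<eta> \<in> I"
    by (intro I_plus graded_ideal_scale[OF ideal] graded_ideal_sum[OF ideal])
       (auto intro: I_wedge \<alpha> \<beta> F comp_n forms_comps)
  show ?thesis
  proof (rule homogeneous_partI[OF hom I_homogeneous[OF I] \<omega>(1) I_forms[OF I]])
    fix x vs assume x: "x \<in> M" "set vs \<subseteq> tangent M x" "length vs = 3"
    then obtain a b e where vs: "vs = [a, b, e]" by (auto simp: length_Suc_conv numeral_3_eq_3)
    have T: "a \<in> tangent M x" "b \<in> tangent M x" "e \<in> tangent M x" using x vs by auto
    note t = T p_tangent[OF x(1)] d_tangent[OF x(1)] Jd_tangent[OF x(1)]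
    obtain \<phi> where \<phi>: "alt \<phi>" "\<forall>vs. set vs \<subseteq> tangent M x \<longrightarrow> \<omega> x vs = \<phi> vs"
      by (rule forms_point[OF \<omega>(1) x(1)])
    have p\<phi>: "\<phi> [u, v, z] = \<phi> [p x u, v, z]" "\<phi> [u, v, z] = \<phi> [p x u, p x v, p x z]"
      if "u \<in> tangent M x" "v \<in> tangent M x" "z \<in> tangent M x" for u v z
      using admissibleD[OF \<omega>(2) x(1), of "[u, v, z]"] admissibleD[OF \<omega>(2) x(1), of "[p x u, v, z]"]
        \<phi>(2) that t proj(1)[OF x(1)] by simp_all
    let ?S = "\<lambda>P \<psi>. \<Sum>c\<in>Basis. wedge (\<lambda>x' us. if length us = 1 then P x (hd us) \<bullet> c else 0) (\<lambda>x. \<psi> c) x [a, b, e]"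
    let ?K = "\<lambda>L c us. \<phi> (p x c # map L us)"
    let ?Jd = "\<lambda>v. J x (d x v)"
    have linK: "linear (\<lambda>c. ?K L c us)" for L us
      using linear_compose[OF linear(1) alt_slot_linear[OF \<phi>(1), of "[]" "map L us"]] by (simp add: o_def)
    have linK2: "linear (\<lambda>c. ?K L c us - ?K L' c us)" for L L' us
      by (intro linear_compose_sub linK)
    have 1: "(\<Sum>c\<in>Basis. wedge (comp p c) (\<alpha> c) x vs) = ?S p (\<lambda>c us. ?K (\<lambda>v. v) c us - ?K (d x) c us)"
      unfolding vs
      by (rule sum_wedge_at[OF x(1)])
         (use x vs t \<phi>(2) in \<open>auto simp: \<alpha>_def defs form_plus_def contraction_def image_subset_iff\<close>)
    have 2: "(\<Sum>c\<in>Basis. wedge (comp n c) (\<kappa> c) x vs) = ?S n (?K (d x))"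
      unfolding vs
      by (rule sum_wedge_at[OF x(1)])
         (use x vs t \<phi>(2) in \<open>auto simp: defs contraction_def image_subset_iff\<close>)
    have 3: "(\<Sum>c\<in>Basis. wedge (comp d c) (\<beta> c) x vs) = ?S d (\<lambda>c us. ?K (d x) c us - ?K ?Jd c us)"
      unfolding vs
      by (rule sum_wedge_at[OF x(1)])
         (use x vs t \<phi>(2) in \<open>auto simp: \<beta>_def defs form_plus_def contraction_def image_subset_iff\<close>)
    have pn: "p x (n x u) = p x u - d x u" for u
      using linear_diff[OF linear(1)] proj(1,2)[OF x(1)] by simp
    obtain f g where fg: "d x f = f" "d x g = g"
      "\<And>v. \<exists>r s t q. d x v = r *\<^sub>R f + s *\<^sub>R J x f + t *\<^sub>R g + q *\<^sub>R J x g"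
      using plane[OF x(1)] by blast
    define u where "u = (\<lambda>i::nat. d x (if i = 0 then a else if i = 1 then b else e))"
    have plane: "\<phi> [d x a, ?Jd b, ?Jd e] + \<phi> [?Jd a, d x b, ?Jd e] + \<phi> [?Jd a, ?Jd b, d x e]
        = \<phi> [d x a, d x b, d x e]"
      using three_form_complex_plane[OF \<phi>(1) linear(3), of x f g u] fg proj(6)[OF x(1), of f]
        proj(6)[OF x(1), of g] by (simp add: u_def)
    note perm = alt_permute3[OF \<phi>(1)]
    have d3: "\<phi> [p x u - d x u, v, z] = \<phi> [p x u, v, z] - \<phi> [d x u, v, z]" for u v z
      using linear_diff[OF alt_linear3(1)[OF \<phi>(1)]] .
    have "?\<eta> x vs = 1 / 3 * (\<phi> [p x a, b, e] - \<phi> [p x a, d x b, d x e]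
        - (\<phi> [p x b, a, e] - \<phi> [p x b, d x a, d x e]) + (\<phi> [p x e, a, b] - \<phi> [p x e, d x a, d x b]))
      + (1 / 3 * (\<phi> [p x a, d x b, d x e] - \<phi> [d x a, d x b, d x e]
        - (\<phi> [p x b, d x a, d x e] - \<phi> [d x b, d x a, d x e])
        + (\<phi> [p x e, d x a, d x b] - \<phi> [d x e, d x a, d x b]))
      + 1 / 2 * (\<phi> [d x a, d x b, d x e] - \<phi> [d x a, ?Jd b, ?Jd e]
        - (\<phi> [d x b, d x a, d x e] - \<phi> [d x b, ?Jd a, ?Jd e])
        + (\<phi> [d x e, d x a, d x b] - \<phi> [d x e, ?Jd a, ?Jd b])))"
      unfolding form_plus_def trans[OF 1 sum_wedge_contract3[OF linK2]]
        trans[OF 2 sum_wedge_contract3[OF linK]] trans[OF 3 sum_wedge_contract3[OF linK2]]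
      by (simp add: pn d3 proj(1,2)[OF x(1)])
    also have "\<dots> = 1 / 3 * (\<phi> [a, b, e] - \<phi> [b, a, e] + \<phi> [e, a, b])
      - 1 / 3 * (\<phi> [d x a, d x b, d x e] - \<phi> [d x b, d x a, d x e] + \<phi> [d x e, d x a, d x b])
      + 1 / 2 * (\<phi> [d x a, d x b, d x e] - \<phi> [d x b, d x a, d x e] + \<phi> [d x e, d x a, d x b]
        - (\<phi> [d x a, ?Jd b, ?Jd e] - \<phi> [d x b, ?Jd a, ?Jd e] + \<phi> [d x e, ?Jd a, ?Jd b]))"
      using p\<phi>(1)[OF T] p\<phi>(1)[OF T(2,1,3)] p\<phi>(1)[OF T(3,1,2)] by (simp add: field_simps)
    also have "\<dots> = \<phi> [a, b, e]"
      using plane perm[of b a e] perm[of a e b] perm(1)[of "d x b" "d x a" "d x e"]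
        perm(2)[of "d x e" "d x a" "d x b"] perm(2)[of e a b]
        perm(1)[of "d x b" "?Jd a" "?Jd e"] perm(2)[of "d x e" "?Jd a" "?Jd b"] by simp
    finally show "\<omega> x vs = ?\<eta> x vs" using \<phi>(2) vs x by simp
  qed
qed

text \<open>Euler's identity writes \<omega> as a sum of products of \<open>comp p c\<close> with
  contractions, whose degree is one less but still at least three in the induction step.
  Admissibility allows \<open>p\<close> to be inserted in all arguments.\<close>

lemma degree_ge3_in_ideal:
  assumes "\<omega> \<in> forms M" "admissible \<omega>" "homogeneous_part (k + 3) \<omega> = \<omega>"
  shows "\<omega> \<in> I"
  using assms
proof (induction k arbitrary: \<omega>)
  case 0
  then show ?case using degree3_in_ideal by simp
next
  case (Suc k)
  let ?\<iota> = "\<lambda>c. contraction [\<lambda>x. p x c] (\<lambda>x v. v) \<omega>"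
  have \<iota>: "?\<iota> c \<in> I" for c
  proof (rule Suc.IH)
    have "\<omega> x (p x c # map (p x) vs) = \<omega> x (p x c # vs)" if "x \<in> M" "set vs \<subseteq> tangent M x" for x vs
      using admissibleD[OF Suc.prems(2), of x "p x c # vs"] that by (simp add: p_tangent proj)
    then show "admissible (?\<iota> c)"
      by (auto simp: factors_through_def contraction_def p_tangent image_subset_iff)
    show "homogeneous_part (k + 3) (?\<iota> c) = ?\<iota> c"
      using homogeneous_zero[OF Suc.prems(3)] by (auto simp: homogeneous_part_def contraction_def fun_eq_iff)
  qed (rule forms_con[OF Suc.prems(1)])
  let ?\<eta> = "\<lambda>x vs. 1 / real (Suc k + 3) * (\<Sum>c\<in>Basis. wedge (comp p c) (?\<iota> c) x vs)"
  have I: "?\<eta> \<in> I"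
    by (intro graded_ideal_scale[OF ideal] graded_ideal_sum[OF ideal] I_wedge \<iota> forms_comps)
  show ?case
  proof (rule homogeneous_partI[OF Suc.prems(3) I_homogeneous[OF I] Suc.prems(1) I_forms[OF I]])
    fix x vs assume x: "x \<in> M" "set vs \<subseteq> tangent M x" "length vs = Suc k + 3"
    obtain \<phi> where \<phi>: "alt \<phi>" "\<forall>vs. set vs \<subseteq> tangent M x \<longrightarrow> \<omega> x vs = \<phi> vs"
      by (rule forms_point[OF Suc.prems(1) x(1)])
    have pp: "map (p x) (map (p x) us) = map (p x) us" for us
      by (simp add: o_def proj(1)[OF x(1)])
    have p\<phi>: "\<phi> (map (p x) us) = \<phi> us" if "set us \<subseteq> tangent M x" for us
    proof -
      have "set (map (p x) us) \<subseteq> tangent M x" using p_tangent[OF x(1)] by auto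
      then show ?thesis using admissibleD[OF Suc.prems(2) x(1) that] \<phi>(2) that by metis
    qed
    have "(\<Sum>c\<in>Basis. wedge (comp p c) (?\<iota> c) x vs) =
        (\<Sum>c\<in>Basis. wedge (\<lambda>x' us. if length us = 1 then p x (hd us) \<bullet> c else 0)
          (\<lambda>x' us. \<phi> (map (p x) (c # map (p x) us))) x vs)"
    proof (rule sum_wedge_at[OF x(1,2)])
      fix c us assume us: "set us \<subseteq> tangent M x"
      then have "\<phi> (map (p x) (p x c # us)) = \<phi> (p x c # us)"
        using p_tangent[OF x(1)] by (intro p\<phi>) auto
      then show "?\<iota> c x us = \<phi> (map (p x) (c # map (p x) us))"
        using us x(1) \<phi>(2) p_tangent[OF x(1)] by (simp add: contraction_def pp proj(1)[OF x(1)] del: map_map)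
    qed
    also have "\<dots> = real (length vs) * \<phi> (map (p x) (map (p x) vs))"
      by (rule sum_wedge_contract[OF alt_map[OF \<phi>(1) linear(1)]])
    also have "\<dots> = real (Suc k + 3) * \<omega> x vs"
      using x(2,3) \<phi>(2) p\<phi>[OF x(2)] by (simp only: pp)
    finally show "\<omega> x vs = ?\<eta> x vs" by simp
  qed
qed

theorem pointwise_cond_in_ideal:
  assumes \<omega>: "\<omega> \<in> forms M" "admissible \<omega>" and cond: "pointwise_cond M d J \<omega>"
  shows "\<omega> \<in> I"
proof -
  have hom: "homogeneous_part k (homogeneous_part k \<omega>) = homogeneous_part k \<omega>" for k
    by (intro ext) (simp add: homogeneous_part_def)
  have F: "homogeneous_part k \<omega> \<in> forms M" for k by (rule forms_homogeneous[OF \<omega>(1)])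
  have A: "admissible (homogeneous_part k \<omega>)" for k
    using \<omega>(2) by (auto simp: factors_through_def homogeneous_part_def)
  have "homogeneous_part k \<omega> \<in> I" for k
  proof -
    have "k = 0 \<or> k = 1 \<or> k = 2 \<or> (\<exists>j. k = j + 3)" by presburger
    then consider "k = 0" | "k = 1" | "k = 2" | j where "k = j + 3" by blast
    then show ?thesis
    proof cases
      case 1
      have "homogeneous_part 0 \<omega> = (\<lambda>x vs. 0)"
        using cond forms_outside[OF \<omega>(1)]
        unfolding pointwise_cond_def homogeneous_part_def by (intro ext) auto
      with 1 I_zero show ?thesis by simp
    next
      case 2
      then show ?thesis using degree1[OF F A hom] cond
        by (simp add: pointwise_cond_def homogeneous_part_def)
    next
      case 3
      then show ?thesis using degree2_in_ideal[OF F A hom] cond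
        by (simp add: pointwise_cond_def homogeneous_part_def)
    next
      case (4 j)
      then show ?thesis using degree_ge3_in_ideal[OF F A hom] by simp
    qed
  qed
  then have "(\<lambda>x vs. \<Sum>k\<le>DIM('e). homogeneous_part k \<omega> x vs) \<in> I"
    by (intro graded_ideal_sum[OF ideal])
  then show ?thesis using sum_homogeneous_parts[OF \<omega>(1)] by simp
qed

end

subsection \<open>Complex 2 by 2 matrices\<close>

type_synonym cmat = "complex^2^2"

definition cscale :: "complex \<Rightarrow> cmat \<Rightarrow> cmat" where
  "cscale c A = (\<chi> i j. c * A $ i $ j)"

text \<open>The adjugate: it agrees with the inverse on \<open>SL2C\<close> but is linear on all
  matrices, so expressions in it are smooth on the whole ambient space and easy to
  differentiate.\<close>

definition adj2 :: "cmat \<Rightarrow> cmat" where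
  "adj2 A = vector [vector [A $ 2 $ 2, - (A $ 1 $ 2)], vector [- (A $ 2 $ 1), A $ 1 $ 1]]"

definition munit :: "2 \<Rightarrow> 2 \<Rightarrow> cmat" where
  "munit k l = (\<chi> i j. if i = k \<and> j = l then 1 else 0)"

lemma mat2_eq_iff: "A = B \<longleftrightarrow> A $ 1 $ 1 = B $ 1 $ 1 \<and> A $ 1 $ 2 = B $ 1 $ 2 \<and> A $ 2 $ 1 = B $ 2 $ 1 \<and> A $ 2 $ 2 = B $ 2 $ 2"
  for A B :: cmat
  by (auto simp: vec_eq_iff forall_2)

lemma mat2_mult: "(A ** B) $ i $ j = A $ i $ 1 * B $ 1 $ j + A $ i $ 2 * B $ 2 $ j" for A B :: cmat
  by (simp add: matrix_matrix_mult_def sum_2)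

lemma mat2_entries [simp]:
  "cscale c A $ i $ j = c * A $ i $ j"
  "adj2 A $ 1 $ 1 = A $ 2 $ 2" "adj2 A $ 1 $ 2 = - (A $ 1 $ 2)"
  "adj2 A $ 2 $ 1 = - (A $ 2 $ 1)" "adj2 A $ 2 $ 2 = A $ 1 $ 1"
  "munit k l $ i $ j = (if i = k \<and> j = l then 1 else 0)"
  "dagger A $ i $ j = cnj (A $ j $ i)"
  "transpose A $ i $ j = A $ j $ i"
  by (simp_all add: cscale_def adj2_def munit_def dagger_def transpose_def vector_2)

lemma mat1_entries [simp]: "(mat 1 :: cmat) $ i $ j = (if i = j then 1 else 0)"
  by (simp add: mat_def)

lemma trace2: "trace A = A $ 1 $ 1 + A $ 2 $ 2" for A :: cmat
  by (simp add: trace_def sum_2)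

lemmas mat2 = mat2_eq_iff mat2_mult trace2

lemma cscale_simps:
  "cscale c A ** B = cscale c (A ** B)" "A ** cscale c B = cscale c (A ** B)"
  "cscale c (cscale e A) = cscale (c * e) A" "cscale c (A + B) = cscale c A + cscale c B"
  "cscale c (A - B) = cscale c A - cscale c B" "transpose (cscale c A) = cscale c (transpose A)"
  "dagger (cscale c A) = cscale (cnj c) (dagger A)" "trace (cscale c A) = c * trace A"
  "cscale c (- A) = - cscale c A" "cscale 1 A = A" "cscale c 0 = 0" "cscale 0 A = 0"
  by (simp_all add: mat2 algebra_simps)

lemma matrix_ring_simps:
  "A ** (B + C) = A ** B + A ** C" "(B + C) ** A = B ** A + C ** A"
  "A ** (B - C) = A ** B - A ** C" "(B - C) ** A = B ** A - C ** A"
  "A ** (- B) = - (A ** B)" "(- B) ** A = - (B ** A)"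
  "A ** 0 = 0" "0 ** A = 0" "A ** mat 1 = A" "mat 1 ** A = A"
  "(A ** B) ** C = A ** (B ** C)" "A ** (r *\<^sub>R B) = r *\<^sub>R (A ** B)" "(r *\<^sub>R A) ** B = r *\<^sub>R (A ** B)"
  for A B C :: cmat
  by (simp_all add: mat2 algebra_simps)

lemma transpose_simps:
  "transpose (A + B) = transpose A + transpose B" "transpose (A - B) = transpose A - transpose B"
  "transpose (A ** B) = transpose B ** transpose A" "transpose (mat 1 :: cmat) = mat 1"
  "transpose (r *\<^sub>R A) = r *\<^sub>R transpose A" "transpose (- A) = - transpose A" "transpose (0::cmat) = 0"
  "transpose (transpose A) = A"
  "dagger (A + B) = dagger A + dagger B" "dagger (A - B) = dagger A - dagger B"
  "dagger (A ** B) = dagger B ** dagger A" "dagger (mat 1) = mat 1"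
  "dagger (r *\<^sub>R A) = r *\<^sub>R dagger A" "dagger (dagger A) = A" "dagger (transpose A) = transpose (dagger A)"
  "dagger (- A) = - dagger A"
  for A B :: cmat
  by (simp_all add: mat2 algebra_simps)

lemma adj2_simps: "adj2 (A ** B) = adj2 B ** adj2 A" "adj2 (A + B) = adj2 A + adj2 B"
  "adj2 (cscale c A) = cscale c (adj2 A)"
  by (simp_all add: mat2 algebra_simps)

lemma munit_mult: "munit i j ** munit k l = (if j = k then munit i l else 0)"
  using exhaust_2[of j] exhaust_2[of k]
  by (elim disjE) (simp_all add: vec_eq_iff matrix_matrix_mult_def sum_2)

lemma munit_dagger: "dagger (munit i j) = munit j i" "transpose (munit i j) = munit j i"
  by (simp_all add: vec_eq_iff conj_commute)

lemma munit_sum: "munit 1 1 + munit 2 2 = mat 1"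
  by (simp add: mat2)

lemma SL2C_iff: "A \<in> SL2C \<longleftrightarrow> A $ 1 $ 1 * A $ 2 $ 2 - A $ 1 $ 2 * A $ 2 $ 1 = 1"
  by (simp add: SL2C_def det_2)

lemma SL2C_adj2:
  assumes "A \<in> SL2C"
  shows "adj2 A ** A = mat 1" "A ** adj2 A = mat 1" "matrix_inv A = adj2 A"
    "adj2 A ** (A ** B) = B" "A ** (adj2 A ** B) = B"
proof -
  show 1: "adj2 A ** A = mat 1" "A ** adj2 A = mat 1"
    using assms unfolding SL2C_iff mat2 by (simp_all add: algebra_simps)
  then show "matrix_inv A = adj2 A"
    using SL2C_inverse(2)[OF assms] by (metis matrix_mul_assoc matrix_mul_lid matrix_mul_rid)
  show "adj2 A ** (A ** B) = B" "A ** (adj2 A ** B) = B"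
    by (simp_all add: 1 matrix_mul_assoc)
qed

lemma SU2_D:
  assumes "C \<in> SU2"
  shows "C ** dagger C = mat 1" "dagger C ** C = mat 1" "C ** (dagger C ** B) = B"
    "dagger C ** (C ** B) = B" "adj2 C = dagger C" "adj2 (dagger C) = C" "C \<in> SL2C"
proof -
  show 1: "C ** dagger C = mat 1" "C \<in> SL2C" using assms by (auto simp: SU2_def)
  then show 2: "dagger C ** C = mat 1" using matrix_left_right_inverse by blast
  show "C ** (dagger C ** B) = B" "dagger C ** (C ** B) = B"
    by (simp_all add: 1 2 matrix_mul_assoc)
  show a: "adj2 C = dagger C"
    using 1 SL2C_adj2(1)[OF 1(2)] by (metis matrix_mul_assoc matrix_mul_lid matrix_mul_rid)
  have "adj2 (adj2 C) = C" by (simp add: mat2)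
  with a show "adj2 (dagger C) = C" by simp
qed

subsection \<open>The complex projective line\<close>

text \<open>Homogeneous coordinates are row vectors, acted on from the right. Hence it is the
  transpose of the projection \<open>hpoint w\<close> that transforms by conjugation, and
  \<open>outer\<close> is this transpose before normalisation.\<close>

definition outer :: "complex^2 \<Rightarrow> cmat" where
  "outer w = (\<chi> i j. cnj (w $ i) * w $ j)"

lemma outer_entries [simp]: "outer w $ i $ j = cnj (w $ i) * w $ j"
  by (simp add: outer_def)

lemma transpose_hpoint: "transpose (hpoint w) = cscale (1 / trace (outer w)) (outer w)"
  by (simp add: mat2 hpoint_def norm_sq_vec2 mult.commute del: of_real_power)

lemma trace_outer: "trace (outer w) = complex_of_real ((norm w)\<^sup>2)"
  by (simp only: trace2 norm_sq_vec2 outer_entries mult.commute)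

lemma outer_act: "outer (w v* C) = dagger C ** outer w ** C"
  by (simp add: mat2 vector_matrix_mult_def sum_2 algebra_simps)

lemma hpoint_unitary:
  assumes "C \<in> SU2"
  shows "transpose (hpoint (w v* C)) = dagger C ** transpose (hpoint w) ** C"
proof -
  have "trace (dagger C ** (outer w ** C)) = trace (outer w)"
    using trace_mul_sym[of "dagger C" "outer w ** C"] SU2_D[OF assms]
    by (simp add: matrix_ring_simps)
  then show ?thesis
    by (simp add: transpose_hpoint outer_act matrix_ring_simps cscale_simps)
qed

text \<open>A unit representative (p, q) is completed to a unitary matrix with second row (p, q), so
  that [p, q] = [0, 1] C and computations at \<open>P\<close> are conjugate to those at
  [0, 1].\<close>

lemma CP1_E:
  assumes "P \<in> CP1"
  obtains p q C where "P = hpoint (vector [p, q])" "p * cnj p + q * cnj q = 1"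
    "C = vector [vector [cnj q, - cnj p], vector [p, q]]" "C \<in> SU2"
    "transpose P = dagger C ** munit 2 2 ** C"
proof -
  obtain w where w: "w \<noteq> 0" "P = hpoint w" using assms by (auto simp: CP1_def)
  define c where "c = complex_of_real (1 / norm w)"
  have c: "c \<noteq> 0" using w by (simp add: c_def)
  define p q where "p = c * w $ 1" and "q = c * w $ 2"
  have cw: "c *s w = vector [p, q]" by (simp add: vec_eq_iff forall_2 vector_2 p_def q_def)
  have P: "P = hpoint (vector [p, q])" using hpoint_scale[OF c, of w] w cw by simp
  have "p * cnj p + q * cnj q = c * cnj c * complex_of_real ((norm w)\<^sup>2)"
    by (simp only: norm_sq_vec2 p_def q_def) (simp add: algebra_simps)
  also have "\<dots> = 1" using w by (simp add: c_def power2_eq_square)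
  finally have n: "p * cnj p + q * cnj q = 1" .
  define C :: cmat where "C = vector [vector [cnj q, - cnj p], vector [p, q]]"
  have C: "C \<in> SU2"
    unfolding SU2_def mem_Collect_eq SL2C_iff mat2
    using n by (simp add: C_def vector_2 algebra_simps)
  have "vector [p, q] = vector [0, 1] v* C"
    by (simp add: vec_eq_iff forall_2 vector_matrix_mult_def sum_2 C_def vector_2)
  moreover have "transpose (hpoint (vector [0, 1])) = munit 2 2"
    by (simp add: transpose_hpoint mat2 vector_2)
  ultimately have "transpose P = dagger C ** munit 2 2 ** C"
    using hpoint_unitary[OF C, of "vector [0, 1]"] P by simp
  with P n C_def C that show thesis by blast
qed

lemma CP1_D:
  assumes "P \<in> CP1"
  shows "P ** P = P" "P ** (P ** B) = P ** B" "dagger P = P" "trace P = 1"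
    "transpose P ** transpose P = transpose P" "transpose P ** (transpose P ** B) = transpose P ** B"
proof -
  obtain C where C: "C \<in> SU2" and P: "transpose P = dagger C ** munit 2 2 ** C"
    using CP1_E[OF assms] by metis
  show Q: "transpose P ** transpose P = transpose P"
    unfolding P by (simp add: matrix_ring_simps SU2_D[OF C]) (simp add: munit_mult flip: matrix_ring_simps(11))
  then have "transpose (transpose P ** transpose P) = P" by (simp add: transpose_simps)
  then show PP: "P ** P = P" by (simp add: transpose_simps)
  show "P ** (P ** B) = P ** B" by (simp add: PP matrix_mul_assoc)
  show "transpose P ** (transpose P ** B) = transpose P ** B" by (simp add: Q matrix_mul_assoc)
  have "dagger (transpose P) = transpose P" unfolding P
    by (simp add: transpose_simps munit_dagger matrix_ring_simps)
  then have "transpose (dagger P) = transpose P" by (simp add: transpose_simps)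
  then show "dagger P = P" by (metis transpose_transpose)
  have "trace (transpose P) = 1"
    unfolding P matrix_mul_assoc[symmetric] trace_mul_sym[of "dagger C"]
    by (simp add: matrix_ring_simps SU2_D[OF C]) (simp add: trace2)
  then show "trace P = 1" by (simp add: trace2)
qed

subsection \<open>Smoothness of matrix expressions\<close>

lemma bounded_linear_fun: "linear f \<Longrightarrow> bounded_linear f"
  for f :: "'a::euclidean_space \<Rightarrow> 'b::real_normed_vector"
  by (simp add: linear_conv_bounded_linear)

lemma bounded_bilinear_matrix_mult: "bounded_bilinear ((**) :: cmat \<Rightarrow> cmat \<Rightarrow> cmat)"
  unfolding bilinear_conv_bounded_bilinear[symmetric] bilinear_def
  by (auto intro!: linear_slotI simp: matrix_ring_simps)

lemma bounded_bilinear_cscale: "bounded_bilinear cscale"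
  unfolding bilinear_conv_bounded_bilinear[symmetric] bilinear_def
  by (auto intro!: linear_slotI simp: mat2 algebra_simps)

lemma linear_cmat: "linear dagger" "linear (transpose :: cmat \<Rightarrow> cmat)" "linear adj2"
  "linear (trace :: cmat \<Rightarrow> complex)" "linear (\<lambda>A::cmat. A $ i $ j)"
  by (auto intro!: linear_slotI simp: mat2 algebra_simps)

lemmas bounded_linear_cmat = linear_cmat[THEN bounded_linear_fun]

lemma smooth_on_Pair:
  fixes f :: "'e::euclidean_space \<Rightarrow> 'b::real_normed_vector" and g :: "'e \<Rightarrow> 'c::real_normed_vector"
  assumes "open S" "smooth_on S f" "smooth_on S g"
  shows "smooth_on S (\<lambda>x. (f x, g x))"
proof -
  have "bounded_linear (\<lambda>a::'b. (a, 0::'c))" "bounded_linear (\<lambda>b::'c. (0::'b, b))"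
    by (intro bounded_linear_Pair bounded_linear_ident bounded_linear_zero)+
  then have "smooth_on S (\<lambda>x. (f x, 0) + (0, g x))"
    using assms by (intro smooth_on_add) (auto intro: smooth_on_linear)
  then show ?thesis by simp
qed

lemma smooth_on_minus: "open S \<Longrightarrow> smooth_on S f \<Longrightarrow> smooth_on S g \<Longrightarrow> smooth_on S (\<lambda>x. f x - g x)"
  for f :: "'e::euclidean_space \<Rightarrow> 'b::real_normed_vector"
  using smooth_on_add[of S f "\<lambda>x. - g x"] smooth_on_linear[OF bounded_linear_minus[OF bounded_linear_ident], of S g]
  by simp

lemma smooth_on_uminus: "open S \<Longrightarrow> smooth_on S g \<Longrightarrow> smooth_on S (\<lambda>x. - g x)"
  for g :: "'e::euclidean_space \<Rightarrow> 'b::real_normed_vector"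
  by (rule smooth_on_linear[OF bounded_linear_minus[OF bounded_linear_ident]])

lemmas smooth_on_cmat =
  smooth_on_bilinear[OF bounded_bilinear_matrix_mult] smooth_on_bilinear[OF bounded_bilinear_cscale]
  smooth_on_bilinear[OF bounded_bilinear_scaleR]
  bounded_linear_cmat[THEN smooth_on_linear] smooth_on_linear[OF bounded_linear_fst]
  smooth_on_linear[OF bounded_linear_snd] smooth_on_linear[OF bounded_linear_of_real]
  smooth_on_linear[OF bounded_linear_Re] smooth_on_linear[OF bounded_linear_Im]
  smooth_on_linear[OF bounded_linear_cnj]
  smooth_on_add smooth_on_minus smooth_on_uminus smooth_on_mult smooth_on_Pair smooth_on_const smooth_on_ident

subsection \<open>Tangent spaces\<close>

lemma tangent_Times: "tangent (S \<times> T) (a, b) = tangent S a \<times> tangent T b"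
proof (intro equalityI subsetI)
  fix v assume "v \<in> tangent (S \<times> T) (a, b)"
  then obtain c where c: "\<forall>t. c t \<in> S \<times> T" "c 0 = (a, b)" "(c has_vector_derivative v) (at 0)"
    unfolding tangent_def by blast
  have "((\<lambda>t. fst (c t)) has_vector_derivative fst v) (at 0)" "((\<lambda>t. snd (c t)) has_vector_derivative snd v) (at 0)"
    using c(3) by (auto intro: bounded_linear.has_vector_derivative[OF bounded_linear_fst]
        bounded_linear.has_vector_derivative[OF bounded_linear_snd])
  then have "fst v \<in> tangent S a" "snd v \<in> tangent T b"
    using c(1,2) unfolding tangent_def
    by (auto intro!: exI[of _ "\<lambda>t. fst (c t)"] exI[of _ "\<lambda>t. snd (c t)"] simp: mem_Times_iff)
  then show "v \<in> tangent S a \<times> tangent T b" by (simp add: mem_Times_iff)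
next
  fix v assume "v \<in> tangent S a \<times> tangent T b"
  then obtain c e where c: "\<forall>t. c t \<in> S" "c 0 = a" "(c has_vector_derivative fst v) (at 0)"
    "\<forall>t. e t \<in> T" "e 0 = b" "(e has_vector_derivative snd v) (at 0)"
    unfolding tangent_def by auto
  have "((\<lambda>t. (c t, e t)) has_vector_derivative (fst v, snd v)) (at 0)"
    by (intro has_vector_derivative_Pair c)
  with c show "v \<in> tangent (S \<times> T) (a, b)"
    unfolding tangent_def by (auto intro!: exI[of _ "\<lambda>t. (c t, e t)"])
qed

lemma tangent_SL2C:
  assumes A: "A \<in> SL2C"
  shows "tangent SL2C A = {V. trace (adj2 A ** V) = 0}"
proof (intro equalityI subsetI)
  fix V assume V: "V \<in> tangent SL2C A"
  let ?f = "\<lambda>A::cmat. A $ 1 $ 1 * A $ 2 $ 2 - A $ 1 $ 2 * A $ 2 $ 1"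
  note bl = bounded_linear.has_derivative[OF bounded_linear_cmat(5) has_derivative_ident]
  have "(?f has_derivative (\<lambda>V. A $ 1 $ 1 * V $ 2 $ 2 + V $ 1 $ 1 * A $ 2 $ 2
      - (A $ 1 $ 2 * V $ 2 $ 1 + V $ 1 $ 2 * A $ 2 $ 1))) (at A within SL2C)"
    by (intro has_derivative_diff has_derivative_mult bl)
  from derivative_unique_on_tangent[OF this has_derivative_const open_UNIV UNIV_I _ V, of 1]
  show "V \<in> {V. trace (adj2 A ** V) = 0}"
    by (simp add: SL2C_iff mat2 algebra_simps)
next
  fix V assume "V \<in> {V. trace (adj2 A ** V) = 0}"
  define X where "X = adj2 A ** V"
  have tr: "X $ 1 $ 1 = - X $ 2 $ 2"
    using \<open>V \<in> _\<close> unfolding X_def trace2 by (simp add: eq_neg_iff_add_eq_0)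
  let ?x = "X $ 1 $ 1" and ?y = "X $ 1 $ 2" and ?z = "X $ 2 $ 1"
  \<comment> \<open>\<open>A\<close> times diag(e^(t x), e^(-t x)) times an upper and a lower
    unipotent matrix with entries t y and t z: the determinant stays 1 for all t, and the velocity
    at 0 is \<open>A ** X\<close>.\<close>
  define c where "c = (\<lambda>t::real. A ** (cscale (exp (of_real t * ?x) * (1 + of_real t * of_real t * ?y * ?z)) (munit 1 1)
    + cscale (exp (of_real t * ?x) * of_real t * ?y) (munit 1 2)
    + cscale (exp (- of_real t * ?x) * of_real t * ?z) (munit 2 1) + cscale (exp (- of_real t * ?x)) (munit 2 2)))"
  have e: "exp (of_real t * ?x) * exp (- of_real t * ?x) = 1" for t
    by (simp flip: exp_add)
  have d: "A $ 1 $ 1 * A $ 2 $ 2 - A $ 1 $ 2 * A $ 2 $ 1 = 1" using A SL2C_iff by blast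
  have "c t \<in> SL2C" for t
  proof -
    have "det (c t) = det A * (exp (of_real t * ?x) * exp (- of_real t * ?x))"
      unfolding c_def det_mul by (simp add: det_2 algebra_simps)
    with e A show ?thesis by (simp add: SL2C_def)
  qed
  moreover have "c 0 = A" by (simp add: c_def cscale_simps matrix_ring_simps(9) munit_sum)
  moreover have "(c has_vector_derivative A ** (cscale ?x (munit 1 1) + cscale ?y (munit 1 2)
      + cscale ?z (munit 2 1) + cscale (- ?x) (munit 2 2))) (at 0)"
    unfolding c_def
    by (rule bounded_linear.has_vector_derivative[OF bounded_bilinear.bounded_linear_right[OF bounded_bilinear_matrix_mult]],
        intro has_vector_derivative_add bounded_linear.has_vector_derivative[OF
          bounded_bilinear.bounded_linear_left[OF bounded_bilinear_cscale]];
        rule has_vector_derivative_real_field; auto intro!: derivative_eq_intros)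
  moreover have "A ** (cscale ?x (munit 1 1) + cscale ?y (munit 1 2)
      + cscale ?z (munit 2 1) + cscale (- ?x) (munit 2 2)) = V"
  proof -
    have "cscale ?x (munit 1 1) + cscale ?y (munit 1 2) + cscale ?z (munit 2 1) + cscale (- ?x) (munit 2 2) = X"
      using tr by (simp add: mat2)
    then show ?thesis by (simp add: X_def SL2C_adj2[OF A])
  qed
  ultimately show "V \<in> tangent SL2C A" unfolding tangent_def by auto
qed

lemma tangent_CP1:
  assumes P: "P \<in> CP1"
  shows "tangent CP1 P = {W. dagger W = W \<and> W = W ** P + P ** W}"
proof (intro equalityI subsetI)
  fix W assume W: "W \<in> tangent CP1 P"
  have "((\<lambda>P. P - dagger P) has_derivative (\<lambda>W. W - dagger W)) (at P within CP1)"
    by (intro has_derivative_diff has_derivative_ident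
        bounded_linear.has_derivative[OF bounded_linear_cmat(1) has_derivative_ident])
  from derivative_unique_on_tangent[OF this has_derivative_const open_UNIV UNIV_I _ W, of 0]
  have 1: "W - dagger W = 0" using CP1_D by simp
  have "((\<lambda>P. P ** P - P) has_derivative (\<lambda>W. P ** W + W ** P - W)) (at P within CP1)"
    by (intro has_derivative_diff has_derivative_ident
        bounded_bilinear.FDERIV[OF bounded_bilinear_matrix_mult has_derivative_ident has_derivative_ident])
  from derivative_unique_on_tangent[OF this has_derivative_const open_UNIV UNIV_I _ W, of 0]
  have "P ** W + W ** P - W = 0" using CP1_D by simp
  with 1 show "W \<in> {W. dagger W = W \<and> W = W ** P + P ** W}" by (simp add: algebra_simps)
next
  fix W assume W: "W \<in> {W. dagger W = W \<and> W = W ** P + P ** W}"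
  obtain C where C: "C \<in> SU2" and Q: "transpose P = dagger C ** munit 2 2 ** C"
    using CP1_E[OF P] by metis
  define Z where "Z = C ** transpose W ** dagger C"
  have Wd: "dagger W = W" and WP: "W = W ** P + P ** W" using W by blast+
  have tW: "transpose W = dagger C ** Z ** C"
    unfolding Z_def by (simp add: matrix_ring_simps SU2_D[OF C])
  have Zd: "dagger Z = Z"
    unfolding Z_def by (simp add: transpose_simps Wd matrix_ring_simps)
  have "transpose W = transpose P ** transpose W + transpose W ** transpose P"
    by (subst WP) (simp add: transpose_simps)
  then have "dagger C ** Z ** C = dagger C ** (munit 2 2 ** Z + Z ** munit 2 2) ** C"
    unfolding tW Q by (simp add: matrix_ring_simps SU2_D[OF C])
  then have "C ** (dagger C ** Z ** C) ** dagger C = C ** (dagger C ** (munit 2 2 ** Z + Z ** munit 2 2) ** C) ** dagger C"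
    by simp
  then have "Z = munit 2 2 ** Z + Z ** munit 2 2"
    by (simp add: matrix_ring_simps SU2_D[OF C])
  then have Z0: "Z $ 1 $ 1 = 0" "Z $ 2 $ 2 = 0" by (simp_all add: mat2)
  define z where "z = Z $ 2 $ 1"
  have Z: "Z = cscale (cnj z) (munit 1 2) + cscale z (munit 2 1)"
    using Z0 arg_cong[OF Zd, of "\<lambda>M. M $ 1 $ 2"] by (simp add: mat2 z_def)
  define m where "m = (norm z)\<^sup>2"
  have m: "complex_of_real m = z * cnj z" unfolding m_def by (rule complex_norm_square)
  \<comment> \<open>In the frame \<open>C\<close> the point is [0, 1], and the tangent vector is the
    off-diagonal Hermitian matrix with lower left entry \<open>z\<close>, the velocity of
    [t z, 1].\<close>
  define c where "c = (\<lambda>t::real. hpoint (vector [of_real t * z, 1] v* C))"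
  have c: "transpose (c t) = dagger C ** (cscale (inverse (of_real (1 + m * t\<^sup>2))) (munit 2 2
      + cscale (of_real (m * t\<^sup>2)) (munit 1 1) + cscale (of_real t) Z)) ** C" for t
  proof -
    have "outer (vector [of_real t * z, 1]) = munit 2 2
      + cscale (of_real (m * t\<^sup>2)) (munit 1 1) + cscale (of_real t) Z"
      by (simp add: mat2 Z vector_2 m power2_eq_square mult_ac)
    moreover have "trace (outer (vector [of_real t * z, 1])) = of_real (1 + m * t\<^sup>2)"
      by (simp add: trace2 vector_2 m power2_eq_square mult_ac)
    ultimately show ?thesis
      unfolding c_def hpoint_unitary[OF C] by (simp add: transpose_hpoint inverse_eq_divide)
  qed
  have "c t \<in> CP1" for t
  proof -
    have "vector [of_real t * z, 1] v* C \<noteq> 0"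
    proof
      assume "vector [of_real t * z, 1] v* C = 0"
      then have "vector [of_real t * z, 1] v* C v* dagger C = 0" by (simp add: vector_matrix_mult_0)
      then have "vector [of_real t * z, 1] = (0 :: complex^2)"
        by (simp add: vector_matrix_mul_assoc SU2_D[OF C])
      then show False by (simp add: vec_eq_iff forall_2 vector_2)
    qed
    then show ?thesis unfolding c_def CP1_def by blast
  qed
  moreover have "c 0 = P"
  proof -
    have "transpose (c 0) = transpose P" unfolding c Q by (simp add: cscale_simps)
    then show ?thesis by (metis transpose_transpose)
  qed
  moreover have "(c has_vector_derivative W) (at 0)"
  proof -
    have "((\<lambda>t. inverse (complex_of_real (1 + m * t\<^sup>2))) has_vector_derivative 0) (at 0)"
      unfolding has_vector_derivative_def
      by (auto intro!: derivative_eq_intros)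
    moreover have "((\<lambda>t. munit 2 2 + cscale (of_real (m * t\<^sup>2)) (munit 1 1) + cscale (of_real t) Z)
        has_vector_derivative 0 + cscale 0 (munit 1 1) + cscale 1 Z) (at 0)"
      by (intro has_vector_derivative_add has_vector_derivative_const bounded_linear.has_vector_derivative[OF
          bounded_bilinear.bounded_linear_left[OF bounded_bilinear_cscale]])
         (auto intro!: derivative_eq_intros simp: has_vector_derivative_def fun_eq_iff scaleR_conv_of_real)
    ultimately have "((\<lambda>t. cscale (inverse (of_real (1 + m * t\<^sup>2))) (munit 2 2
      + cscale (of_real (m * t\<^sup>2)) (munit 1 1) + cscale (of_real t) Z))
      has_vector_derivative cscale 1 Z) (at 0)"
      by (auto simp: cscale_simps dest!: bounded_bilinear.has_vector_derivative[OF bounded_bilinear_cscale])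
    then have "((\<lambda>t. transpose (c t)) has_vector_derivative dagger C ** Z ** C) (at 0)"
      unfolding c
      by (intro bounded_linear.has_vector_derivative[OF bounded_bilinear.bounded_linear_left[OF bounded_bilinear_matrix_mult]]
           bounded_linear.has_vector_derivative[OF bounded_bilinear.bounded_linear_right[OF bounded_bilinear_matrix_mult]])
         (simp add: cscale_simps)
    from bounded_linear.has_vector_derivative[OF bounded_linear_cmat(2) this]
    show ?thesis unfolding tW[symmetric] by (simp add: transpose_simps)
  qed
  ultimately show "W \<in> tangent CP1 P" unfolding tangent_def by blast
qed

subsection \<open>The holomorphic Pfaffian system\<close>

abbreviation SLCP :: "(cmat \<times> cmat) set" where "SLCP \<equiv> SL2C \<times> CP1"

text \<open>Hermitian part, then the two off-diagonal blocks with respect to \<open>P\<close>. This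
  is polynomial in \<open>P\<close>, and at points of \<open>CP1\<close> it projects onto the
  tangent space.\<close>

definition tproj :: "cmat \<Rightarrow> cmat \<Rightarrow> cmat" where
  "tproj P W = P ** ((1/2) *\<^sub>R (W + dagger W)) ** (mat 1 - P) + (mat 1 - P) ** ((1/2) *\<^sub>R (W + dagger W)) ** P"

definition tproj' :: "cmat \<Rightarrow> cmat \<Rightarrow> cmat \<Rightarrow> cmat" where
  "tproj' P U W = U ** ((1/2) *\<^sub>R (W + dagger W)) ** (mat 1 - P) - P ** ((1/2) *\<^sub>R (W + dagger W)) ** U
    + ((mat 1 - P) ** ((1/2) *\<^sub>R (W + dagger W)) ** U - U ** ((1/2) *\<^sub>R (W + dagger W)) ** P)"

text \<open>The first component removes the trace of the Maurer-Cartan form; the factor 1/2 comes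
  from \<open>trace (adj2 A ** A) = 2\<close> on \<open>SL2C\<close>.\<close>

definition pE :: "cmat \<times> cmat \<Rightarrow> cmat \<times> cmat \<Rightarrow> cmat \<times> cmat" where
  "pE x v = (fst v - cscale (1/2 * trace (adj2 (fst x) ** fst v)) (fst x), tproj (snd x) (snd v))"

definition pE' :: "cmat \<times> cmat \<Rightarrow> cmat \<times> cmat \<Rightarrow> cmat \<times> cmat \<Rightarrow> cmat \<times> cmat" where
  "pE' x u v = (- (cscale (1/2 * trace (adj2 (fst x) ** fst v)) (fst u)
      + cscale (1/2 * trace (adj2 (fst u) ** fst v)) (fst x)), tproj' (snd x) (snd u) (snd v))"

text \<open>With \<open>Q\<close> the transpose of \<open>P\<close>, the distribution annihilated by the system consists of the
  tangent vectors with \<open>Q ** X = 0\<close> for \<open>X\<close> the Maurer-Cartan form; \<open>X\<close> is then nilpotent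
  and equal to \<open>(1 - Q) ** X ** Q\<close>.\<close>
definition dE :: "cmat \<times> cmat \<Rightarrow> cmat \<times> cmat \<Rightarrow> cmat \<times> cmat" where
  "dE x v = (fst x ** (mat 1 - transpose (snd x)) ** adj2 (fst x) ** fst v ** transpose (snd x),
    tproj (snd x) (snd v))"

definition dE' :: "cmat \<times> cmat \<Rightarrow> cmat \<times> cmat \<Rightarrow> cmat \<times> cmat \<Rightarrow> cmat \<times> cmat" where
  "dE' x u v = (fst x ** (mat 1 - transpose (snd x)) ** adj2 (fst x) ** fst v ** transpose (snd u)
      + (fst x ** (mat 1 - transpose (snd x)) ** adj2 (fst u)
        + (fst x ** (- transpose (snd u)) + fst u ** (mat 1 - transpose (snd x))) ** adj2 (fst x))
        ** fst v ** transpose (snd x), tproj' (snd x) (snd u) (snd v))"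

text \<open>The complex structure of the product, \<open>CP1\<close> being embedded by projections.\<close>
definition JE :: "cmat \<times> cmat \<Rightarrow> cmat \<times> cmat \<Rightarrow> cmat \<times> cmat" where
  "JE x v = (cscale \<i> (fst v), cscale \<i> (snd v ** snd x - snd x ** snd v))"

lemma tangent_SLCP:
  assumes "x \<in> SLCP"
  shows "v \<in> tangent SLCP x \<longleftrightarrow> trace (adj2 (fst x) ** fst v) = 0 \<and> dagger (snd v) = snd v \<and>
    snd v = snd v ** snd x + snd x ** snd v"
  using assms by (cases x; cases v) (auto simp: tangent_Times tangent_SL2C tangent_CP1)

lemma tangent_CP1_D:
  assumes P: "P \<in> CP1" and W: "dagger W = W" "W = W ** P + P ** W"
  shows "P ** (W ** P) = 0" "tproj P W = W"
proof -
  have "P ** (W ** P) = P ** ((W ** P + P ** W) ** P)" using W(2) by simp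
  also have "\<dots> = P ** (W ** P) + P ** (W ** P)" by (simp add: matrix_ring_simps CP1_D[OF P])
  finally show 0: "P ** (W ** P) = 0" by simp
  have H: "(1/2) *\<^sub>R (W + dagger W) = W" by (simp add: W(1) flip: scaleR_2)
  show "tproj P W = W"
    unfolding tproj_def H using W(2) 0 by (simp add: matrix_ring_simps add.commute)
qed

lemma tproj_tangent:
  assumes P: "P \<in> CP1"
  shows "dagger (tproj P W) = tproj P W" "tproj P W = tproj P W ** P + P ** tproj P W"
proof -
  let ?H = "(1/2) *\<^sub>R (W + dagger W)"
  have H: "dagger ?H = ?H" by (simp add: transpose_simps add.commute)
  show "dagger (tproj P W) = tproj P W"
    unfolding tproj_def by (simp only: transpose_simps(9-12) H CP1_D(3)[OF P])
      (simp add: matrix_ring_simps add.commute)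
  show "tproj P W = tproj P W ** P + P ** tproj P W"
    unfolding tproj_def
    by (simp only: matrix_ring_simps(1-11) CP1_D(1,2)[OF P]) (simp add: algebra_simps)
qed

lemma tproj'_symmetric:
  assumes P: "P \<in> CP1" and U: "dagger U = U" "U = U ** P + P ** U"
    and W: "dagger W = W" "W = W ** P + P ** W"
  shows "tproj' P U W = tproj' P W U"
proof -
  have H: "(1/2) *\<^sub>R (Z + dagger Z) = Z" if "dagger Z = Z" for Z
    by (simp add: that flip: scaleR_2)
  \<comment> \<open>Tangent vectors of \<open>CP1\<close> exchange the range and the kernel of
    \<open>P\<close>, so a product of two of them commutes with \<open>P\<close>.\<close>
  have comm: "P ** (Y ** Z) = Y ** (Z ** P)" if "Y = Y ** P + P ** Y" "Z = Z ** P + P ** Z" for Y Z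
  proof -
    have "P ** Y = Y - Y ** P" "P ** Z = Z - Z ** P" using that by (simp_all add: algebra_simps)
    then have "P ** (Y ** Z) = Y ** Z - Y ** (P ** Z)" "Y ** (P ** Z) = Y ** Z - Y ** (Z ** P)"
      by (metis matrix_ring_simps(4,11)) (metis \<open>P ** Z = Z - Z ** P\<close> matrix_ring_simps(3))
    then show ?thesis by simp
  qed
  show ?thesis
    unfolding tproj'_def H[OF U(1)] H[OF W(1)]
    by (simp add: matrix_ring_simps comm[OF U(2) W(2)] comm[OF W(2) U(2)] algebra_simps)
qed

lemmas matrix_has_derivative =
  has_derivative_add has_derivative_diff bounded_bilinear.FDERIV[OF bounded_bilinear_matrix_mult]
  bounded_bilinear.FDERIV[OF bounded_bilinear_cscale] has_derivative_mult_right
  bounded_linear.has_derivative[OF bounded_linear_cmat(2)]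
  bounded_linear.has_derivative[OF bounded_linear_cmat(3)]
  bounded_linear.has_derivative[OF bounded_linear_cmat(4)]
  has_derivative_fst has_derivative_snd has_derivative_ident has_derivative_const

lemma tproj_derivative:
  "((\<lambda>y. tproj (snd y) W) has_derivative (\<lambda>h. tproj' (snd x) (snd h) W)) (at x)"
  for x :: "cmat \<times> cmat"
  unfolding tproj_def tproj'_def
  by (rule has_derivative_eq_rhs, (rule matrix_has_derivative)+)
     (simp add: fun_eq_iff matrix_ring_simps algebra_simps)

lemma pE_derivative: "((\<lambda>y. pE y v) has_derivative (\<lambda>h. pE' x h v)) (at x)"
  unfolding pE_def pE'_def
  by (rule has_derivative_eq_rhs, rule has_derivative_Pair, (rule tproj_derivative matrix_has_derivative)+)
     (simp add: fun_eq_iff matrix_ring_simps cscale_simps)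

lemma dE_derivative: "((\<lambda>y. dE y v) has_derivative (\<lambda>h. dE' x h v)) (at x)"
  unfolding dE_def dE'_def
  by (rule has_derivative_eq_rhs, rule has_derivative_Pair, (rule tproj_derivative matrix_has_derivative)+)
     (simp add: fun_eq_iff matrix_ring_simps)

lemma pE_ident: "x \<in> SLCP \<Longrightarrow> v \<in> tangent SLCP x \<Longrightarrow> pE x v = v"
  by (cases x; cases v) (simp add: tangent_SLCP pE_def tangent_CP1_D(2) cscale_simps)

lemma pE_tangent:
  assumes x: "x \<in> SLCP"
  shows "pE x v \<in> tangent SLCP x"
proof -
  have A: "fst x \<in> SL2C" and P: "snd x \<in> CP1" using x by auto
  have "trace (adj2 (fst x) ** (fst v - cscale t (fst x))) = trace (adj2 (fst x) ** fst v) - t * 2" for t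
    by (simp only: matrix_ring_simps(3) cscale_simps(2) SL2C_adj2(1)[OF A] trace_sub cscale_simps(8))
       (simp add: trace2)
  then show ?thesis
    unfolding tangent_SLCP[OF x] using tproj_tangent[OF P] by (simp add: pE_def)
qed

interpretation SLCP: projected_manifold SLCP pE pE'
proof
  fix x assume x: "x \<in> SLCP"
  show "subspace (tangent SLCP x)"
  proof -
    define f where "f = (\<lambda>v :: cmat \<times> cmat. (trace (adj2 (fst x) ** fst v), dagger (snd v) - snd v,
      snd v - (snd v ** snd x + snd x ** snd v)))"
    have "linear f"
      unfolding f_def by (rule linear_slotI)
        (simp add: matrix_ring_simps transpose_simps trace2 algebra_simps)
    moreover have "tangent SLCP x = {v. f v = 0}"
      unfolding f_def using tangent_SLCP[OF x] by (auto simp: zero_prod_def)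
    ultimately show ?thesis using real_vector.linear_subspace_kernel[of f] by simp
  qed
  show "pE' x u v = pE' x v u" if "u \<in> tangent SLCP x" "v \<in> tangent SLCP x" for u v
    using that x tproj'_symmetric[of "snd x" "snd u" "snd v"]
    unfolding tangent_SLCP[OF x] pE'_def
    by (auto simp: cscale_simps mat2 algebra_simps)
qed (rule pE_tangent pE_ident pE_derivative; assumption)+

text \<open>Coordinates on the distribution, for a unitary frame \<open>C\<close> adapted to the point.\<close>
definition vecD :: "cmat \<Rightarrow> cmat \<Rightarrow> complex \<Rightarrow> complex \<Rightarrow> cmat \<times> cmat" where
  "vecD A C y z = (A ** (dagger C ** (cscale y (munit 1 2) ** C)),
    transpose (dagger C ** ((cscale z (munit 1 2) + cscale (cnj z) (munit 2 1)) ** C)))"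

lemma transpose_tproj: "transpose (tproj P W) = tproj (transpose P) (transpose W)"
  by (simp add: tproj_def transpose_simps matrix_ring_simps algebra_simps)

lemma tproj_conj:
  assumes "C \<in> SU2"
  shows "tproj (dagger C ** (Q ** C)) (dagger C ** (Z ** C)) = dagger C ** (tproj Q Z ** C)"
  unfolding tproj_def
  by (simp add: transpose_simps matrix_ring_simps SU2_D[OF assms] algebra_simps)

locale adapted_frame =
  fixes A P C :: cmat
  assumes A: "A \<in> SL2C" and P: "P \<in> CP1" and C: "C \<in> SU2"
    and Q: "transpose P = dagger C ** (munit 2 2 ** C)"
begin

lemma point: "(A, P) \<in> SLCP" using A P by simp

lemma Q': "mat 1 - transpose P = dagger C ** (munit 1 1 ** C)"
proof -
  have "mat 1 = dagger C ** ((munit 1 1 + munit 2 2) ** C)"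
    by (simp add: munit_sum matrix_ring_simps(10) SU2_D[OF C])
  then show ?thesis unfolding Q by (simp add: matrix_ring_simps)
qed

lemma dE_eq_vecD:
  "dE (A, P) (V, W) = vecD A C ((C ** adj2 A ** V ** dagger C) $ 1 $ 2)
    (((C ** transpose W ** dagger C) $ 1 $ 2 + cnj ((C ** transpose W ** dagger C) $ 2 $ 1)) / 2)"
proof -
  have unit: "munit 1 1 ** (Y ** munit 2 2) = cscale (Y $ 1 $ 2) (munit 1 2)" for Y
    by (simp add: mat2)
  have 1: "A ** (dagger C ** (munit 1 1 ** C)) ** adj2 A ** V ** (dagger C ** (munit 2 2 ** C)) =
      A ** (dagger C ** (cscale ((C ** adj2 A ** V ** dagger C) $ 1 $ 2) (munit 1 2) ** C))"
    unfolding unit[symmetric] by (simp add: matrix_mul_assoc)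
  have "tproj (munit 2 2) Z = cscale ((Z $ 1 $ 2 + cnj (Z $ 2 $ 1)) / 2) (munit 1 2)
      + cscale (cnj ((Z $ 1 $ 2 + cnj (Z $ 2 $ 1)) / 2)) (munit 2 1)" for Z
    by (simp add: tproj_def mat2) (simp add: scaleR_conv_of_real field_simps)
  moreover have "transpose W = dagger C ** ((C ** transpose W ** dagger C) ** C)"
    by (simp add: matrix_ring_simps SU2_D[OF C])
  ultimately have "transpose (tproj P W) = dagger C ** ((cscale (((C ** transpose W ** dagger C) $ 1 $ 2 + cnj ((C ** transpose W ** dagger C) $ 2 $ 1)) / 2) (munit 1 2)
      + cscale (cnj (((C ** transpose W ** dagger C) $ 1 $ 2 + cnj ((C ** transpose W ** dagger C) $ 2 $ 1)) / 2)) (munit 2 1)) ** C)"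
    unfolding transpose_tproj Q by (metis tproj_conj[OF C])
  then have "tproj P W = transpose (dagger C ** ((cscale (((C ** transpose W ** dagger C) $ 1 $ 2 + cnj ((C ** transpose W ** dagger C) $ 2 $ 1)) / 2) (munit 1 2)
      + cscale (cnj (((C ** transpose W ** dagger C) $ 1 $ 2 + cnj ((C ** transpose W ** dagger C) $ 2 $ 1)) / 2)) (munit 2 1)) ** C))"
    by (metis transpose_transpose)
  with 1 show ?thesis unfolding dE_def vecD_def fst_conv snd_conv Q' unfolding Q by simp
qed

lemma dE_vecD: "dE (A, P) (vecD A C y z) = vecD A C y z"
proof -
  have "(C ** adj2 A ** (A ** (dagger C ** (cscale y (munit 1 2) ** C))) ** dagger C) = cscale y (munit 1 2)"
    by (simp add: matrix_ring_simps SL2C_adj2[OF A] SU2_D[OF C] cscale_simps)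
  moreover have "C ** transpose (transpose (dagger C ** (Z ** C))) ** dagger C = Z" for Z
    by (simp add: transpose_simps(8) matrix_ring_simps SU2_D[OF C])
  ultimately show ?thesis unfolding vecD_def dE_eq_vecD by (simp add: vecD_def)
qed

lemma ex_vecD: "\<exists>y z. dE (A, P) v = vecD A C y z"
  using dE_eq_vecD by (cases v) blast

text \<open>In the frame the CP1 component is the velocity of [t \<open>cnj z\<close>, 1], so
  \<open>cnj z\<close> is the holomorphic coordinate; multiplying it by \<i> turns \<open>z\<close>
  into \<open>- \<i> * z\<close>.\<close>

lemma JE_vecD: "JE (A, P) (vecD A C y z) = vecD A C (\<i> * y) (- \<i> * z)"
proof -
  let ?Z = "cscale z (munit 1 2) + cscale (cnj z) (munit 2 1)"
  have "transpose (cscale \<i> (transpose (dagger C ** (?Z ** C)) ** P - P ** transpose (dagger C ** (?Z ** C))))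
      = cscale \<i> (transpose P ** (dagger C ** (?Z ** C)) - (dagger C ** (?Z ** C)) ** transpose P)"
    by (simp only: transpose_simps(2,3,8) cscale_simps)
  also have "\<dots> = dagger C ** (cscale \<i> (munit 2 2 ** ?Z - ?Z ** munit 2 2) ** C)"
    unfolding Q by (simp only: matrix_ring_simps(3,4,11) SU2_D[OF C] cscale_simps)
  also have "cscale \<i> (munit 2 2 ** ?Z - ?Z ** munit 2 2) =
      cscale (- \<i> * z) (munit 1 2) + cscale (cnj (- \<i> * z)) (munit 2 1)"
    by (simp add: mat2)
  finally have "cscale \<i> (transpose (dagger C ** (?Z ** C)) ** P - P ** transpose (dagger C ** (?Z ** C))) =
      transpose (dagger C ** ((cscale (- \<i> * z) (munit 1 2) + cscale (cnj (- \<i> * z)) (munit 2 1)) ** C))"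
    by (metis transpose_transpose)
  then show ?thesis by (simp add: JE_def vecD_def cscale_simps)
qed

lemma vecD_tangent: "vecD A C y z \<in> tangent SLCP (A, P)"
proof -
  have "dE (A, P) v \<in> tangent SLCP (A, P)" for v
  proof -
    let ?Y = "adj2 A ** fst v"
    have "trace (adj2 A ** (A ** ((mat 1 - transpose P) ** (?Y ** transpose P)))) = trace ((mat 1 - transpose P) ** (?Y ** transpose P))"
      by (simp only: SL2C_adj2(4)[OF A])
    also have "trace ((mat 1 - transpose P) ** (?Y ** transpose P)) = trace (?Y ** (transpose P ** (mat 1 - transpose P)))"
      using trace_mul_sym[of "mat 1 - transpose P" "?Y ** transpose P"] by (simp only: matrix_ring_simps(11))
    also have "transpose P ** (mat 1 - transpose P) = 0"
      by (simp add: matrix_ring_simps CP1_D[OF P])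
    finally have "trace (adj2 A ** (A ** ((mat 1 - transpose P) ** (?Y ** transpose P)))) = 0"
      by (simp add: matrix_ring_simps(7) trace2)
    then show ?thesis
      unfolding tangent_SLCP[OF point] dE_def fst_conv snd_conv matrix_ring_simps(11)
      using tproj_tangent[OF P] by simp
  qed
  from this[of "vecD A C y z"] show ?thesis unfolding dE_vecD .
qed

text \<open>Moving \<open>A\<close> contributes nothing, since the products of matrix units that
  arise vanish. Moving \<open>P\<close> contributes the commutator of \<open>munit 1 2\<close> with
  the part \<open>cnj z\<close> times \<open>munit 2 1\<close> of the CP1 component, which is
  diagonal.\<close>

lemma dE'_vecD:
  "fst (dE' (A, P) (vecD A C y z) (vecD A C y' z')) =
    A ** (dagger C ** (cscale (y' * cnj z) (munit 1 1 - munit 2 2) ** C))"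
proof -
  note s = SL2C_adj2[OF A] SU2_D[OF C] adj2_simps transpose_simps(8) cscale_simps
  have a: "adj2 (munit 1 2) = - munit 1 2" by (simp add: mat2)
  have m: "munit i j ** (munit k l ** B) = (if j = k then munit i l ** B else 0)" for i j k l B
    by (simp add: matrix_mul_assoc munit_mult matrix_ring_simps(8))
  show ?thesis
    unfolding dE'_def vecD_def fst_conv snd_conv Q' unfolding Q
    by (simp add: s matrix_ring_simps a m munit_mult mult.commute)
qed

text \<open>The bracket of the fields \<open>dE y (v i)\<close> lies in one complex direction
  transverse to the plane. Its coefficient is alternating and complex bilinear in the holomorphic
  coordinates \<open>y\<close> and \<open>cnj z\<close>: this is the (2,0) form \<Omega>.\<close>

lemma ext_d_vecD:
  assumes \<omega>: "\<omega> \<in> forms SLCP" and zero: "\<And>x v. x \<in> SLCP \<Longrightarrow> \<omega> x [dE x v] = 0"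
  shows "ext_d SLCP \<omega> (A, P) [vecD A C y1 z1, vecD A C y2 z2] =
    \<omega> (A, P) [(A ** (dagger C ** (cscale (y1 * cnj z2 - y2 * cnj z1) (munit 1 1 - munit 2 2) ** C)), 0)]"
proof -
  define v where "v = (\<lambda>i. if i then vecD A C y1 z1 else vecD A C y2 z2)"
  define b where "b = (A ** (dagger C ** (cscale (y1 * cnj z2 - y2 * cnj z1) (munit 1 1 - munit 2 2) ** C)), 0 :: cmat)"
  have T: "trace (adj2 A ** (A ** (dagger C ** (cscale c (munit 1 1 - munit 2 2) ** C)))) = 0" for c
    by (subst SL2C_adj2(4)[OF A], subst trace_mul_sym)
       (simp add: matrix_ring_simps SU2_D[OF C] cscale_simps, simp add: mat2)
  have bT: "b \<in> tangent SLCP (A, P)"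
    unfolding tangent_SLCP[OF point] b_def using T
    by (simp add: matrix_ring_simps(7,8) linear_0[OF linear_cmat(1)])
  have dT: "dE x w \<in> tangent SLCP x" if x: "x \<in> SLCP" for x w
  proof -
    obtain B R where xBR: "x = (B, R)" by (cases x)
    then have BR: "B \<in> SL2C" "R \<in> CP1" using x by auto
    obtain p q D where "D \<in> SU2" "transpose R = dagger D ** munit 2 2 ** D"
      using CP1_E[OF BR(2)] by metis
    then interpret D: adapted_frame B R D
      by unfold_locales (use BR in \<open>simp_all add: matrix_mul_assoc\<close>)
    show ?thesis unfolding xBR using D.ex_vecD[of w] D.vecD_tangent by auto
  qed
  have D: "dE' (A, P) (vecD A C y2 z2) (vecD A C y1 z1) - dE' (A, P) (vecD A C y1 z1) (vecD A C y2 z2) = b"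
  proof (rule prod_eqI)
    show "fst (dE' (A, P) (vecD A C y2 z2) (vecD A C y1 z1) - dE' (A, P) (vecD A C y1 z1) (vecD A C y2 z2)) = fst b"
      unfolding fst_diff dE'_vecD b_def by (simp add: mat2 algebra_simps)
    show "snd (dE' (A, P) (vecD A C y2 z2) (vecD A C y1 z1) - dE' (A, P) (vecD A C y1 z1) (vecD A C y2 z2)) = snd b"
      using tproj'_symmetric[OF P, of "snd (vecD A C y2 z2)" "snd (vecD A C y1 z1)"]
        vecD_tangent[of y1 z1] vecD_tangent[of y2 z2]
      unfolding tangent_SLCP[OF point] by (simp add: dE'_def b_def)
  qed
  have "ext_d SLCP \<omega> (A, P) [v True, v False] =
      \<omega> (A, P) [dE' (A, P) (v False) (v True) - dE' (A, P) (v True) (v False)]"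
  proof (rule SLCP.ext_d_bracket[OF \<omega> point, where Y = "\<lambda>i y. dE y (v i)" and Y' = "\<lambda>i h. dE' (A, P) h (v i)"])
    show "dE' (A, P) (v False) (v True) - dE' (A, P) (v True) (v False) \<in> tangent SLCP (A, P)"
      using D bT by (simp add: v_def)
  qed (auto simp: zero dT dE_derivative v_def dE_vecD)
  then show ?thesis using D by (simp add: v_def b_def)
qed

end

lemma adapted_frameE:
  assumes "x \<in> SLCP"
  obtains A P p q C where "x = (A, P)" "adapted_frame A P C" "P = hpoint (vector [p, q])"
    "p * cnj p + q * cnj q = 1" "C = vector [vector [cnj q, - cnj p], vector [p, q]]"
proof -
  obtain A P where x: "x = (A, P)" by (cases x)
  then have AP: "A \<in> SL2C" "P \<in> CP1" using assms by auto
  obtain p q C where C: "P = hpoint (vector [p, q])" "p * cnj p + q * cnj q = 1"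
    "C = vector [vector [cnj q, - cnj p], vector [p, q]]" "C \<in> SU2" "transpose P = dagger C ** munit 2 2 ** C"
    by (rule CP1_E[OF AP(2)])
  show thesis
    by (rule that[OF x _ C(1-3)], unfold_locales) (use AP C in \<open>simp_all add: matrix_mul_assoc\<close>)
qed

lemma dE_tangent: "x \<in> SLCP \<Longrightarrow> dE x v \<in> tangent SLCP x"
  by (metis adapted_frame.ex_vecD adapted_frame.vecD_tangent adapted_frameE)

lemma dE_JE: "x \<in> SLCP \<Longrightarrow> dE x (JE x (dE x v)) = JE x (dE x v)"
  by (metis adapted_frame.ex_vecD adapted_frame.JE_vecD adapted_frame.dE_vecD adapted_frameE)

text \<open>By \<open>ext_d_vecD\<close> the derivative sees its two arguments only through a
  complex bilinear coefficient, so a factor \<i> can move from one argument to the other.\<close>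

lemma pointwise_cond_ext_d:
  assumes \<omega>: "\<omega> \<in> forms SLCP" and cond: "pointwise_cond SLCP dE JE (\<omega> :: (cmat \<times> cmat, real) form)"
  shows "pointwise_cond SLCP dE JE (ext_d SLCP \<omega>)"
  unfolding pointwise_cond_def
proof (intro ballI conjI allI)
  fix x v w assume x: "x \<in> SLCP"
  show "ext_d SLCP \<omega> x [] = 0" using x by (simp add: ext_d_def)
  show "ext_d SLCP \<omega> x [dE x v] = 0"
    by (rule SLCP.ext_d_degree0[OF \<omega> _ x dE_tangent[OF x]]) (use cond in \<open>unfold pointwise_cond_def, blast\<close>)
  obtain A P p q C where xAP: "x = (A, P)" and f: "adapted_frame A P C"
    by (rule adapted_frameE[OF x])
  interpret adapted_frame A P C by (rule f)
  obtain y1 z1 y2 z2 where v: "dE x v = vecD A C y1 z1" and w: "dE x w = vecD A C y2 z2"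
    using ex_vecD xAP by metis
  have zero: "\<omega> x [dE x v] = 0" if "x \<in> SLCP" for x v
    using cond that unfolding pointwise_cond_def by blast
  show "ext_d SLCP \<omega> x [JE x (dE x v), dE x w] = ext_d SLCP \<omega> x [dE x v, JE x (dE x w)]"
    unfolding v w unfolding xAP JE_vecD
    by (subst (1 2) ext_d_vecD[OF \<omega> zero]) (simp_all add: algebra_simps)
qed

lemma is_EDS_pointwise_cond:
  "is_EDS SLCP {\<omega> \<in> forms SLCP. pointwise_cond SLCP dE JE (\<omega> :: (cmat \<times> cmat, real) form)}"
  unfolding is_EDS_def
  using SLCP.graded_ideal_pointwise_cond[where d = dE and J = JE] dE_JE
    SLCP.forms_ext_d pointwise_cond_ext_d by blast

lemma vecD_linear:
  "vecD A C y z + vecD A C y' z' = vecD A C (y + y') (z + z')"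
  "r *\<^sub>R vecD A C y z = vecD A C (r *\<^sub>R y) (r *\<^sub>R z)"
  "- vecD A C y z = vecD A C (- y) (- z)"
proof -
  have "cscale (r *\<^sub>R c) B = r *\<^sub>R cscale c B" "cscale (c + e) B = cscale c B + cscale e B"
    "cscale (- c) B = - cscale c B" for c e B
    by (simp_all add: mat2 algebra_simps)
  then show "vecD A C y z + vecD A C y' z' = vecD A C (y + y') (z + z')"
    "r *\<^sub>R vecD A C y z = vecD A C (r *\<^sub>R y) (r *\<^sub>R z)" "- vecD A C y z = vecD A C (- y) (- z)"
    by (simp_all add: vecD_def matrix_ring_simps transpose_simps algebra_simps)
qed

text \<open>In the adapted frame X is \<open>y\<close> times the column (q, -p) times the row (p,
  q), so the row vector (p, q) annihilates it from the left; on its entries all three generators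
  vanish.\<close>

lemma H_bundle_dE:
  assumes x: "x \<in> SLCP" and \<phi>: "\<phi> \<in> H_bundle x"
  shows "\<phi> (dE x v) = 0"
proof -
  obtain A P p q C where xAP: "x = (A, P)" and f: "adapted_frame A P C" and Peq: "P = hpoint (vector [p, q])"
    and n: "p * cnj p + q * cnj q = 1" and Ceq: "C = vector [vector [cnj q, - cnj p], vector [p, q]]"
    by (rule adapted_frameE[OF x])
  interpret adapted_frame A P C by (rule f)
  have nz: "vector [p, q] \<noteq> (0 :: complex^2)"
    using n by (auto simp: vec_eq_iff forall_2 vector_2)
  obtain y z where v: "dE x v = vecD A C y z" using ex_vecD xAP by metis
  have "matrix_inv A ** fst (vecD A C y z) = cscale y (dagger C ** (munit 1 2 ** C))"
    by (simp add: vecD_def SL2C_adj2[OF A] cscale_simps)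
  then have \<alpha>: "\<alpha>1 A (fst (vecD A C y z)) = y * (q * p)" "\<alpha>2 A (fst (vecD A C y z)) = y * (q * q)"
    "\<alpha>3 A (fst (vecD A C y z)) = - y * (p * p)"
    by (simp_all add: \<alpha>1_def \<alpha>2_def \<alpha>3_def maurer_cartan_def mat2_mult Ceq vector_2)
  obtain c1 c2 c3 where \<phi>': "\<phi> = (\<lambda>(V, W). c1 * (p * q * \<alpha>2 A V - q\<^sup>2 * \<alpha>1 A V) +
      c2 * (p * q * \<alpha>3 A V + p\<^sup>2 * \<alpha>1 A V) + c3 * (q\<^sup>2 * \<alpha>3 A V + p\<^sup>2 * \<alpha>2 A V))"
    using \<phi> unfolding xAP Peq H_bundle_hpoint[OF nz] by blast
  show ?thesis
    unfolding v \<phi>' case_prod_beta \<alpha> by (simp add: power2_eq_square algebra_simps)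
qed

lemma bundle_sections_pointwise_cond:
  assumes "\<omega> \<in> bundle_sections SLCP (real_bundle H_bundle)"
  shows "\<omega> \<in> forms SLCP" "pointwise_cond SLCP dE JE \<omega>"
proof -
  show "\<omega> \<in> forms SLCP" using assms unfolding bundle_sections_def by blast
  have hom: "\<omega> x vs = 0" if "length vs \<noteq> 1" for x vs
    using assms that unfolding bundle_sections_def by (metis (mono_tags, lifting) homogeneous_part_def mem_Collect_eq)
  show "pointwise_cond SLCP dE JE \<omega>"
    unfolding pointwise_cond_def
  proof (intro ballI conjI allI)
    fix x v w assume x: "x \<in> SLCP"
    show "\<omega> x [] = 0" "\<omega> x [JE x (dE x v), dE x w] = \<omega> x [dE x v, JE x (dE x w)]"
      by (simp_all add: hom)
    obtain \<phi> where \<phi>: "\<phi> \<in> real_bundle H_bundle x" "\<forall>v\<in>tangent SLCP x. \<omega> x [v] = \<phi> v"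
      using assms x unfolding bundle_sections_def by blast
    then obtain \<phi>1 \<phi>2 where *: "\<phi> = (\<lambda>v. Re (\<phi>1 v) + Im (\<phi>2 v))" "\<phi>1 \<in> H_bundle x" "\<phi>2 \<in> H_bundle x"
      unfolding real_bundle_def by blast
    then show "\<omega> x [dE x v] = 0"
      using \<phi>(2) dE_tangent[OF x, of v] H_bundle_dE[OF x *(2), of v]
        H_bundle_dE[OF x *(3), of v] *(1) by simp
  qed
qed

lemma real_functional_complex:
  assumes "linear (L :: complex \<Rightarrow> real)"
  shows "L z = Re ((L 1 - \<i> * L \<i>) * z)"
proof -
  have "L z = L (Re z *\<^sub>R 1 + Im z *\<^sub>R \<i>)" by (rule arg_cong[of _ _ L]) (simp add: complex_eq_iff)
  also have "\<dots> = Re z * L 1 + Im z * L \<i>" by (simp only: linear_add[OF assms] linear_scale[OF assms]) simp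
  finally show ?thesis by simp
qed

text \<open>The three generators span the two covectors \<open>w ** X\<close> in the row vector \<open>w = (p, q)\<close>.\<close>
lemma H_span:
  assumes "p \<noteq> 0 \<or> q \<noteq> (0::complex)"
  obtains c1 c2 c3 where "\<And>x1 x2 x3. k1 * (p * x1 + q * x3) + k2 * (p * x2 - q * x1) =
    c1 * (p * q * x2 - q\<^sup>2 * x1) + c2 * (p * q * x3 + p\<^sup>2 * x1) + c3 * (q\<^sup>2 * x3 + p\<^sup>2 * x2)"
proof (cases "q = 0")
  case True
  then have "p \<noteq> 0" using assms by simp
  then show thesis
    by (intro that[of 0 "k1 / p" "k2 / p"]) (simp add: True power2_eq_square field_simps)
next
  case False
  then show thesis
    by (intro that[of "k2 / q - k1 * p / q\<^sup>2" 0 "k1 / q"]) (simp add: power2_eq_square field_simps)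
qed

text \<open>The condition is fibrewise, so coefficients may be found at each point separately.
  Modulo the plane only the entries Z11 and Z21 of \<open>C ** X ** dagger C\<close> remain, and
  both are combinations of the entries of the row vector (p, q) X.\<close>

lemma annihilator_section:
  assumes \<omega>: "\<omega> \<in> forms SLCP" and hom: "homogeneous_part 1 \<omega> = \<omega>"
    and zero: "\<And>x v. x \<in> SLCP \<Longrightarrow> \<omega> x [dE x v] = 0"
  shows "\<omega> \<in> bundle_sections SLCP (real_bundle H_bundle)"
  unfolding bundle_sections_def mem_Collect_eq
proof (intro conjI \<omega> hom ballI)
  fix x assume x: "x \<in> SLCP"
  obtain A P p q C where xAP: "x = (A, P)" and f: "adapted_frame A P C" and Peq: "P = hpoint (vector [p, q])"
    and n: "p * cnj p + q * cnj q = 1" and Ceq: "C = vector [vector [cnj q, - cnj p], vector [p, q]]"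
    by (rule adapted_frameE[OF x])
  interpret adapted_frame A P C by (rule f)
  have pq: "p \<noteq> 0 \<or> q \<noteq> 0" using n by auto
  then have nz: "vector [p, q] \<noteq> (0 :: complex^2)" by (auto simp: vec_eq_iff forall_2 vector_2)
  obtain \<phi> where \<phi>: "alt \<phi>" "\<forall>vs. set vs \<subseteq> tangent SLCP x \<longrightarrow> \<omega> x vs = \<phi> vs"
    by (rule forms_point[OF \<omega> x])
  have lin: "linear (\<lambda>v. \<phi> [v])" using alt_slot_linear[OF \<phi>(1), of "[]" "[]"] by simp
  define vec where "vec = (\<lambda>z M. (A ** (dagger C ** (cscale z M ** C)), 0 :: cmat))"
  have linv: "linear (\<lambda>z. \<phi> [vec z M])" for M
  proof -
    have "linear (\<lambda>z. vec z M)"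
    proof (rule linear_slotI)
      have "cscale (c *\<^sub>R u + d *\<^sub>R w) M = c *\<^sub>R cscale u M + d *\<^sub>R cscale w M" for c d u w
        by (simp add: mat2 algebra_simps)
      then show "vec (c *\<^sub>R u + d *\<^sub>R w) M = c *\<^sub>R vec u M + d *\<^sub>R vec w M" for c d u w
        by (simp add: vec_def matrix_ring_simps)
    qed
    from linear_compose[OF this lin] show ?thesis by (simp add: o_def)
  qed
  obtain k1 k2 where k: "\<And>z. \<phi> [vec z (munit 1 1 - munit 2 2)] = Re (k1 * z)" "\<And>z. \<phi> [vec z (munit 2 1)] = Re (k2 * z)"
    using real_functional_complex[OF linv] by metis
  have val: "\<omega> x [(V, W)] = Re (k1 * Z $ 1 $ 1 + k2 * Z $ 2 $ 1)"
    if v: "(V, W) \<in> tangent SLCP x" and Z: "Z = C ** adj2 A ** V ** dagger C" for V W Z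
  proof -
    have W: "dagger W = W" "W = W ** P + P ** W" and tr: "trace (adj2 A ** V) = 0"
      using v unfolding tangent_SLCP[OF x] by (auto simp: xAP)
    have "trace Z = trace (adj2 A ** V ** (dagger C ** C))"
      using trace_mul_sym[of C "adj2 A ** V ** dagger C"] unfolding Z by (simp only: matrix_mul_assoc)
    then have Z22: "Z $ 2 $ 2 = - Z $ 1 $ 1"
      using tr unfolding SU2_D(2)[OF C] by (simp add: trace2 matrix_ring_simps eq_neg_iff_add_eq_0 add.commute)
    have V: "V = A ** (dagger C ** (Z ** C))"
      unfolding Z by (simp add: matrix_ring_simps SU2_D[OF C] SL2C_adj2[OF A])
    have "Z = cscale (Z $ 1 $ 2) (munit 1 2) + (cscale (Z $ 1 $ 1) (munit 1 1 - munit 2 2) + cscale (Z $ 2 $ 1) (munit 2 1))"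
      by (simp add: mat2 Z22)
    then have "V = A ** (dagger C ** (cscale (Z $ 1 $ 2) (munit 1 2) ** C)) +
        (fst (vec (Z $ 1 $ 1) (munit 1 1 - munit 2 2)) + fst (vec (Z $ 2 $ 1) (munit 2 1)))"
      unfolding vec_def fst_conv by (subst V) (metis matrix_ring_simps(1,2))
    moreover have "fst (dE x (V, W)) = A ** (dagger C ** (cscale (Z $ 1 $ 2) (munit 1 2) ** C))"
      unfolding xAP dE_eq_vecD Z by (simp add: vecD_def)
    moreover have "snd (dE x (V, W)) = W"
      using tangent_CP1_D(2)[OF P W] by (simp add: dE_def xAP)
    ultimately have "(V, W) = dE x (V, W) + (vec (Z $ 1 $ 1) (munit 1 1 - munit 2 2) + vec (Z $ 2 $ 1) (munit 2 1))"
      by (intro prod_eqI) (simp_all add: vec_def)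
    then have "\<phi> [(V, W)] = \<phi> [dE x (V, W)] + (\<phi> [vec (Z $ 1 $ 1) (munit 1 1 - munit 2 2)] + \<phi> [vec (Z $ 2 $ 1) (munit 2 1)])"
      using linear_add[OF lin] by metis
    moreover have "\<phi> [dE x (V, W)] = 0"
      using zero[OF x] \<phi>(2) dE_tangent[OF x] by simp
    ultimately show ?thesis using k \<phi>(2) v by simp
  qed
  \<comment> \<open>With (a, b) = (p, q) X one has Z21 = q a - p b and Z11 = - Z22 = - (cnj p a +
    cnj q b); the two factors collect the coefficients of a and b in k1 Z11 + k2 Z21.\<close>
  obtain c1 c2 c3 where c: "\<And>x1 x2 x3. (- k1 * cnj p + k2 * q) * (p * x1 + q * x3) + (- k1 * cnj q - k2 * p) * (p * x2 - q * x1) =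
      c1 * (p * q * x2 - q\<^sup>2 * x1) + c2 * (p * q * x3 + p\<^sup>2 * x1) + c3 * (q\<^sup>2 * x3 + p\<^sup>2 * x2)"
    using H_span[OF pq, of "- k1 * cnj p + k2 * q" "- k1 * cnj q - k2 * p"] by metis
  define \<psi> where "\<psi> = (\<lambda>(V, W :: cmat). c1 * (p * q * \<alpha>2 A V - q\<^sup>2 * \<alpha>1 A V) +
    c2 * (p * q * \<alpha>3 A V + p\<^sup>2 * \<alpha>1 A V) + c3 * (q\<^sup>2 * \<alpha>3 A V + p\<^sup>2 * \<alpha>2 A V))"
  have \<psi>: "\<psi> \<in> H_bundle x" "(\<lambda>v. 0) \<in> H_bundle x"
    unfolding xAP Peq H_bundle_hpoint[OF nz] \<psi>_def
    by (blast, auto intro!: exI[of _ 0])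
  have "\<omega> x [v] = Re (\<psi> v)" if v: "v \<in> tangent SLCP x" for v
  proof -
    obtain V W where VW: "v = (V, W)" by (cases v)
    let ?X = "adj2 A ** V"
    have tr: "?X $ 2 $ 2 = - ?X $ 1 $ 1"
      using v unfolding tangent_SLCP[OF x] by (simp add: xAP VW trace2 eq_neg_iff_add_eq_0 add.commute)
    let ?Z = "C ** ?X ** dagger C"
    have "\<omega> x [v] = Re (k1 * ?Z $ 1 $ 1 + k2 * ?Z $ 2 $ 1)"
      unfolding VW by (rule val) (use v VW in \<open>simp_all add: matrix_mul_assoc\<close>)
    also have "?Z $ 2 $ 1 = q * (p * ?X $ 1 $ 1 + q * ?X $ 2 $ 1) - p * (p * ?X $ 1 $ 2 - q * ?X $ 1 $ 1)"
      unfolding mat2_mult[of _ "dagger C"] mat2_mult[of C] using tr by (simp add: Ceq vector_2 algebra_simps)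
    also have "?Z $ 1 $ 1 = - ?Z $ 2 $ 2"
    proof -
      have "trace ?Z = trace (?X ** (dagger C ** C))"
        using trace_mul_sym[of C "?X ** dagger C"] by (simp only: matrix_mul_assoc)
      then show ?thesis unfolding SU2_D(2)[OF C] using tr
        by (simp add: trace2 matrix_ring_simps(9) eq_neg_iff_add_eq_0 add.commute)
    qed
    also have "?Z $ 2 $ 2 = cnj p * (p * ?X $ 1 $ 1 + q * ?X $ 2 $ 1) + cnj q * (p * ?X $ 1 $ 2 - q * ?X $ 1 $ 1)"
      unfolding mat2_mult[of _ "dagger C"] mat2_mult[of C] using tr by (simp add: Ceq vector_2 algebra_simps)
    also have "k1 * - (cnj p * (p * ?X $ 1 $ 1 + q * ?X $ 2 $ 1) + cnj q * (p * ?X $ 1 $ 2 - q * ?X $ 1 $ 1))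
        + k2 * (q * (p * ?X $ 1 $ 1 + q * ?X $ 2 $ 1) - p * (p * ?X $ 1 $ 2 - q * ?X $ 1 $ 1)) =
      (- k1 * cnj p + k2 * q) * (p * ?X $ 1 $ 1 + q * ?X $ 2 $ 1) + (- k1 * cnj q - k2 * p) * (p * ?X $ 1 $ 2 - q * ?X $ 1 $ 1)"
      by (simp add: algebra_simps)
    also have "\<dots> = \<psi> v"
      unfolding c VW \<psi>_def by (simp add: \<alpha>1_def \<alpha>2_def \<alpha>3_def maurer_cartan_def SL2C_adj2(3)[OF A])
    finally show ?thesis .
  qed
  moreover have "(\<lambda>v. Re (\<psi> v) + Im ((\<lambda>v. 0) v)) \<in> real_bundle H_bundle x"
    unfolding real_bundle_def using \<psi> by (intro CollectI exI[of _ \<psi>] exI[of _ "\<lambda>v. 0"]) simp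
  ultimately show "\<exists>\<phi>\<in>real_bundle H_bundle x. \<forall>v\<in>tangent SLCP x. \<omega> x [v] = \<phi> v"
    by (intro bexI) auto
qed

context adapted_frame
begin

text \<open>The (2,0) forms on a complex plane are one complex line, so \<phi> has two real
  coefficients. They are read off on two pairs of vectors on which the (2,0) form takes the values 1
  and \<i>.\<close>

lemma two_form_type:
  fixes \<phi> :: "(cmat \<times> cmat) list \<Rightarrow> real"
  assumes \<phi>: "alt \<phi>" and J: "\<And>y z y' z'. \<phi> [vecD A C (\<i> * y) (- \<i> * z), vecD A C y' z'] = \<phi> [vecD A C y z, vecD A C (\<i> * y') (- \<i> * z')]"
  shows "\<phi> [vecD A C y1 z1, vecD A C y2 z2] =
    \<phi> [vecD A C 0 1, vecD A C 1 0] * Re (cnj z1 * y2 - cnj z2 * y1) + \<phi> [vecD A C 0 1, vecD A C \<i> 0] * Im (cnj z1 * y2 - cnj z2 * y1)"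
proof -
  let ?v = "vecD A C"
  have lin: "linear (\<lambda>u. \<phi> [u, w])" "linear (\<lambda>u. \<phi> [w, u])" for w
    using alt_slot_linear[OF \<phi>, of "[]" "[w]"] alt_slot_linear[OF \<phi>, of "[w]" "[]"] by auto
  have swap: "\<phi> [u, w] = - \<phi> [w, u]" for u w using alt_swap[OF \<phi>, of "[]" u w "[]"] by simp
  have ex: "?v y z = Re y *\<^sub>R ?v 1 0 + Im y *\<^sub>R ?v \<i> 0 + Re z *\<^sub>R ?v 0 1 + Im z *\<^sub>R ?v 0 \<i>" for y z
    unfolding vecD_linear by (rule arg_cong2[of _ _ _ _ "vecD A C"]) (simp_all add: complex_eq_iff)
  have neg: "?v 0 (- \<i>) = - ?v 0 \<i>" "?v (- 1) 0 = - ?v 1 0" by (simp_all add: vecD_linear)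
  have nl: "\<phi> [- u, w] = - \<phi> [u, w]" "\<phi> [w, - u] = - \<phi> [w, u]" for u w
    using linear_neg[OF lin(1)] linear_neg[OF lin(2)] by auto
  have same: "\<phi> [u, u] = 0" for u using swap[of u u] by simp
  have 1: "\<phi> [?v 1 0, ?v \<i> 0] = 0" using J[of 1 0 1 0] swap[of "?v 1 0" "?v \<i> 0"] by simp
  have 2: "\<phi> [?v 0 1, ?v 0 \<i>] = 0"
    using J[of 0 1 0 1] swap[of "?v 0 1" "?v 0 \<i>"] by (simp add: neg nl)
  have 3: "\<phi> [?v 0 \<i>, ?v 1 0] = - \<phi> [?v 0 1, ?v \<i> 0]" using J[of 0 1 1 0] by (simp add: neg nl)
  have 4: "\<phi> [?v 0 \<i>, ?v \<i> 0] = \<phi> [?v 0 1, ?v 1 0]" using J[of 0 1 \<i> 0] by (simp add: neg nl)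
  note l = lin(1)[THEN linear_add] lin(2)[THEN linear_add] lin(1)[THEN linear_scale] lin(2)[THEN linear_scale]
  show ?thesis
    unfolding ex[of y1 z1] ex[of y2 z2] l same
      swap[of "?v 1 0" "?v 0 1"] swap[of "?v 1 0" "?v 0 \<i>"] swap[of "?v \<i> 0" "?v 0 1"]
      swap[of "?v \<i> 0" "?v 0 \<i>"] swap[of "?v \<i> 0" "?v 1 0"] swap[of "?v 0 \<i>" "?v 0 1"] 1 2 3 4
    by (simp add: algebra_simps)
qed

end

section \<open>Linearity, smoothness and complex structure of the projections\<close>

lemma tproj_linear: "tproj P (c *\<^sub>R u + d *\<^sub>R w) = c *\<^sub>R tproj P u + d *\<^sub>R tproj P w"
proof -
  have "(1/2) *\<^sub>R (c *\<^sub>R u + d *\<^sub>R w + dagger (c *\<^sub>R u + d *\<^sub>R w)) =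
      c *\<^sub>R ((1/2) *\<^sub>R (u + dagger u)) + d *\<^sub>R ((1/2) *\<^sub>R (w + dagger w))"
    by (simp add: transpose_simps scaleR_add_right)
  then show ?thesis
    unfolding tproj_def by (simp only: matrix_ring_simps(1,2,12,13) scaleR_add_right add_ac)
qed

lemma cscale_real_linear: "cscale z (c *\<^sub>R u + d *\<^sub>R w) = c *\<^sub>R cscale z u + d *\<^sub>R cscale z w"
  "cscale (c *\<^sub>R z + d *\<^sub>R y) u = c *\<^sub>R cscale z u + d *\<^sub>R cscale y u"
  by (simp_all add: mat2 algebra_simps)

lemma linear_E: "linear (pE x)" "linear (dE x)" "linear (JE x)"
proof -
  have t: "trace (c *\<^sub>R B + d *\<^sub>R B') = c *\<^sub>R trace B + d *\<^sub>R trace B'" for c d and B B' :: cmat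
    by (simp add: trace2 algebra_simps)
  have s: "cscale ((c *\<^sub>R z + d *\<^sub>R y) / 2) u = c *\<^sub>R cscale (z / 2) u + d *\<^sub>R cscale (y / 2) u" for c d z y u
    by (simp add: mat2) (simp add: scaleR_conv_of_real field_simps)
  show "linear (pE x)"
    by (rule linear_slotI) (simp add: pE_def tproj_linear matrix_ring_simps(1,12) t s, simp add: algebra_simps)
  show "linear (dE x)"
    by (rule linear_slotI) (simp add: dE_def tproj_linear matrix_ring_simps(1,2,12,13))
  show "linear (JE x)"
    by (rule linear_slotI)
      (simp add: JE_def cscale_real_linear matrix_ring_simps(1,2,12,13), simp add: mat2 algebra_simps)
qed

lemma smooth_E: "smooth_on UNIV (\<lambda>x. pE x v)" "smooth_on UNIV (\<lambda>x. dE x v)" "smooth_on UNIV (\<lambda>x. JE x (dE x v))"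
  unfolding pE_def dE_def JE_def tproj_def fst_conv snd_conv by (intro smooth_on_cmat open_UNIV)+

lemma JE_JE:
  assumes "x \<in> SLCP"
  shows "JE x (JE x (dE x v)) = - dE x v"
proof -
  obtain A P p q C where x: "x = (A, P)" and f: "adapted_frame A P C" by (rule adapted_frameE[OF assms])
  interpret adapted_frame A P C by (rule f)
  obtain y z where "dE x v = vecD A C y z" using ex_vecD x by metis
  then show ?thesis unfolding x by (simp only: JE_vecD vecD_linear) simp
qed

lemma plane_E:
  assumes "x \<in> SLCP"
  shows "\<exists>a b. dE x a = a \<and> dE x b = b \<and>
    (\<forall>v. \<exists>r s t q. dE x v = r *\<^sub>R a + s *\<^sub>R JE x a + t *\<^sub>R b + q *\<^sub>R JE x b)"
proof -
  obtain A P p q C where x: "x = (A, P)" and f: "adapted_frame A P C" by (rule adapted_frameE[OF assms])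
  interpret adapted_frame A P C by (rule f)
  have "vecD A C y z = Re y *\<^sub>R vecD A C 1 0 + Im y *\<^sub>R vecD A C (\<i> * 1) (- \<i> * 0)
      + Re z *\<^sub>R vecD A C 0 1 + (- Im z) *\<^sub>R vecD A C (\<i> * 0) (- \<i> * 1)" for y z
    unfolding vecD_linear by (rule arg_cong2[of _ _ _ _ "vecD A C"]) (simp_all add: complex_eq_iff)
  then have "\<forall>v. \<exists>r s t q. dE x v = r *\<^sub>R vecD A C 1 0 + s *\<^sub>R JE x (vecD A C 1 0) + t *\<^sub>R vecD A C 0 1
      + q *\<^sub>R JE x (vecD A C 0 1)"
    unfolding x JE_vecD using ex_vecD by metis
  then show ?thesis
    by (intro exI[of _ "vecD A C 1 0"] exI[of _ "vecD A C 0 1"]) (simp add: x dE_vecD)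
qed

text \<open>A 2-form of type (2,0) + (0,2) on the distribution is \<open>Re (f * \<Omega>)\<close> for the 2-form \<open>\<Omega>\<close> induced
  by the differential of \<open>trace (Q ** X)\<close>. The vector fields below recover \<open>f\<close> globally.\<close>
definition nilX :: "2 \<Rightarrow> 2 \<Rightarrow> cmat \<Rightarrow> cmat" where
  "nilX k l P = (mat 1 - transpose P) ** munit k l ** transpose P"

definition fieldA :: "complex \<Rightarrow> 2 \<Rightarrow> 2 \<Rightarrow> cmat \<times> cmat \<Rightarrow> cmat \<times> cmat" where
  "fieldA c k l x = (fst x ** cscale c (nilX k l (snd x)), 0)"

definition fieldP :: "2 \<Rightarrow> 2 \<Rightarrow> cmat \<times> cmat \<Rightarrow> cmat \<times> cmat" where
  "fieldP k l x = (0, transpose (nilX k l (snd x) + dagger (nilX k l (snd x))))"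

lemma smooth_fields: "smooth_on UNIV (fieldA c k l)" "smooth_on UNIV (fieldP k l)"
  unfolding fieldA_def[abs_def] fieldP_def[abs_def] nilX_def by (intro smooth_on_cmat open_UNIV)+

definition traceQ :: "cmat \<times> cmat \<Rightarrow> cmat \<times> cmat \<Rightarrow> complex" where
  "traceQ x v = trace (transpose (snd x) ** adj2 (fst x) ** fst v)"

context adapted_frame
begin

lemma nilX_eq: "nilX k l P = dagger C ** (cscale ((C ** munit k l ** dagger C) $ 1 $ 2) (munit 1 2) ** C)"
proof -
  have unit: "munit 1 1 ** (Y ** munit 2 2) = cscale (Y $ 1 $ 2) (munit 1 2)" for Y
    by (simp add: mat2)
  show ?thesis
    unfolding nilX_def Q' unfolding Q unit[symmetric] by (simp add: matrix_mul_assoc)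
qed

lemma fields_vecD:
  "fieldA c k l (A, P) = vecD A C (c * (C ** munit k l ** dagger C) $ 1 $ 2) 0"
  "fieldP k l (A, P) = vecD A C 0 ((C ** munit k l ** dagger C) $ 1 $ 2)"
proof -
  show "fieldA c k l (A, P) = vecD A C (c * (C ** munit k l ** dagger C) $ 1 $ 2) 0"
    by (simp add: fieldA_def vecD_def nilX_eq cscale_simps matrix_ring_simps transpose_simps)
  have "dagger (dagger C ** (cscale t (munit 1 2) ** C)) = dagger C ** (cscale (cnj t) (munit 2 1) ** C)" for t
    by (simp add: transpose_simps cscale_simps munit_dagger matrix_ring_simps)
  then show "fieldP k l (A, P) = vecD A C 0 ((C ** munit k l ** dagger C) $ 1 $ 2)"
    by (simp add: fieldP_def vecD_def nilX_eq cscale_simps matrix_ring_simps)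
qed

text \<open>The entries are products of an entry of the first row of \<open>C\<close> with a
  conjugate entry of the second, and their squared moduli sum to the product of the squared row
  norms. No single field on CP1 is nowhere zero, so all four are used together with these
  weights.\<close>

lemma sum_units: "(\<Sum>k\<in>UNIV. \<Sum>l\<in>UNIV. (cmod ((C ** munit k l ** dagger C) $ 1 $ 2))\<^sup>2) = 1"
proof -
  have t: "(C ** munit k l ** dagger C) $ 1 $ 2 = C $ 1 $ k * cnj (C $ 2 $ l)" for k l
    using exhaust_2[of k] exhaust_2[of l] by (elim disjE) (simp_all add: mat2_mult)
  have "(C ** dagger C) $ i $ i = 1" for i unfolding SU2_D(1)[OF C] by simp
  then have "C $ i $ 1 * cnj (C $ i $ 1) + C $ i $ 2 * cnj (C $ i $ 2) = 1" for i
    by (simp add: mat2_mult)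
  then have "complex_of_real ((cmod (C $ i $ 1))\<^sup>2 + (cmod (C $ i $ 2))\<^sup>2) = 1" for i
    by (simp only: of_real_add complex_norm_square)
  then have row: "(cmod (C $ i $ 1))\<^sup>2 + (cmod (C $ i $ 2))\<^sup>2 = 1" for i
    by (metis of_real_eq_1_iff)
  have "(\<Sum>k\<in>UNIV. \<Sum>l\<in>UNIV. (cmod ((C ** munit k l ** dagger C) $ 1 $ 2))\<^sup>2) =
      ((cmod (C $ 1 $ 1))\<^sup>2 + (cmod (C $ 1 $ 2))\<^sup>2) * ((cmod (C $ 2 $ 1))\<^sup>2 + (cmod (C $ 2 $ 2))\<^sup>2)"
    by (simp add: t sum_2 norm_mult power_mult_distrib algebra_simps)
  then show ?thesis by (simp add: row)
qed

lemma traceQ_vecD: "traceQ (A, P) (vecD A C y z) = 0"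
proof -
  have "transpose P ** adj2 A ** fst (vecD A C y z) = 0"
    unfolding vecD_def fst_conv Q
    by (simp add: matrix_ring_simps SL2C_adj2[OF A] SU2_D[OF C] cscale_simps)
       (simp add: matrix_mul_assoc munit_mult matrix_ring_simps(7,8) cscale_simps)
  then show ?thesis unfolding traceQ_def fst_conv snd_conv by (simp add: trace2)
qed

lemma traceQ_bracket:
  "traceQ (A, P) (A ** (dagger C ** (cscale c (munit 1 1 - munit 2 2) ** C)), W) = - c"
proof -
  have "transpose P ** adj2 A ** (A ** (dagger C ** (cscale c (munit 1 1 - munit 2 2) ** C)))
      = dagger C ** ((munit 2 2 ** cscale c (munit 1 1 - munit 2 2)) ** C)"
    unfolding Q by (simp add: matrix_ring_simps(11) SL2C_adj2[OF A] SU2_D[OF C])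
  moreover have t: "trace (dagger C ** (M ** C)) = trace M" for M
    using trace_mul_sym[of "dagger C" "M ** C"] by (simp add: matrix_ring_simps SU2_D[OF C])
  ultimately have "traceQ (A, P) (A ** (dagger C ** (cscale c (munit 1 1 - munit 2 2) ** C)), W) =
      trace (munit 2 2 ** cscale c (munit 1 1 - munit 2 2))"
    unfolding traceQ_def fst_conv snd_conv by (simp only: t)
  then show ?thesis by (simp add: mat2)
qed

end

lemma traceQ_dE: "x \<in> SLCP \<Longrightarrow> traceQ x (dE x v) = 0"
  by (metis adapted_frame.ex_vecD adapted_frame.traceQ_vecD adapted_frameE)

lemma linear_traceQ: "linear (traceQ x)"
  by (rule linear_slotI) (simp add: traceQ_def matrix_ring_simps(1,12) trace2 algebra_simps)

lemma smooth_traceQ: "smooth_on UNIV (\<lambda>x. traceQ x v)"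
  unfolding traceQ_def by (intro smooth_on_cmat open_UNIV)

lemma fields_tangent:
  assumes "x \<in> SLCP"
  shows "fieldA c k l x \<in> tangent SLCP x" "fieldP k l x \<in> tangent SLCP x"
proof -
  obtain A P p q C where x: "x = (A, P)" and f: "adapted_frame A P C" by (rule adapted_frameE[OF assms])
  interpret adapted_frame A P C by (rule f)
  show "fieldA c k l x \<in> tangent SLCP x" "fieldP k l x \<in> tangent SLCP x"
    unfolding x fields_vecD by (rule vecD_tangent)+
qed

section \<open>Membership in every exterior differential system that contains the sections\<close>

context
  fixes I :: "(cmat \<times> cmat, real) form set"
  assumes EDS: "is_EDS SLCP I" and sections: "bundle_sections SLCP (real_bundle H_bundle) \<subseteq> I"
begin

lemma annihilator_in_EDS:
  "\<omega> \<in> forms SLCP \<Longrightarrow> homogeneous_part 1 \<omega> = \<omega> \<Longrightarrow> (\<And>x v. x \<in> SLCP \<Longrightarrow> \<omega> x [dE x v] = 0) \<Longrightarrow> \<omega> \<in> I"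
  using annihilator_section sections by blast

lemma traceQ_in_EDS:
  assumes "linear h" "\<And>f :: cmat \<times> cmat \<Rightarrow> complex. smooth_on UNIV f \<Longrightarrow> smooth_on UNIV (\<lambda>x. h (f x) :: real)"
  shows "one_form SLCP (\<lambda>x v. h (traceQ x v)) \<in> I"
proof (rule annihilator_in_EDS)
  show "one_form SLCP (\<lambda>x v. h (traceQ x v)) \<in> forms SLCP"
    by (rule SLCP.forms_one_form[of UNIV])
       (use assms linear_compose[OF linear_traceQ assms(1)] smooth_traceQ in \<open>auto simp: o_def\<close>)
  show "homogeneous_part 1 (one_form SLCP (\<lambda>x v. h (traceQ x v))) = one_form SLCP (\<lambda>x v. h (traceQ x v))"
    by (intro ext) (simp add: homogeneous_part_def one_form_def)
  show "one_form SLCP (\<lambda>x v. h (traceQ x v)) x [dE x v] = 0" if "x \<in> SLCP" for x v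
    using that linear_0[OF assms(1)] by (simp add: one_form_def traceQ_dE)
qed

text \<open>Let g1, g2 be the coefficients of \<omega> from \<open>two_form_type\<close>. The form
  \<xi> = g1 Re (traceQ) + g2 Im (traceQ) lies in \<open>I\<close>, hence so does its derivative. As
  \<open>traceQ\<close> vanishes on the planes, derivatives of g1 and g2 do not contribute there,
  and d\<xi> restricts to \<omega>. Contractions with the global fields exhibit g1 and g2 as smooth
  functions.\<close>

lemma two_form_representative:
  assumes \<omega>: "\<omega> \<in> forms SLCP" and hom: "homogeneous_part 2 \<omega> = \<omega>"
    and J: "\<And>x v w. x \<in> SLCP \<Longrightarrow> \<omega> x [JE x (dE x v), dE x w] = \<omega> x [dE x v, JE x (dE x w)]"
  shows "\<exists>\<tau>\<in>I. \<forall>x\<in>SLCP. \<forall>v w. \<tau> x [dE x v, dE x w] = \<omega> x [dE x v, dE x w]"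
proof -
  have ideal: "graded_ideal SLCP I" and d: "\<And>\<eta>. \<eta> \<in> I \<Longrightarrow> ext_d SLCP \<eta> \<in> I"
    using EDS unfolding is_EDS_def by auto
  let ?R = "one_form SLCP (\<lambda>x v. Re (traceQ x v))" and ?M = "one_form SLCP (\<lambda>x v. Im (traceQ x v))"
  let ?con = "\<lambda>c k l. SLCP.contraction [fieldP k l, fieldA c k l] (\<lambda>x v. v) \<omega>"
  define \<xi> where "\<xi> = form_plus (\<lambda>x vs. \<Sum>k\<in>UNIV. \<Sum>l\<in>UNIV. wedge (?con 1 k l) ?R x vs)
    (\<lambda>x vs. \<Sum>k\<in>UNIV. \<Sum>l\<in>UNIV. wedge (?con \<i> k l) ?M x vs)"
  have con: "?con c k l \<in> forms SLCP" for c k l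
    by (rule SLCP.forms_contraction[OF \<omega>])
       (auto simp: smooth_fields fields_tangent intro: linear_id[unfolded id_def])
  have RM: "?R \<in> I" "?M \<in> I"
    by (rule traceQ_in_EDS; auto intro: smooth_on_cmat bounded_linear.linear bounded_linear_Re bounded_linear_Im)+
  have wI: "wedge \<eta> \<zeta> \<in> I" if "\<eta> \<in> forms SLCP" "\<zeta> \<in> I" for \<eta> \<zeta>
    using ideal that unfolding graded_ideal_def by blast
  have plus: "form_plus \<eta> \<zeta> \<in> I" if "\<eta> \<in> I" "\<zeta> \<in> I" for \<eta> \<zeta>
    using ideal that unfolding graded_ideal_def by blast
  have \<xi>I: "\<xi> \<in> I"
    unfolding \<xi>_def by (intro plus SLCP.graded_ideal_sum[OF ideal] wI con RM)
  then have \<xi>: "\<xi> \<in> forms SLCP" using ideal unfolding graded_ideal_def by blast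
  have eval_at: "\<xi> x [u] = (\<Sum>k\<in>UNIV. \<Sum>l\<in>UNIV. \<omega> x [fieldP k l x, fieldA 1 k l x]) * Re (traceQ x u)
      + (\<Sum>k\<in>UNIV. \<Sum>l\<in>UNIV. \<omega> x [fieldP k l x, fieldA \<i> k l x]) * Im (traceQ x u)"
    if x: "x \<in> SLCP" and u: "u \<in> tangent SLCP x" for x u
  proof -
    have "?con c k l y us = 0" if "us \<noteq> []" for c k l y us
    proof -
      have "\<omega> y (a # b # us) = 0" for a b
        using that fun_cong[OF fun_cong[OF hom], of y "a # b # us"] by (simp add: homogeneous_part_def)
      then show ?thesis by (simp add: SLCP.contraction_def)
    qed
    then have "wedge (?con c k l) \<zeta> x [u] = ?con c k l x [] * \<zeta> x [u]" for c k l and \<zeta> :: "(cmat \<times> cmat, real) form"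
      by (rule wedge_degree0)
    moreover have "?con c k l x [] = \<omega> x [fieldP k l x, fieldA c k l x]" for c k l
      using x by (simp add: SLCP.contraction_def)
    ultimately have "wedge (?con c k l) \<zeta> x [u] = \<omega> x [fieldP k l x, fieldA c k l x] * \<zeta> x [u]" for c k l and \<zeta> :: "(cmat \<times> cmat, real) form"
      by simp
    then show ?thesis
      using x u by (simp add: \<xi>_def form_plus_def one_form_def sum_distrib_right)
  qed
  have zero: "\<xi> x [dE x v] = 0" if "x \<in> SLCP" for x v
    using eval_at[OF that dE_tangent[OF that]] by (simp add: traceQ_dE[OF that])
  have "ext_d SLCP \<xi> x [dE x v, dE x w] = \<omega> x [dE x v, dE x w]" if x: "x \<in> SLCP" for x v w
  proof -
    obtain A P p q C where xAP: "x = (A, P)" and f: "adapted_frame A P C" by (rule adapted_frameE[OF x])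
    interpret adapted_frame A P C by (rule f)
    obtain y1 z1 y2 z2 where v: "dE x v = vecD A C y1 z1" and w: "dE x w = vecD A C y2 z2"
      using ex_vecD xAP by metis
    obtain \<phi> where \<phi>: "alt \<phi>" "\<forall>vs. set vs \<subseteq> tangent SLCP x \<longrightarrow> \<omega> x vs = \<phi> vs"
      by (rule forms_point[OF \<omega> x])
    have \<omega>\<phi>: "\<omega> x [vecD A C y z, vecD A C y' z'] = \<phi> [vecD A C y z, vecD A C y' z']" for y z y' z'
      using \<phi>(2) vecD_tangent by (simp add: xAP)
    have J\<phi>: "\<phi> [vecD A C (\<i> * y) (- \<i> * z), vecD A C y' z'] = \<phi> [vecD A C y z, vecD A C (\<i> * y') (- \<i> * z')]" for y z y' z'
      using J[OF x, of "vecD A C y z" "vecD A C y' z'"] unfolding xAP dE_vecD JE_vecD unfolding xAP[symmetric] \<omega>\<phi> .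
    let ?g1 = "\<phi> [vecD A C 0 1, vecD A C 1 0]" and ?g2 = "\<phi> [vecD A C 0 1, vecD A C \<i> 0]"
    let ?t = "\<lambda>k l. (C ** munit k l ** dagger C) $ 1 $ 2"
    \<comment> \<open>Both fields carry the same entry \<open>?t k l\<close>, one as
      \<open>y\<close> and one as \<open>z\<close>, so the phase of the frame cancels in
      \<open>cnj z * y\<close> and only the weight remains.\<close>
    have tt: "cnj (?t k l) * ?t k l = complex_of_real ((cmod (?t k l))\<^sup>2)" for k l
      by (simp only: complex_norm_square mult.commute)
    have "\<omega> x [fieldP k l x, fieldA c k l x] = ?g1 * Re (cnj (?t k l) * (c * ?t k l)) + ?g2 * Im (cnj (?t k l) * (c * ?t k l))" for c k l
      unfolding xAP fields_vecD unfolding xAP[symmetric] \<omega>\<phi>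
      using two_form_type[OF \<phi>(1) J\<phi>, of 0 "?t k l" "c * ?t k l" 0] by simp
    moreover have "cnj (?t k l) * (c * ?t k l) = c * complex_of_real ((cmod (?t k l))\<^sup>2)" for c k l
      unfolding tt[symmetric] by simp
    ultimately have "\<omega> x [fieldP k l x, fieldA 1 k l x] = ?g1 * (cmod (?t k l))\<^sup>2"
      "\<omega> x [fieldP k l x, fieldA \<i> k l x] = ?g2 * (cmod (?t k l))\<^sup>2" for k l
      by (simp_all del: of_real_power)
    then have val: "\<xi> x [u] = ?g1 * Re (traceQ x u) + ?g2 * Im (traceQ x u)" if "u \<in> tangent SLCP x" for u
      unfolding eval_at[OF x that] by (simp add: sum_units flip: sum_distrib_left)
    let ?b = "(A ** (dagger C ** (cscale (y1 * cnj z2 - y2 * cnj z1) (munit 1 1 - munit 2 2) ** C)), 0 :: cmat)"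
    have "?b \<in> tangent SLCP x"
    proof -
      have "trace (adj2 A ** fst ?b) = trace (cscale (y1 * cnj z2 - y2 * cnj z1) (munit 1 1 - munit 2 2))"
        using trace_mul_sym[of "dagger C" "cscale (y1 * cnj z2 - y2 * cnj z1) (munit 1 1 - munit 2 2) ** C"]
        by (simp add: SL2C_adj2[OF A] matrix_ring_simps(11) SU2_D[OF C] matrix_ring_simps(9))
      also have "\<dots> = 0" by (simp add: mat2)
      finally show ?thesis
        unfolding tangent_SLCP[OF x] by (simp add: xAP matrix_ring_simps(7,8) linear_0[OF linear_cmat(1)])
    qed
    then have "\<xi> x [?b] = ?g1 * Re (traceQ x ?b) + ?g2 * Im (traceQ x ?b)" by (rule val)
    also have "traceQ x ?b = cnj z1 * y2 - cnj z2 * y1"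
      unfolding xAP traceQ_bracket by (simp add: algebra_simps)
    also have "?g1 * Re (cnj z1 * y2 - cnj z2 * y1) + ?g2 * Im (cnj z1 * y2 - cnj z2 * y1) = \<omega> x [dE x v, dE x w]"
      unfolding v w \<omega>\<phi> two_form_type[OF \<phi>(1) J\<phi>, of y1 z1 y2 z2] ..
    finally show ?thesis
      unfolding v w unfolding xAP by (subst ext_d_vecD[OF \<xi> zero])
  qed
  with d[OF \<xi>I] show ?thesis by blast
qed

lemma pointwise_cond_in_EDS:
  assumes \<omega>: "\<omega> \<in> forms SLCP" and cond: "pointwise_cond SLCP dE JE \<omega>"
  shows "\<omega> \<in> I"
proof -
  \<comment> \<open>\<open>pE\<close> fixes tangent vectors, so the factorisation condition of the
    locale holds for all forms here.\<close>
  have ft: "factors_through SLCP pE \<eta>" for \<eta> :: "(cmat \<times> cmat, real) form"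
    unfolding factors_through_def
  proof (intro ballI allI impI)
    fix x vs assume "x \<in> SLCP" "set vs \<subseteq> tangent SLCP x"
    then have "map (pE x) vs = vs" by (intro map_idI pE_ident) auto
    then show "\<eta> x (map (pE x) vs) = \<eta> x vs" by simp
  qed
  have dp: "dE x (pE x v) = dE x v" if x: "x \<in> SLCP" for x v
  proof -
    have A: "fst x \<in> SL2C" and P: "snd x \<in> CP1" using x by auto
    have "tproj (snd x) (tproj (snd x) W) = tproj (snd x) W" for W
      by (rule tangent_CP1_D(2)[OF P tproj_tangent[OF P]])
    moreover have "fst x ** (mat 1 - transpose (snd x)) ** adj2 (fst x) ** cscale t (fst x) ** transpose (snd x) = 0" for t
      by (simp add: matrix_ring_simps SL2C_adj2[OF A] cscale_simps CP1_D[OF P])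
    ultimately show ?thesis
      by (simp add: dE_def pE_def matrix_ring_simps(3,4))
  qed
  have dd: "dE x (dE x v) = dE x v" if "x \<in> SLCP" for x v
    using that by (metis adapted_frame.dE_vecD adapted_frame.ex_vecD adapted_frameE)
  interpret frame SLCP pE dE JE I
  proof
    fix \<omega> :: "(cmat \<times> cmat, real) form" assume "\<omega> \<in> forms SLCP" "homogeneous_part 2 \<omega> = \<omega>"
      "\<And>x v w. x \<in> SLCP \<Longrightarrow> \<omega> x [JE x (dE x v), dE x w] = \<omega> x [dE x v, JE x (dE x w)]"
    from two_form_representative[OF this]
    show "\<exists>\<tau>\<in>I. factors_through SLCP pE \<tau> \<and> (\<forall>x\<in>SLCP. \<forall>v w. \<tau> x [dE x v, dE x w] = \<omega> x [dE x v, dE x w])"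
      using ft by blast
  next
    fix \<omega> :: "(cmat \<times> cmat, real) form" assume "\<omega> \<in> forms SLCP" "homogeneous_part 1 \<omega> = \<omega>"
      "\<And>x v. x \<in> SLCP \<Longrightarrow> \<omega> x [dE x v] = 0"
    then show "\<omega> \<in> I" by (rule annihilator_in_EDS)
  next
    show "graded_ideal SLCP I" using EDS unfolding is_EDS_def by blast
  qed (rule linear_E[THEN linear_add] linear_E[THEN linear_scale] smooth_E pE_tangent dd dp dE_JE JE_JE plane_E pE_ident dE_tangent | assumption)+
  show ?thesis by (rule pointwise_cond_in_ideal[OF \<omega> ft cond])
qed

end

text \<open>The forms with the pointwise condition are themselves a system containing the sections,
  and every such system contains them.\<close>

lemma E_system_iff:
  assumes \<omega>: "\<omega> \<in> forms SLCP"
  shows "\<omega> \<in> E_system \<longleftrightarrow> pointwise_cond SLCP dE JE \<omega>"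
proof
  assume "\<omega> \<in> E_system"
  then have "\<omega> \<in> {\<omega> \<in> forms SLCP. pointwise_cond SLCP dE JE \<omega>}"
    unfolding E_system_def real_version_def pfaffian_system_def EDS_generated_def
    using is_EDS_pointwise_cond bundle_sections_pointwise_cond by blast
  then show "pointwise_cond SLCP dE JE \<omega>" by blast
next
  assume "pointwise_cond SLCP dE JE \<omega>"
  then show "\<omega> \<in> E_system"
    unfolding E_system_def real_version_def pfaffian_system_def EDS_generated_def
    using pointwise_cond_in_EDS[OF _ _ \<omega>] by blast
qed

subsection \<open>The quotient of the second system\<close>

lemma (in tangent_spaces) forms_image:
  fixes h :: "'b::{real_normed_field, euclidean_space} \<Rightarrow> 'c::real_normed_field"
  assumes h: "bounded_linear h" and \<omega>: "\<omega> \<in> forms M"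
  shows "(\<lambda>x vs. h (\<omega> x vs)) \<in> forms M"
proof (rule formsI[OF subspace_tangent])
  have lin: "linear h" by (rule bounded_linear.linear[OF h])
  fix x assume "x \<in> M"
  then obtain \<eta> U where x: "x \<in> U" and e: "extends_on M U \<omega> \<eta>" by (rule formsE[OF \<omega>])
  note E = extends_onD[OF e]
  have "alt (\<lambda>vs. h (\<eta> y vs))" if "y \<in> U" for y
    by (rule altI) (use linear_compose[OF alt_slot_linear[OF E(2)[OF that]] lin] alt_adjacent[OF E(2)[OF that]] linear_0[OF lin]
      in \<open>simp_all add: o_def\<close>)
  then show "\<exists>\<zeta>. local_extension M (\<lambda>x vs. h (\<omega> x vs)) x \<zeta>"
    by (intro exI[of _ "\<lambda>x vs. h (\<eta> x vs)"] local_extensionI[of U])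
       (auto simp: E x intro: smooth_on_linear[OF h])
next
  fix x vs assume "x \<notin> M \<or> \<not> set vs \<subseteq> tangent M x"
  then have "\<omega> x vs = 0" by (rule forms_outside[OF \<omega>])
  then show "h (\<omega> x vs) = 0" by (simp add: linear_0[OF bounded_linear.linear[OF h]])
qed

interpretation SL2C: tangent_spaces SL2C
proof
  fix A assume A: "A \<in> SL2C"
  have "linear (\<lambda>V. trace (adj2 A ** V))"
    by (rule linear_slotI) (simp add: matrix_ring_simps(1,12) trace2 algebra_simps)
  then show "subspace (tangent SL2C A)"
    unfolding tangent_SL2C[OF A] using real_vector.linear_subspace_kernel by blast
qed

text \<open>In the coframe \<open>u = \<alpha>3\<close>, \<open>w = \<alpha>2 + cnj \<alpha>3\<close>, \<open>Re \<alpha>1\<close>, \<open>Im \<alpha>1\<close>, the projection \<open>pB\<close> kills the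
  direction of \<open>Im \<alpha>1\<close>, tangent to the circle orbits, and \<open>dB\<close> also that of \<open>Re \<alpha>1\<close>. The
  complex structure \<open>JB\<close> is the one for which \<open>u\<close> and \<open>w\<close> are of type (1,0).\<close>
definition ps :: "cmat \<Rightarrow> cmat" where
  "ps Y = cscale (of_real (Re ((Y $ 1 $ 1 - Y $ 2 $ 2) / 2))) (munit 1 1 - munit 2 2)
    + cscale (Y $ 1 $ 2) (munit 1 2) + cscale (Y $ 2 $ 1) (munit 2 1)"

definition off :: "cmat \<Rightarrow> cmat" where
  "off Y = cscale (Y $ 1 $ 2) (munit 1 2) + cscale (Y $ 2 $ 1) (munit 2 1)"

text \<open>From u -> \<i> u and w -> \<i> w: the entry Y12 = w - cnj u goes to \<i> w - cnj (\<i>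
  u) = \<i> w + \<i> cnj u, and substituting w = Y12 + cnj u gives the term with the factor
  2.\<close>

definition jj :: "cmat \<Rightarrow> cmat" where
  "jj Y = cscale (\<i> * Y $ 1 $ 2 + 2 * \<i> * cnj (Y $ 2 $ 1)) (munit 1 2) + cscale (\<i> * Y $ 2 $ 1) (munit 2 1)"

definition pB :: "cmat \<Rightarrow> cmat \<Rightarrow> cmat" where "pB A V = A ** ps (adj2 A ** V)"
definition dB :: "cmat \<Rightarrow> cmat \<Rightarrow> cmat" where "dB A V = A ** off (adj2 A ** V)"
definition JB :: "cmat \<Rightarrow> cmat \<Rightarrow> cmat" where "JB A V = A ** jj (adj2 A ** V)"

lemma left_translate_linear:
  fixes f :: "cmat \<Rightarrow> cmat"
  assumes "\<And>c d u w. f (c *\<^sub>R u + d *\<^sub>R w) = c *\<^sub>R f u + d *\<^sub>R f w"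
  shows "linear (\<lambda>V. A ** f (adj2 A ** V))"
  by (rule linear_slotI) (simp add: matrix_ring_simps(1,12) assms)

lemma ps_off_jj_linear:
  "ps (c *\<^sub>R u + d *\<^sub>R w) = c *\<^sub>R ps u + d *\<^sub>R ps w"
  "off (c *\<^sub>R u + d *\<^sub>R w) = c *\<^sub>R off u + d *\<^sub>R off w"
  "jj (c *\<^sub>R u + d *\<^sub>R w) = c *\<^sub>R jj u + d *\<^sub>R jj w"
  unfolding ps_def off_def jj_def mat2_eq_iff
  by (simp_all add: complex_eq_iff algebra_simps add_divide_distrib diff_divide_distrib)

lemma linear_B: "linear (pB A)" "linear (dB A)" "linear (JB A)"
  unfolding pB_def[abs_def] dB_def[abs_def] JB_def[abs_def]
  by (rule left_translate_linear[OF ps_off_jj_linear(1)] left_translate_linear[OF ps_off_jj_linear(2)]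
      left_translate_linear[OF ps_off_jj_linear(3)])+

lemma smooth_B: "smooth_on UNIV (\<lambda>A. pB A V)" "smooth_on UNIV (\<lambda>A. dB A V)" "smooth_on UNIV (\<lambda>A. JB A (dB A V))"
  unfolding pB_def dB_def JB_def ps_def off_def jj_def divide_complex_def
  by (intro smooth_on_cmat open_UNIV)+

lemma ps_off_jj:
  "ps (ps Y) = ps Y" "ps (off Y) = off Y" "off (ps Y) = off Y" "off (off Y) = off Y"
  "off (jj Y) = jj Y" "jj (jj (off Y)) = - off Y" "trace (ps Y) = 0"
  by (simp_all add: ps_def off_def jj_def mat2_eq_iff trace2 complex_eq_iff field_simps)

section \<open>The complex ideal behind \<open>B_system\<close> and its real forms\<close>

lemma wedge_image:
  assumes "\<And>a b. h (a * b) = h a * h b" "\<And>a b. h (a + b) = h a + h b" "h 0 = 0" "h 1 = 1" "h (- 1) = - 1"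
  shows "wedge (\<lambda>x vs. h (\<omega> x vs)) (\<lambda>x vs. h (\<eta> x vs)) = (\<lambda>x vs. h (wedge \<omega> \<eta> x vs))"
proof -
  have p: "h (a ^ n) = h a ^ n" for a n by (induction n) (simp_all add: assms)
  have s: "h (sum f S) = (\<Sum>i\<in>S. h (f i))" for f :: "nat set \<Rightarrow> _" and S
    by (induction S rule: infinite_finite_induct) (simp_all add: assms)
  show ?thesis by (simp add: wedge_def s p assms)
qed

lemma B_forms: "one_form SL2C \<alpha>1 \<in> forms SL2C" "one_form SL2C \<alpha>2 \<in> forms SL2C" "one_form SL2C \<alpha>3 \<in> forms SL2C"
  and one_form_\<alpha>: "one_form SL2C \<alpha>1 = one_form SL2C (\<lambda>A V. (adj2 A ** V) $ 1 $ 1)"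
   "one_form SL2C \<alpha>2 = one_form SL2C (\<lambda>A V. (adj2 A ** V) $ 1 $ 2)"
   "one_form SL2C \<alpha>3 = one_form SL2C (\<lambda>A V. (adj2 A ** V) $ 2 $ 1)"
proof -
  show eq: "one_form SL2C \<alpha>1 = one_form SL2C (\<lambda>A V. (adj2 A ** V) $ 1 $ 1)"
   "one_form SL2C \<alpha>2 = one_form SL2C (\<lambda>A V. (adj2 A ** V) $ 1 $ 2)"
   "one_form SL2C \<alpha>3 = one_form SL2C (\<lambda>A V. (adj2 A ** V) $ 2 $ 1)"
    by (auto simp: one_form_def fun_eq_iff \<alpha>1_def \<alpha>2_def \<alpha>3_def maurer_cartan_def SL2C_adj2(3))
  have "one_form SL2C (\<lambda>A V. (adj2 A ** V) $ i $ j) \<in> forms SL2C" for i j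
  proof (rule SL2C.forms_one_form[of UNIV])
    show "linear (\<lambda>V. (adj2 A ** V) $ i $ j)" for A
      by (rule linear_slotI) (simp add: matrix_ring_simps(1,12))
    show "smooth_on UNIV (\<lambda>A. (adj2 A ** V) $ i $ j)" for V
      by (intro smooth_on_cmat open_UNIV)
  qed auto
  then show "one_form SL2C \<alpha>1 \<in> forms SL2C" "one_form SL2C \<alpha>2 \<in> forms SL2C" "one_form SL2C \<alpha>3 \<in> forms SL2C"
    unfolding eq by auto
qed

lemma forms_cnj: "\<omega> \<in> forms SL2C \<Longrightarrow> form_cnj \<omega> \<in> forms SL2C"
  unfolding form_cnj_def by (rule SL2C.forms_image[OF bounded_linear_cnj])

lemma B_generators_forms: "B_generators \<subseteq> forms SL2C"
  unfolding B_generators_def Let_def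
  by (auto intro!: SL2C.forms_plus SL2C.forms_wedge forms_cnj B_forms)

lemma algebraic_ideal_graded:
  assumes "S \<subseteq> forms SL2C"
  shows "graded_ideal SL2C (algebraic_ideal SL2C S)"
proof -
  let ?\<I> = "{I. graded_ideal SL2C I \<and> S \<subseteq> I}"
  have "forms SL2C \<in> ?\<I>" using assms SL2C.graded_ideal_forms by blast
  then have "algebraic_ideal SL2C S \<subseteq> forms SL2C" unfolding algebraic_ideal_def by blast
  then show ?thesis
    unfolding graded_ideal_def unfolding algebraic_ideal_def graded_ideal_def by blast
qed

lemma graded_ideal_B: "graded_ideal SL2C B_system"
proof -
  let ?J = "algebraic_ideal SL2C B_generators" and ?c = "\<lambda>\<omega> x vs. complex_of_real (\<omega> x vs)"
  have J: "graded_ideal SL2C ?J" by (rule algebraic_ideal_graded[OF B_generators_forms])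
  have w: "?c (wedge \<omega> \<eta>) = wedge (?c \<omega>) (?c \<eta>)" for \<omega> \<eta> :: "(cmat, real) form"
    by (rule wedge_image[symmetric]) auto
  have p: "?c (form_plus \<omega> \<eta>) = form_plus (?c \<omega>) (?c \<eta>)" for \<omega> \<eta> :: "(cmat, real) form"
    by (simp add: form_plus_def)
  have h: "?c (homogeneous_part k \<omega>) = homogeneous_part k (?c \<omega>)" for k and \<omega> :: "(cmat, real) form"
    by (simp add: homogeneous_part_def fun_eq_iff)
  have c: "?c \<omega> \<in> forms SL2C" if "\<omega> \<in> forms SL2C" for \<omega>
    by (rule SL2C.forms_image[OF bounded_linear_of_real that])
  note J' = J[unfolded graded_ideal_def]
  show ?thesis
    unfolding graded_ideal_def B_system_def real_forms_in_def
  proof (intro conjI ballI allI; (elim CollectE conjE)?; (intro CollectI conjI)?)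
    show "{\<omega> \<in> forms SL2C. ?c \<omega> \<in> ?J} \<subseteq> forms SL2C" by blast
    show "?c (\<lambda>x vs. 0) \<in> ?J" using J' by simp
  qed (use J' c in \<open>simp_all add: w p h SL2C.forms_zero SL2C.forms_plus SL2C.forms_wedge SL2C.forms_homogeneous\<close>)
qed

lemma JB_dB: "A \<in> SL2C \<Longrightarrow> dB A (JB A (dB A V)) = JB A (dB A V)"
  by (simp add: dB_def JB_def SL2C_adj2 ps_off_jj)

lemma dB_tangent: "A \<in> SL2C \<Longrightarrow> dB A V \<in> tangent SL2C A"
  by (simp add: tangent_SL2C dB_def SL2C_adj2 off_def trace2)

lemma JB_tangent: "A \<in> SL2C \<Longrightarrow> JB A V \<in> tangent SL2C A"
  by (simp add: tangent_SL2C JB_def SL2C_adj2 jj_def trace2)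

lemma coframe_dB:
  assumes "A \<in> SL2C"
  shows "one_form SL2C \<alpha>1 A [dB A V] = 0"
    "one_form SL2C \<alpha>3 A [JB A (dB A V)] = \<i> * one_form SL2C \<alpha>3 A [dB A V]"
    "form_plus (one_form SL2C \<alpha>2) (form_cnj (one_form SL2C \<alpha>3)) A [JB A (dB A V)] =
      \<i> * form_plus (one_form SL2C \<alpha>2) (form_cnj (one_form SL2C \<alpha>3)) A [dB A V]"
  unfolding one_form_\<alpha> using assms dB_tangent[OF assms] JB_tangent[OF assms]
  by (simp_all add: one_form_def form_plus_def form_cnj_def)
     (simp_all add: dB_def JB_def SL2C_adj2 off_def jj_def algebra_simps)

text \<open>Complex-valued forms with the pointwise condition are a graded ideal, so only the
  generators matter: \<alpha>1 + cnj \<alpha>1 annihilates the distribution, the second generator is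
  a product of two (1,0) forms, and the third is its conjugate.\<close>

lemma B_system_pointwise_cond:
  assumes "\<omega> \<in> B_system"
  shows "pointwise_cond SL2C dB JB \<omega>"
proof -
  let ?I = "{\<omega> \<in> forms SL2C. pointwise_cond SL2C dB JB (\<omega> :: (cmat, complex) form)}"
  let ?a2 = "one_form SL2C \<alpha>2" and ?a3 = "one_form SL2C \<alpha>3"
  define w where "w = form_plus ?a2 (form_cnj ?a3)"
  have deg: "?a3 x us = 0" "w x us = 0" "one_form SL2C \<alpha>1 x us = 0" if "length us \<noteq> 1" for x us
    using that by (auto simp: one_form_def form_plus_def form_cnj_def w_def)
  have \<Omega>: "pointwise_cond SL2C dB JB (wedge ?a3 w)"
    unfolding pointwise_cond_def
    using coframe_dB[folded w_def] by (auto simp: deg wedge_degree1)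
  have cnj: "wedge (form_cnj ?a3) (form_plus (form_cnj ?a2) ?a3) = (\<lambda>x vs. cnj (wedge ?a3 w x vs))"
  proof -
    have "form_plus (form_cnj ?a2) ?a3 = (\<lambda>x vs. cnj (w x vs))"
      by (simp add: w_def form_plus_def form_cnj_def)
    then show ?thesis
      unfolding form_cnj_def by (subst wedge_image[symmetric]) simp_all
  qed
  have "pointwise_cond SL2C dB JB (\<lambda>x vs. cnj (wedge ?a3 w x vs))"
    using \<Omega> unfolding pointwise_cond_def by simp
  moreover have "pointwise_cond SL2C dB JB (form_plus (one_form SL2C \<alpha>1) (form_cnj (one_form SL2C \<alpha>1)))"
    unfolding pointwise_cond_def using coframe_dB(1) by (auto simp: form_plus_def form_cnj_def deg)
  ultimately have "B_generators \<subseteq> ?I"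
    using B_generators_forms \<Omega> unfolding B_generators_def Let_def w_def[symmetric] cnj by auto
  moreover have "graded_ideal SL2C ?I"
    by (rule SL2C.graded_ideal_pointwise_cond) (rule JB_dB)
  ultimately have "(\<lambda>x vs. complex_of_real (\<omega> x vs)) \<in> ?I"
    using assms unfolding B_system_def real_forms_in_def algebraic_ideal_def by blast
  then show ?thesis unfolding pointwise_cond_def by simp
qed

lemma real_parts_in_B:
  "(\<lambda>x vs. Re (one_form SL2C \<alpha>1 x vs)) \<in> B_system"
  "(\<lambda>x vs. Re (wedge (one_form SL2C \<alpha>3) (form_plus (one_form SL2C \<alpha>2) (form_cnj (one_form SL2C \<alpha>3))) x vs)) \<in> B_system"
  "(\<lambda>x vs. Im (wedge (one_form SL2C \<alpha>3) (form_plus (one_form SL2C \<alpha>2) (form_cnj (one_form SL2C \<alpha>3))) x vs)) \<in> B_system"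
proof -
  let ?J = "algebraic_ideal SL2C B_generators"
  let ?a1 = "one_form SL2C \<alpha>1" and ?a2 = "one_form SL2C \<alpha>2" and ?a3 = "one_form SL2C \<alpha>3"
  let ?\<Omega> = "wedge ?a3 (form_plus ?a2 (form_cnj ?a3))"
  have J: "graded_ideal SL2C ?J" by (rule algebraic_ideal_graded[OF B_generators_forms])
  have gen: "B_generators \<subseteq> ?J" unfolding algebraic_ideal_def by blast
  have g: "form_plus ?a1 (form_cnj ?a1) \<in> ?J" "?\<Omega> \<in> ?J"
    "wedge (form_cnj ?a3) (form_plus (form_cnj ?a2) ?a3) \<in> ?J"
    using gen unfolding B_generators_def Let_def by auto
  have cnj: "wedge (form_cnj ?a3) (form_plus (form_cnj ?a2) ?a3) = (\<lambda>x vs. cnj (?\<Omega> x vs))"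
  proof -
    have "form_plus (form_cnj ?a2) ?a3 = (\<lambda>x vs. cnj (form_plus ?a2 (form_cnj ?a3) x vs))"
      by (simp add: form_plus_def form_cnj_def)
    then show ?thesis
      unfolding form_cnj_def by (subst wedge_image[symmetric]) simp_all
  qed
  have plus: "form_plus \<omega> \<eta> \<in> ?J" if "\<omega> \<in> ?J" "\<eta> \<in> ?J" for \<omega> \<eta>
    using J that unfolding graded_ideal_def by blast
  have comb: "(\<lambda>x vs. c * \<omega> x vs + d * \<eta> x vs) \<in> ?J" if "\<omega> \<in> ?J" "\<eta> \<in> ?J" for c d \<omega> \<eta>
    using plus[OF SL2C.graded_ideal_scale[OF J that(1), of c] SL2C.graded_ideal_scale[OF J that(2), of d]]
    unfolding form_plus_def .
  have F: "?\<Omega> \<in> forms SL2C" using B_generators_forms unfolding B_generators_def Let_def by auto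
  have re: "complex_of_real (Re z) = 1/2 * z + 1/2 * cnj z" "complex_of_real (Im z) = - \<i>/2 * z + \<i>/2 * cnj z" for z
    by (simp_all add: complex_eq_iff)
  have "(\<lambda>x vs. complex_of_real (Re (?a1 x vs))) = (\<lambda>x vs. 1/2 * form_plus ?a1 (form_cnj ?a1) x vs + 0 * form_plus ?a1 (form_cnj ?a1) x vs)"
    by (simp add: fun_eq_iff form_plus_def form_cnj_def complex_eq_iff)
  then show "(\<lambda>x vs. Re (?a1 x vs)) \<in> B_system"
    unfolding B_system_def real_forms_in_def
    using comb[OF g(1) g(1), of "1/2" 0] SL2C.forms_image[OF bounded_linear_Re B_forms(1)] by simp
  show "(\<lambda>x vs. Re (?\<Omega> x vs)) \<in> B_system"
    unfolding B_system_def real_forms_in_def mem_Collect_eq re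
    using comb[OF g(2) g(3)[unfolded cnj], of "1/2" "1/2"] SL2C.forms_image[OF bounded_linear_Re F] by blast
  show "(\<lambda>x vs. Im (?\<Omega> x vs)) \<in> B_system"
    unfolding B_system_def real_forms_in_def mem_Collect_eq re
    using comb[OF g(2) g(3)[unfolded cnj], of "- \<i>/2" "\<i>/2"] SL2C.forms_image[OF bounded_linear_Im F] by blast
qed

text \<open>The left-invariant field with value \<open>Y\<close> at the identity. Such fields frame
  \<open>SL2C\<close>, so coefficients of a form can be read off by contraction with single
  fields.\<close>

definition leftfield :: "cmat \<Rightarrow> cmat \<Rightarrow> cmat" where "leftfield Y A = A ** Y"

lemma smooth_leftfield: "smooth_on UNIV (leftfield Y)"
  unfolding leftfield_def[abs_def] by (intro smooth_on_cmat open_UNIV)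

lemma leftfield_tangent: "A \<in> SL2C \<Longrightarrow> trace Y = 0 \<Longrightarrow> leftfield Y A \<in> tangent SL2C A"
  by (simp add: leftfield_def tangent_SL2C SL2C_adj2)

interpretation B: frame SL2C pB dB JB B_system
proof
  fix \<omega> :: "(cmat, real) form"
  assume \<omega>: "\<omega> \<in> forms SL2C" "factors_through SL2C pB \<omega>" "homogeneous_part 1 \<omega> = \<omega>"
    and zero: "\<And>A V. A \<in> SL2C \<Longrightarrow> \<omega> A [dB A V] = 0"
  \<comment> \<open>Re \<alpha>1 takes the value 1 on the left-invariant field of \<open>?h\<close>,
    and forms that factor through \<open>pB\<close> ignore the direction of Im \<alpha>1; hence
    \<omega> is its value on that field times Re \<alpha>1.\<close>
  let ?h = "munit 1 1 - munit 2 2"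
  let ?f = "SL2C.contraction [leftfield ?h] (\<lambda>A V. V) \<omega>" and ?\<rho> = "\<lambda>x vs. Re (one_form SL2C \<alpha>1 x vs)"
  have hom: "\<omega> A us = 0" if "length us \<noteq> 1" for A us
    using that fun_cong[OF fun_cong[OF \<omega>(3)], of A us] by (simp add: homogeneous_part_def)
  have f: "?f \<in> forms SL2C"
    by (rule SL2C.forms_contraction[OF \<omega>(1)])
       (auto simp: smooth_leftfield trace2 intro!: leftfield_tangent intro: linear_id[unfolded id_def])
  have "wedge ?f ?\<rho> \<in> B_system"
    using graded_ideal_B f real_parts_in_B(1) unfolding graded_ideal_def by blast
  moreover have "wedge ?f ?\<rho> = \<omega>"
  proof (intro ext)
    fix A vs
    have "?f A us = 0" if "us \<noteq> []" for us using that by (simp add: SL2C.contraction_def hom)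
    then have w: "wedge ?f ?\<rho> A vs = ?f A [] * ?\<rho> A vs" by (rule wedge_degree0)
    show "wedge ?f ?\<rho> A vs = \<omega> A vs"
    proof (cases "A \<in> SL2C \<and> set vs \<subseteq> tangent SL2C A \<and> length vs = 1")
      case True
      then obtain V where vs: "vs = [V]" by (auto simp: length_Suc_conv)
      have A: "A \<in> SL2C" and V: "V \<in> tangent SL2C A" using True vs by auto
      obtain \<phi> where \<phi>: "alt \<phi>" "\<forall>vs. set vs \<subseteq> tangent SL2C A \<longrightarrow> \<omega> A vs = \<phi> vs"
        by (rule forms_point[OF \<omega>(1) A])
      have lin: "linear (\<lambda>v. \<phi> [v])" using alt_slot_linear[OF \<phi>(1), of "[]" "[]"] by simp
      let ?Y = "adj2 A ** V"
      have tr: "?Y $ 2 $ 2 = - ?Y $ 1 $ 1"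
        using V unfolding tangent_SL2C[OF A] by (simp add: trace2 eq_neg_iff_add_eq_0 add.commute)
      have "ps ?Y = Re (?Y $ 1 $ 1) *\<^sub>R ?h + off ?Y"
        by (simp add: ps_def off_def tr mat2_eq_iff) (simp add: scaleR_conv_of_real)
      then have p: "pB A V = Re (?Y $ 1 $ 1) *\<^sub>R leftfield ?h A + dB A V"
        by (simp add: pB_def dB_def leftfield_def matrix_ring_simps)
      have t: "pB A V \<in> tangent SL2C A" "leftfield ?h A \<in> tangent SL2C A"
        using A leftfield_tangent[OF A, of ?h] by (simp add: tangent_SL2C pB_def SL2C_adj2 ps_off_jj, simp add: trace2)
      have "\<omega> A [V] = \<omega> A [pB A V]"
        using \<omega>(2) A V unfolding factors_through_def by (metis list.simps(8,9) vs True)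
      also have "\<dots> = Re (?Y $ 1 $ 1) * \<phi> [leftfield ?h A] + \<phi> [dB A V]"
        using \<phi>(2) t unfolding p by (simp add: linear_add[OF lin] linear_scale[OF lin])
      also have "\<phi> [dB A V] = 0" using zero[OF A, of V] \<phi>(2) dB_tangent[OF A] by simp
      finally show ?thesis
        using A V \<phi>(2) t w unfolding vs one_form_\<alpha> by (simp add: SL2C.contraction_def one_form_def)
    next
      case False
      then have "\<omega> A vs = 0" using hom forms_outside[OF \<omega>(1)] by blast
      moreover have "?\<rho> A vs = 0" using False by (auto simp: one_form_def)
      ultimately show ?thesis unfolding w by simp
    qed
  qed
  ultimately show "\<omega> \<in> B_system" by simp
next
  fix \<omega> :: "(cmat, real) form"
  assume \<omega>: "\<omega> \<in> forms SL2C" "factors_through SL2C pB \<omega>" "homogeneous_part 2 \<omega> = \<omega>"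
    and J: "\<And>A V W. A \<in> SL2C \<Longrightarrow> \<omega> A [JB A (dB A V), dB A W] = \<omega> A [dB A V, JB A (dB A W)]"
  let ?a2 = "one_form SL2C \<alpha>2" and ?a3 = "one_form SL2C \<alpha>3"
  define w where "w = form_plus ?a2 (form_cnj ?a3)"
  let ?R = "\<lambda>x vs. Re (wedge ?a3 w x vs)" and ?M = "\<lambda>x vs. Im (wedge ?a3 w x vs)"
  text \<open>\<open>ew\<close>, \<open>eu\<close>, \<open>iu\<close> are dual to \<open>w = 1\<close>, \<open>u = 1\<close> and \<open>u = \<i>\<close>.\<close>
  define ew where "ew = munit 1 2"
  define eu where "eu = munit 2 1 - munit 1 2"
  define iu where "iu = cscale \<i> (munit 2 1 + munit 1 2)"
  note e_defs = ew_def eu_def iu_def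
  define con where "con = (\<lambda>u. SL2C.contraction [leftfield u, leftfield ew] (\<lambda>A V. V) \<omega>)"
  have tr: "trace ew = 0" "trace eu = 0" "trace iu = 0" by (simp_all add: e_defs trace2)
  have hom: "\<omega> A us = 0" if "length us \<noteq> 2" for A us
    using that fun_cong[OF fun_cong[OF \<omega>(3)], of A us] by (simp add: homogeneous_part_def)
  have con: "con u \<in> forms SL2C" if "trace u = 0" for u
    unfolding con_def
    by (rule SL2C.forms_contraction[OF \<omega>(1)])
       (auto simp: smooth_leftfield that tr intro!: leftfield_tangent intro: linear_id[unfolded id_def])
  have cw: "wedge (con u) \<zeta> A vs = \<omega> A [leftfield u A, leftfield ew A] * \<zeta> A vs" if "A \<in> SL2C" for u \<zeta> A vs
  proof -
    have "con u A us = 0" if "us \<noteq> []" for us using that by (simp add: con_def SL2C.contraction_def hom)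
    then have "wedge (con u) \<zeta> A vs = con u A [] * \<zeta> A vs" by (rule wedge_degree0)
    then show ?thesis using that by (simp add: con_def SL2C.contraction_def)
  qed
  \<comment> \<open>The wedge of \<alpha>3 and \<open>w\<close> takes the values 1 and \<i> on the
    pairs (\<open>eu\<close>, \<open>ew\<close>) and (\<open>iu\<close>, \<open>ew\<close>), so the
    two contractions are the coefficients of its real and imaginary parts in \<omega>.\<close>
  define \<tau> where "\<tau> = form_plus (wedge (con eu) ?R) (wedge (con iu) ?M)"
  have \<tau>: "\<tau> \<in> B_system"
    using graded_ideal_B con[OF tr(2)] con[OF tr(3)] real_parts_in_B(2,3)[folded w_def]
    unfolding graded_ideal_def \<tau>_def by blast
  have deg: "?a3 x us = 0" "w x us = 0" if "length us \<noteq> 1" for x us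
    using that by (auto simp: one_form_def form_plus_def form_cnj_def w_def)
  have pt: "pB A V \<in> tangent SL2C A" if "A \<in> SL2C" for A V
    using that by (simp add: tangent_SL2C pB_def SL2C_adj2 ps_off_jj)
  have "factors_through SL2C pB \<tau>"
    unfolding factors_through_def
  proof (intro ballI allI impI)
    fix A vs assume A: "A \<in> SL2C" and vs: "set vs \<subseteq> tangent SL2C A"
    have inv: "?a3 A [pB A V] = ?a3 A [V]" "w A [pB A V] = w A [V]" if "V \<in> tangent SL2C A" for V
      unfolding w_def one_form_\<alpha> using that A pt[OF A]
      by (simp_all add: one_form_def form_plus_def form_cnj_def) (simp_all add: pB_def SL2C_adj2 ps_def)
    have "wedge ?a3 w A (map (pB A) vs) = wedge ?a3 w A vs"
    proof -
      have m: "?a3 A (map (pB A) us) = ?a3 A us" "w A (map (pB A) us) = w A us" if "set us \<subseteq> tangent SL2C A" for us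
        using that inv deg by (cases us; cases "tl us"; auto)+
      have "set (nths vs S) \<subseteq> tangent SL2C A" for S using vs set_nths_subset by fastforce
      then show ?thesis unfolding wedge_def nths_map by (simp add: m)
    qed
    then show "\<tau> A (map (pB A) vs) = \<tau> A vs"
      unfolding \<tau>_def form_plus_def cw[OF A] by simp
  qed
  moreover have "\<tau> A [dB A V, dB A W] = \<omega> A [dB A V, dB A W]" if A: "A \<in> SL2C" for A V W
  proof -
    obtain \<phi> where \<phi>: "alt \<phi>" "\<forall>vs. set vs \<subseteq> tangent SL2C A \<longrightarrow> \<omega> A vs = \<phi> vs"
      by (rule forms_point[OF \<omega>(1) A])
    have lin: "linear (\<lambda>u. \<phi> [u, z])" "linear (\<lambda>u. \<phi> [z, u])" for z
      using alt_slot_linear[OF \<phi>(1), of "[]" "[z]"] alt_slot_linear[OF \<phi>(1), of "[z]" "[]"] by auto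
    have swap: "\<phi> [u, z] = - \<phi> [z, u]" for u z using alt_swap[OF \<phi>(1), of "[]" u z "[]"] by simp
    have same: "\<phi> [u, u] = 0" for u using swap[of u u] by simp
    have nl: "\<phi> [- u, z] = - \<phi> [u, z]" "\<phi> [z, - u] = - \<phi> [z, u]" for u z
      using linear_neg[OF lin(1)] linear_neg[OF lin(2)] by auto
    define iw where "iw = cscale \<i> (munit 1 2)"
    let ?l = "\<lambda>Y. leftfield Y A"
    have J\<phi>: "\<phi> [?l (jj Y), ?l Z] = \<phi> [?l Y, ?l (jj Z)]" if "off Y = Y" "off Z = Z" for Y Z
    proof -
      have "dB A (?l Y) = ?l Y" "dB A (?l Z) = ?l Z" "JB A (?l Y) = ?l (jj Y)" "JB A (?l Z) = ?l (jj Z)"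
        using A that by (simp_all add: dB_def JB_def leftfield_def SL2C_adj2)
      then show ?thesis
        using J[OF A, of "?l Y" "?l Z"] \<phi>(2) dB_tangent[OF A] JB_tangent[OF A] by (metis empty_set empty_subsetI insert_subset list.simps(15))
    qed
    have o: "off ew = ew" "off eu = eu" "off iu = iu" "off iw = iw" "jj ew = iw" "jj eu = iu" "jj iu = - eu" "jj iw = - ew"
      by (simp_all add: e_defs iw_def off_def jj_def mat2_eq_iff mult.assoc)
    have ln: "?l (- Y) = - ?l Y" for Y by (simp add: leftfield_def matrix_ring_simps)
    have 1: "\<phi> [?l ew, ?l iw] = 0" using J\<phi>[of ew ew] swap[of "?l ew" "?l iw"] by (simp add: o)
    have 2: "\<phi> [?l eu, ?l iu] = 0" using J\<phi>[of eu eu] swap[of "?l eu" "?l iu"] by (simp add: o)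
    have 3: "\<phi> [?l eu, ?l iw] = \<phi> [?l iu, ?l ew]" using J\<phi>[of eu ew] by (simp add: o)
    have 4: "\<phi> [?l iu, ?l iw] = - \<phi> [?l eu, ?l ew]" using J\<phi>[of iu ew] by (simp add: o ln nl)
    have ex: "dB A V = Re u *\<^sub>R ?l eu + Im u *\<^sub>R ?l iu + Re z *\<^sub>R ?l ew + Im z *\<^sub>R ?l iw"
      if "u = ?a3 A [dB A V]" "z = w A [dB A V]" for V u z
    proof -
      have u: "u = (adj2 A ** V) $ 2 $ 1" and z: "z = (adj2 A ** V) $ 1 $ 2 + cnj ((adj2 A ** V) $ 2 $ 1)"
        using A dB_tangent[OF A, of V] unfolding that w_def one_form_\<alpha>
        by (simp_all add: one_form_def form_plus_def form_cnj_def) (simp_all add: dB_def SL2C_adj2 off_def)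
      have "off (adj2 A ** V) = Re u *\<^sub>R eu + Im u *\<^sub>R iu + Re z *\<^sub>R ew + Im z *\<^sub>R iw"
        by (simp add: u z off_def e_defs iw_def mat2_eq_iff complex_eq_iff)
      then show ?thesis by (simp add: dB_def leftfield_def matrix_ring_simps)
    qed
    define u1 z1 u2 z2 where "u1 = ?a3 A [dB A V]" and "z1 = w A [dB A V]" and "u2 = ?a3 A [dB A W]" and "z2 = w A [dB A W]"
    note l = lin(1)[THEN linear_add] lin(2)[THEN linear_add] lin(1)[THEN linear_scale] lin(2)[THEN linear_scale]
    have \<Omega>: "wedge ?a3 w A [dB A V, dB A W] = u1 * z2 - u2 * z1"
      by (simp add: wedge_degree1 deg u1_def z1_def u2_def z2_def)
    have "\<omega> A [dB A V, dB A W] = \<phi> [dB A V, dB A W]" using \<phi>(2) dB_tangent[OF A] by simp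
    also have "\<dots> = \<phi> [?l eu, ?l ew] * Re (u1 * z2 - u2 * z1) + \<phi> [?l iu, ?l ew] * Im (u1 * z2 - u2 * z1)"
      unfolding ex[OF u1_def z1_def] ex[OF u2_def z2_def] l same
        swap[of "?l ew" "?l eu"] swap[of "?l ew" "?l iu"] swap[of "?l iw" "?l eu"] swap[of "?l iw" "?l iu"]
        swap[of "?l iw" "?l ew"] swap[of "?l iu" "?l eu"] 1 2 3 4
      by (simp add: algebra_simps)
    also have "\<dots> = \<tau> A [dB A V, dB A W]"
      using \<phi>(2) leftfield_tangent[OF A] tr
      unfolding \<tau>_def form_plus_def cw[OF A] \<Omega> by simp
    finally show ?thesis ..
  qed
  ultimately show "\<exists>\<tau>\<in>B_system. factors_through SL2C pB \<tau> \<and>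
      (\<forall>A\<in>SL2C. \<forall>V W. \<tau> A [dB A V, dB A W] = \<omega> A [dB A V, dB A W])"
    using \<tau> by blast
next
  fix A assume A: "A \<in> SL2C"
  show "\<exists>a b. dB A a = a \<and> dB A b = b \<and> (\<forall>V. \<exists>r s t q. dB A V = r *\<^sub>R a + s *\<^sub>R JB A a + t *\<^sub>R b + q *\<^sub>R JB A b)"
  proof (intro exI conjI allI)
    fix V :: cmat
    let ?Y = "adj2 A ** V"
    \<comment> \<open>\<open>jj (munit 2 1)\<close> has the upper right entry 2 \<i> besides \<i> in
      the lower left; its contribution is subtracted from the (1,2) entry beforehand.\<close>
    let ?z = "?Y $ 1 $ 2 - 2 * \<i> * of_real (Im (?Y $ 2 $ 1))"
    have "off ?Y = Re ?z *\<^sub>R munit 1 2 + Im ?z *\<^sub>R jj (munit 1 2) + Re (?Y $ 2 $ 1) *\<^sub>R munit 2 1 + Im (?Y $ 2 $ 1) *\<^sub>R jj (munit 2 1)"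
      by (simp add: off_def jj_def mat2_eq_iff complex_eq_iff)
    then show "dB A V = Re ?z *\<^sub>R (A ** munit 1 2) + Im ?z *\<^sub>R JB A (A ** munit 1 2)
        + Re (?Y $ 2 $ 1) *\<^sub>R (A ** munit 2 1) + Im (?Y $ 2 $ 1) *\<^sub>R JB A (A ** munit 2 1)"
      by (simp add: dB_def JB_def SL2C_adj2[OF A] matrix_ring_simps(1,12))
  qed (simp_all add: dB_def SL2C_adj2[OF A], simp_all add: off_def mat2_eq_iff SL2C_adj2[OF A] cscale_simps)
next
  fix A V :: cmat assume A: "A \<in> SL2C"
  show "pB A V \<in> tangent SL2C A"
    using A by (simp add: tangent_SL2C pB_def SL2C_adj2 ps_off_jj)
  show "pB A (pB A V) = pB A V" "pB A (dB A V) = dB A V" "dB A (pB A V) = dB A V" "dB A (dB A V) = dB A V"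
    "dB A (JB A (dB A V)) = JB A (dB A V)" "JB A (JB A (dB A V)) = - dB A V"
    using A by (simp_all add: pB_def dB_def JB_def SL2C_adj2 ps_off_jj matrix_ring_simps(5))
next
  show "graded_ideal SL2C B_system" by (rule graded_ideal_B)
qed (rule linear_B[THEN linear_add] linear_B[THEN linear_scale] smooth_B)+

lemma B_system_iff:
  assumes "\<omega> \<in> forms SL2C" "factors_through SL2C pB \<omega>"
  shows "\<omega> \<in> B_system \<longleftrightarrow> pointwise_cond SL2C dB JB \<omega>"
  using B_system_pointwise_cond B.pointwise_cond_in_ideal[OF assms] by blast

subsection \<open>The quotient maps\<close>

text \<open>A linear left inverse of \<open>herm\<close> defined on all matrices, which turns
  \<open>Pi_SU2\<close> into a polynomial map of the ambient space.\<close>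

definition hinv :: "cmat \<Rightarrow> real^4" where
  "hinv H = (\<chi> i. if i = 0 then Re (H $ 1 $ 1 + H $ 2 $ 2) / 2 else if i = 1 then Re (H $ 1 $ 2)
    else if i = 2 then Im (H $ 1 $ 2) else Re (H $ 1 $ 1 - H $ 2 $ 2) / 2)"

lemma hinv_linear: "linear hinv"
  by (rule linear_slotI) (simp add: hinv_def vec_eq_iff algebra_simps add_divide_distrib diff_divide_distrib)

lemma hinv_entries: "hinv H $ 0 = Re (H $ 1 $ 1 + H $ 2 $ 2) / 2" "hinv H $ 1 = Re (H $ 1 $ 2)"
  "hinv H $ 2 = Im (H $ 1 $ 2)" "hinv H $ 3 = Re (H $ 1 $ 1 - H $ 2 $ 2) / 2"
  by (simp_all add: hinv_def)

lemma Pi_SU2_eq: "Pi_SU2 A = hinv (A ** dagger A)"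
proof -
  have "hinv (herm x) = x" for x
  proof -
    have "hinv (herm x) $ i = x $ i" for i
    proof -
      \<comment> \<open>Case analysis over the type \<open>4\<close> produces the index 4, which is
        the index 0 of \<open>herm\<close>.\<close>
      have "(4 :: 4) = 0" by simp
      then consider "i = 0" | "i = 1" | "i = 2" | "i = 3" using exhaust_4[of i] by auto
      then show ?thesis by cases (simp_all add: hinv_entries herm_def vector_2)
    qed
    then show ?thesis by (simp add: vec_eq_iff)
  qed
  then show ?thesis by (metis herm_Pi_SU2)
qed

lemma Pi_SU2_H3:
  assumes "A \<in> SL2C"
  shows "Pi_SU2 A \<in> H3"
proof -
  let ?H = "A ** dagger A"
  have re: "?H $ 1 $ 1 = of_real (Re (?H $ 1 $ 1))" "?H $ 2 $ 2 = of_real (Re (?H $ 2 $ 2))"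
    by (simp_all add: mat2_mult complex_eq_iff)
  have "?H $ 2 $ 1 = cnj (?H $ 1 $ 2)" by (simp add: mat2_mult)
  moreover have "?H $ 1 $ 1 * ?H $ 2 $ 2 - ?H $ 1 $ 2 * ?H $ 2 $ 1 = 1"
  proof -
    have "dagger A \<in> SL2C" using assms by (simp add: SL2C_iff flip: complex_cnj_mult complex_cnj_diff) (metis complex_cnj_one mult.commute)
    then have "?H \<in> SL2C" using assms by (simp add: SL2C_def det_mul)
    then show ?thesis unfolding SL2C_iff .
  qed
  ultimately have "of_real (Re (?H $ 1 $ 1) * Re (?H $ 2 $ 2) - ((Re (?H $ 1 $ 2))\<^sup>2 + (Im (?H $ 1 $ 2))\<^sup>2)) = (1 :: complex)"
    using re by (simp add: complex_mult_cnj)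
  then have 1: "Re (?H $ 1 $ 1) * Re (?H $ 2 $ 2) - ((Re (?H $ 1 $ 2))\<^sup>2 + (Im (?H $ 1 $ 2))\<^sup>2) = 1"
    by (metis of_real_eq_1_iff)
  have H: "Re (?H $ i $ i) = (cmod (A $ i $ 1))\<^sup>2 + (cmod (A $ i $ 2))\<^sup>2" for i
    unfolding cmod_power2 by (simp add: mat2_mult power2_eq_square)
  have nn: "Re (?H $ 1 $ 1) \<ge> 0" "Re (?H $ 2 $ 2) \<ge> 0" unfolding H by simp_all
  have "Re (?H $ 1 $ 1) + Re (?H $ 2 $ 2) \<noteq> 0"
  proof
    assume "Re (?H $ 1 $ 1) + Re (?H $ 2 $ 2) = 0"
    then have "Re (?H $ 1 $ 1) = 0" using nn by linarith
    with 1 show False by (simp add: sum_power2_eq_zero_iff) (smt (verit) sum_power2_ge_zero)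
  qed
  with nn have "Re (?H $ 1 $ 1) + Re (?H $ 2 $ 2) > 0" by linarith
  with 1 show ?thesis
    unfolding H3_def Pi_SU2_eq mem_Collect_eq hinv_entries
    by (simp add: power2_eq_square field_simps)
qed

text \<open>For w = (p, q) and the column u = (q, -p) this is \<open>A *v u\<close> times its
  conjugate transpose, divided by the squared norm of w: a multiple of the projection onto the line
  that is the second component of \<open>Pi_Delta_SU2\<close>.\<close>

definition imS :: "cmat \<times> cmat \<Rightarrow> cmat" where
  "imS x = fst x ** (mat 1 - transpose (snd x)) ** dagger (fst x)"

definition imS' :: "cmat \<times> cmat \<Rightarrow> cmat \<times> cmat \<Rightarrow> cmat" where
  "imS' x v = fst x ** (mat 1 - transpose (snd x)) ** dagger (fst v)
    + (fst x ** (- transpose (snd v)) + fst v ** (mat 1 - transpose (snd x))) ** dagger (fst x)"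

text \<open>Extends \<open>Pi_Delta_SU2\<close> to the open set \<open>domF\<close> of the ambient
  space: dividing by the trace normalises the projection without a choice of homogeneous
  coordinates, and derivatives can be computed in the ambient space.\<close>

definition PiF :: "cmat \<times> cmat \<Rightarrow> (real^4) \<times> cmat" where
  "PiF x = (hinv (fst x ** dagger (fst x)), inverse (Re (trace (imS x))) *\<^sub>R imS x)"

definition PiF' :: "cmat \<times> cmat \<Rightarrow> cmat \<times> cmat \<Rightarrow> (real^4) \<times> cmat" where
  "PiF' x v = (hinv (fst x ** dagger (fst v) + fst v ** dagger (fst x)),
    inverse (Re (trace (imS x))) *\<^sub>R imS' x v +
    (- (inverse (Re (trace (imS x))) * Re (trace (imS' x v)) * inverse (Re (trace (imS x))))) *\<^sub>R imS x)"

definition domF :: "(cmat \<times> cmat) set" where "domF = {x. Re (trace (imS x)) \<noteq> 0}"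

lemma smooth_imS: "smooth_on UNIV imS"
  unfolding imS_def[abs_def] by (intro smooth_on_cmat open_UNIV)

lemma open_domF: "open domF"
proof -
  have "smooth_on UNIV (\<lambda>x. Re (trace (imS x)))"
    unfolding imS_def by (intro smooth_on_cmat open_UNIV)
  then have "continuous_on UNIV (\<lambda>x. Re (trace (imS x)))"
    unfolding smooth_on_def by (metis ck_on.simps(1))
  then show ?thesis
    unfolding domF_def by (intro open_Collect_neq) auto
qed

lemma smooth_PiF: "smooth_on domF PiF"
proof -
  have S: "smooth_on domF imS" by (rule smooth_on_subset[OF smooth_imS]) simp
  show ?thesis
    unfolding PiF_def[abs_def]
    by (intro smooth_on_Pair smooth_on_linear[OF bounded_linear_fun[OF hinv_linear]]
        smooth_on_bilinear[OF bounded_bilinear_scaleR] smooth_on_inverse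
        smooth_on_cmat open_domF S) (simp add: domF_def)
qed

lemma imS_derivative: "(imS has_derivative imS' x) (at x)"
proof -
  have "((\<lambda>x. fst x ** (mat 1 - transpose (snd x)) ** dagger (fst x)) has_derivative
      (\<lambda>v. fst x ** (mat 1 - transpose (snd x)) ** dagger (fst v)
    + (fst x ** (0 - transpose (snd v)) + fst v ** (mat 1 - transpose (snd x))) ** dagger (fst x))) (at x)"
    by (rule bounded_linear.has_derivative[OF bounded_linear_cmat(1)] matrix_has_derivative)+
  then show ?thesis by (simp add: imS_def[abs_def] imS'_def[abs_def])
qed

lemma PiF_derivative:
  assumes "x \<in> domF"
  shows "(PiF has_derivative PiF' x) (at x)"
proof -
  have t: "((\<lambda>x. Re (trace (imS x))) has_derivative (\<lambda>v. Re (trace (imS' x v)))) (at x)"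
    by (intro bounded_linear.has_derivative[OF bounded_linear_Re]
        bounded_linear.has_derivative[OF bounded_linear_cmat(4)] imS_derivative)
  have "((\<lambda>x. inverse (Re (trace (imS x))) *\<^sub>R imS x) has_derivative
      (\<lambda>v. inverse (Re (trace (imS x))) *\<^sub>R imS' x v +
    (- (inverse (Re (trace (imS x))) * Re (trace (imS' x v)) * inverse (Re (trace (imS x))))) *\<^sub>R imS x)) (at x)"
    by (rule has_derivative_scaleR[OF Deriv.has_derivative_inverse[OF _ t] imS_derivative])
       (use assms in \<open>simp add: domF_def\<close>)
  moreover have "((\<lambda>x. hinv (fst x ** dagger (fst x))) has_derivative
      (\<lambda>v. hinv (fst x ** dagger (fst v) + fst v ** dagger (fst x)))) (at x)"
    by (rule bounded_linear.has_derivative[OF bounded_linear_fun[OF hinv_linear]]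
        bounded_linear.has_derivative[OF bounded_linear_cmat(1)] matrix_has_derivative)+
  ultimately show ?thesis
    unfolding PiF_def[abs_def] PiF'_def[abs_def] by (intro has_derivative_Pair)
qed

lemma PiF'_linear: "x \<in> domF \<Longrightarrow> linear (PiF' x)"
  by (rule has_derivative_linear[OF PiF_derivative])

lemma hpoint_image:
  assumes w: "w \<noteq> 0" and A: "A \<in> SL2C"
  defines "u \<equiv> vector [w $ 2, - (w $ 1)]"
  shows "hpoint (A *v u) = inverse (Re (trace (imS (A, hpoint w)))) *\<^sub>R imS (A, hpoint w)"
    "(A, hpoint w) \<in> domF" "hpoint (A *v u) \<in> CP1"
proof -
  define n where "n = trace (outer w)"
  have n: "n = complex_of_real ((norm w)\<^sup>2)" "n \<noteq> 0" using w by (simp_all add: n_def trace_outer)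
  have co: "hpoint z = cscale (1 / trace (outer z)) (transpose (outer z))" for z
    using arg_cong[OF transpose_hpoint[of z], of transpose] by (simp add: transpose_simps cscale_simps)
  have u0: "u \<noteq> 0" using w by (auto simp: u_def vec_eq_iff forall_2 vector_2)
  have Au: "A *v u \<noteq> 0"
  proof
    assume "A *v u = 0"
    then have "adj2 A *v (A *v u) = 0" by simp
    then show False using u0 by (simp add: matrix_vector_mul_assoc SL2C_adj2[OF A])
  qed
  \<comment> \<open>\<open>u\<close> and the conjugate of \<open>w\<close> are orthogonal and of
    equal norm, so the identity is the sum of the projections onto their lines.\<close>
  have R: "mat 1 - transpose (hpoint w) = cscale (1 / n) (transpose (outer u))"
  proof -
    have "mat 1 = cscale (1 / n) (cscale n (mat 1))" using n by (simp add: cscale_simps)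
    also have "cscale n (mat 1) = outer w + transpose (outer u)"
      by (simp add: mat2 n_def u_def vector_2)
    finally show ?thesis unfolding transpose_hpoint n_def[symmetric] by (simp add: cscale_simps)
  qed
  have o: "transpose (outer (A *v u)) = A ** transpose (outer u) ** dagger A"
    by (simp add: mat2 matrix_vector_mult_def sum_2 algebra_simps)
  have S: "imS (A, hpoint w) = cscale (1 / n) (transpose (outer (A *v u)))"
    unfolding imS_def fst_conv snd_conv R o by (simp add: cscale_simps)
  have "trace (transpose (outer (A *v u))) = trace (outer (A *v u))" by (simp add: trace2)
  then have t: "trace (imS (A, hpoint w)) = complex_of_real ((norm (A *v u))\<^sup>2 / (norm w)\<^sup>2)"
    unfolding S cscale_simps trace_outer n(1) by simp
  show "(A, hpoint w) \<in> domF" unfolding domF_def mem_Collect_eq t using w Au by simp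
  have "inverse (Re (trace (imS (A, hpoint w)))) *\<^sub>R imS (A, hpoint w) =
      cscale (of_real (inverse (Re (trace (imS (A, hpoint w)))))) (imS (A, hpoint w))"
    by (simp add: mat2_eq_iff) (simp add: scaleR_conv_of_real)
  also have "\<dots> = hpoint (A *v u)"
    unfolding t unfolding S unfolding co[of "A *v u"] trace_outer n(1) using w Au by (simp add: cscale_simps)
  finally show "hpoint (A *v u) = inverse (Re (trace (imS (A, hpoint w)))) *\<^sub>R imS (A, hpoint w)" ..
  show "hpoint (A *v u) \<in> CP1" using Au unfolding CP1_def by blast
qed

lemma Pi_Delta_SU2_eq:
  assumes "x \<in> SLCP"
  shows "Pi_Delta_SU2 x = PiF x" "x \<in> domF" "Pi_Delta_SU2 x \<in> H3 \<times> CP1"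
proof -
  obtain A w where x: "x = (A, hpoint w)" and w: "w \<noteq> 0" and A: "A \<in> SL2C"
    using assms by (auto simp: CP1_def)
  let ?u = "vector [w $ 2, - (w $ 1)] :: complex^2"
  have "w v* adj2 A \<noteq> 0"
  proof
    assume "w v* adj2 A = 0"
    then have "w v* adj2 A v* A = 0" by (simp add: vector_matrix_mult_0)
    then show False using w by (simp add: vector_matrix_mul_assoc SL2C_adj2[OF A])
  qed
  then have "iota (cp1_act (hpoint w) (matrix_inv A)) = hpoint (vector [(w v* adj2 A) $ 2, - ((w v* adj2 A) $ 1)])"
    using w by (simp add: cp1_act_hpoint SL2C_adj2(3)[OF A] iota_hpoint)
  also have "vector [(w v* adj2 A) $ 2, - ((w v* adj2 A) $ 1)] = A *v ?u"
    by (simp add: vec_eq_iff forall_2 vector_2 vector_matrix_mult_def matrix_vector_mult_def sum_2 algebra_simps)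
  finally have "Pi_Delta_SU2 x = (Pi_SU2 A, hpoint (A *v ?u))"
    by (simp add: Pi_Delta_SU2_def x)
  then show "Pi_Delta_SU2 x = PiF x" "x \<in> domF" "Pi_Delta_SU2 x \<in> H3 \<times> CP1"
    using hpoint_image[OF w A] Pi_SU2_H3[OF A] by (simp_all add: x PiF_def Pi_SU2_eq)
qed

definition P0 :: cmat where "P0 = hpoint (vector [0, 1])"

lemma transpose_P0: "transpose P0 = munit 2 2"
  by (simp add: P0_def transpose_hpoint mat2 vector_2)

lemma P0_CP1: "P0 \<in> CP1"
  unfolding P0_def CP1_def by (rule imageI) (simp add: vec_eq_iff forall_2 vector_2)

text \<open>At [0, 1] the vector u is (1, 0), and A u is the first column of \<open>A\<close>. Thus
  \<open>Pi_S1\<close> is \<open>Pi_Delta_SU2\<close> on the slice over \<open>P0\<close>.\<close>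

lemma Pi_S1_eq: "A \<in> SL2C \<Longrightarrow> Pi_S1 A = Pi_Delta_SU2 (A, P0)"
proof -
  assume A: "A \<in> SL2C"
  have w: "vector [0, 1] \<noteq> (0 :: complex^2)" by (simp add: vec_eq_iff forall_2 vector_2)
  have "A *v vector [(vector [0, 1] :: complex^2) $ 2, - ((vector [0, 1] :: complex^2) $ 1)] = vector [A $ 1 $ 1, A $ 2 $ 1]"
    by (simp add: vec_eq_iff forall_2 vector_2 matrix_vector_mult_def sum_2)
  with hpoint_image(1)[OF w A] have "Pi_B A = inverse (Re (trace (imS (A, P0)))) *\<^sub>R imS (A, P0)"
    by (simp add: Pi_B_def P0_def)
  then show ?thesis
    using Pi_Delta_SU2_eq(1)[of "(A, P0)"] A P0_CP1 by (simp add: Pi_S1_def PiF_def Pi_SU2_eq)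
qed

text \<open>These are the tangent vectors to the orbits of \<open>SU2\<close>.\<close>
lemma PiF'_orbit:
  assumes "dagger Z = - Z"
  shows "PiF' (A, P) (A ** Z, transpose (Z ** (mat 1 - transpose P) - (mat 1 - transpose P) ** Z)) = 0"
proof -
  let ?R = "mat 1 - transpose P"
  have "imS' (A, P) (A ** Z, transpose (Z ** ?R - ?R ** Z)) = 0"
    unfolding imS'_def fst_conv snd_conv transpose_simps assms
    by (simp add: matrix_ring_simps algebra_simps)
  moreover have "A ** dagger (A ** Z) + A ** Z ** dagger A = 0"
    unfolding transpose_simps assms by (simp add: matrix_ring_simps)
  ultimately show ?thesis
    unfolding PiF'_def by (simp add: linear_0[OF hinv_linear] trace2 zero_prod_def)
qed

text \<open>Invariance under \<open>C\<close>, whose action carries the slice over \<open>P0\<close>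
  to the slice over \<open>P\<close>. The derivative is taken along the slice, because a CP1
  component is first traded for an orbit direction.\<close>

lemma PiF_unitary:
  assumes C: "C \<in> SU2" and Q: "transpose P = dagger C ** (munit 2 2 ** C)"
  shows "PiF (B ** C, P) = PiF (B, P0)" "PiF' (B ** C, P) (V ** C, 0) = PiF' (B, P0) (V, 0)"
proof -
  have "mat 1 = dagger C ** (mat 1 ** C)" by (simp add: matrix_ring_simps(10) SU2_D[OF C])
  then have R: "mat 1 - transpose P = dagger C ** ((mat 1 - munit 2 2) ** C)"
    unfolding Q by (metis matrix_ring_simps(3,4))
  have t0: "transpose (0 :: cmat) = 0" by (simp add: transpose_simps)
  have S: "imS (B ** C, P) = imS (B, P0)" "imS' (B ** C, P) (V ** C, 0) = imS' (B, P0) (V, 0)"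
    unfolding imS_def imS'_def fst_conv snd_conv R transpose_P0 t0 transpose_simps
    by (simp_all only: matrix_ring_simps(7,8,11) minus_zero add_0 SU2_D[OF C])
  show "PiF (B ** C, P) = PiF (B, P0)" "PiF' (B ** C, P) (V ** C, 0) = PiF' (B, P0) (V, 0)"
    unfolding PiF_def PiF'_def S fst_conv snd_conv transpose_simps
    by (simp_all only: matrix_ring_simps(11) SU2_D[OF C])
qed

subsection \<open>Pullbacks\<close>

text \<open>On tangent vectors the derivative within \<open>M\<close> that \<open>pullback\<close>
  selects equals the derivative of any ambient extension.\<close>

lemma pullback_eq:
  assumes "\<And>x. x \<in> M \<Longrightarrow> f x = F x" "\<And>x. x \<in> M \<Longrightarrow> (F has_derivative F' x) (at x)"
  shows "pullback M f \<theta> = (\<lambda>x vs. if x \<in> M \<and> set vs \<subseteq> tangent M x then \<theta> (F x) (map (F' x) vs) else 0)"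
proof (intro ext)
  fix x vs
  have "map (frechet_derivative f (at x within M)) vs = map (F' x) vs" if x: "x \<in> M" and vs: "set vs \<subseteq> tangent M x"
  proof (rule map_cong[OF refl])
    fix v assume v: "v \<in> set vs"
    have D: "(f has_derivative F' x) (at x within M)"
      using has_derivative_transform[OF x assms(1) has_derivative_at_withinI[OF assms(2)[OF x]]] .
    then have "(f has_derivative frechet_derivative f (at x within M)) (at x within M)"
      using frechet_derivative_works unfolding differentiable_def by blast
    then show "frechet_derivative f (at x within M) v = F' x v"
      by (rule derivative_unique_on_tangent[OF _ D open_UNIV]) (use v vs in auto)
  qed
  then show "pullback M f \<theta> x vs = (if x \<in> M \<and> set vs \<subseteq> tangent M x then \<theta> (F x) (map (F' x) vs) else 0)"
    using assms(1) by (simp add: pullback_def del: map_eq_conv)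
qed

lemma forms_pullback:
  assumes \<theta>: "\<theta> \<in> forms N" and sub: "\<And>x. x \<in> M \<Longrightarrow> subspace (tangent M x)"
    and U: "open U" "M \<subseteq> U" and F: "smooth_on U F" "\<And>x. x \<in> M \<Longrightarrow> F x \<in> N"
    and D: "\<And>x. x \<in> U \<Longrightarrow> (F has_derivative F' x) (at x)"
  shows "(\<lambda>x vs. if x \<in> M \<and> set vs \<subseteq> tangent M x then \<theta> (F x) (map (F' x) vs) else 0) \<in> forms M"
proof -
  have "smooth_on U (\<lambda>x. F' x v)" for v
    by (rule smooth_on_cong[OF U(1) _ smooth_on_frechet_derivative[OF F(1), of v]])
       (use frechet_derivative_at[OF D] in metis)
  moreover have "F' x v \<in> tangent N (F x)" if "x \<in> M" "v \<in> tangent M x" for x v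
    by (rule derivative_tangent[OF has_derivative_at_withinI[OF D] _ that(2)]) (use that U F in auto)
  moreover have "F ` M \<subseteq> N" using F(2) by auto
  ultimately show ?thesis
    using forms_transport[OF \<theta> sub U F(1), of "[]" F'] has_derivative_linear[OF D]
    unfolding list.map(1) append_Nil by simp
qed

context
  fixes \<theta> :: "((real^4) \<times> cmat, real) form"
  assumes \<theta>: "\<theta> \<in> forms (H3 \<times> CP1)"
begin

lemma pullback_Delta:
  "pullback SLCP Pi_Delta_SU2 \<theta> =
    (\<lambda>x vs. if x \<in> SLCP \<and> set vs \<subseteq> tangent SLCP x then \<theta> (PiF x) (map (PiF' x) vs) else 0)"
  by (rule pullback_eq) (auto simp: Pi_Delta_SU2_eq intro!: PiF_derivative)

lemma pullback_S1:
  "pullback SL2C Pi_S1 \<theta> = (\<lambda>A Vs. if A \<in> SL2C \<and> set Vs \<subseteq> tangent SL2C A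
    then \<theta> (PiF (A, P0)) (map (\<lambda>V. PiF' (A, P0) (V, 0)) Vs) else 0)"
proof (rule pullback_eq[where F = "\<lambda>A. PiF (A, P0)"])
  fix A assume A: "A \<in> SL2C"
  then have x: "(A, P0) \<in> SLCP" using P0_CP1 by simp
  show "Pi_S1 A = PiF (A, P0)" using Pi_S1_eq[OF A] Pi_Delta_SU2_eq(1)[OF x] by simp
  have "((\<lambda>A. (A, P0)) has_derivative (\<lambda>V. (V, 0))) (at A)"
    by (intro has_derivative_Pair has_derivative_ident has_derivative_const)
  from diff_chain_at[OF this PiF_derivative[OF Pi_Delta_SU2_eq(2)[OF x]]]
  show "((\<lambda>A. PiF (A, P0)) has_derivative (\<lambda>V. PiF' (A, P0) (V, 0))) (at A)"
    by (simp add: o_def)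
qed

lemma forms_pullback_Delta: "pullback SLCP Pi_Delta_SU2 \<theta> \<in> forms SLCP"
  unfolding pullback_Delta
proof (rule forms_pullback[OF \<theta> SLCP.subspace_tangent open_domF _ smooth_PiF _ PiF_derivative])
  show "SLCP \<subseteq> domF" using Pi_Delta_SU2_eq(2) by blast
  show "PiF x \<in> H3 \<times> CP1" if "x \<in> SLCP" for x
    using Pi_Delta_SU2_eq(1,3)[OF that] by simp
qed

lemma forms_pullback_S1: "pullback SL2C Pi_S1 \<theta> \<in> forms SL2C"
  unfolding pullback_S1
proof (rule forms_pullback[OF \<theta> SL2C.subspace_tangent, where U = "(\<lambda>A. (A, P0)) -` domF"])
  have sm: "smooth_on UNIV (\<lambda>A. (A, P0))" by (intro smooth_on_cmat open_UNIV)
  have "continuous_on UNIV (\<lambda>A :: cmat. (A, P0))" by (intro continuous_intros)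
  then show U: "open ((\<lambda>A. (A, P0)) -` domF)" using open_domF open_vimage by blast
  show "SL2C \<subseteq> (\<lambda>A. (A, P0)) -` domF" using Pi_Delta_SU2_eq(2) P0_CP1 by auto
  show "smooth_on ((\<lambda>A. (A, P0)) -` domF) (\<lambda>A. PiF (A, P0))"
    by (rule smooth_on_compose[OF U open_domF _ smooth_on_subset[OF sm] smooth_PiF]) auto
  show "PiF (A, P0) \<in> H3 \<times> CP1" if "A \<in> SL2C" for A
    using Pi_Delta_SU2_eq(1,3)[of "(A, P0)"] that P0_CP1 by simp
  show "((\<lambda>A. PiF (A, P0)) has_derivative (\<lambda>V. PiF' (A, P0) (V, 0))) (at A)"
    if "A \<in> (\<lambda>A. (A, P0)) -` domF" for A
  proof -
    have "((\<lambda>A. (A, P0)) has_derivative (\<lambda>V. (V, 0))) (at A)"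
      by (intro has_derivative_Pair has_derivative_ident has_derivative_const)
    from diff_chain_at[OF this PiF_derivative[of "(A, P0)"]] that show ?thesis by (simp add: o_def)
  qed
qed

text \<open>The circle direction consists of imaginary multiples of
  \<open>munit 1 1 - munit 2 2\<close>. These are anti-Hermitian and commute with the transpose of
  \<open>P0\<close>, so they are orbit directions without CP1 component, and \<open>PiF'\<close>
  kills them.\<close>

lemma factors_through_pullback_S1: "factors_through SL2C pB (pullback SL2C Pi_S1 \<theta>)"
  unfolding factors_through_def
proof (intro ballI allI impI)
  fix A Vs assume A: "A \<in> SL2C" and Vs: "set Vs \<subseteq> tangent SL2C A"
  have lin: "linear (PiF' (A, P0))"
    using PiF'_linear Pi_Delta_SU2_eq(2)[of "(A, P0)"] A P0_CP1 by simp
  have "PiF' (A, P0) (pB A V, 0) = PiF' (A, P0) (V, 0)" if V: "V \<in> tangent SL2C A" for V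
  proof -
    let ?Y = "adj2 A ** V"
    define Z where "Z = cscale (\<i> * of_real (Im (?Y $ 1 $ 1))) (munit 1 1 - munit 2 2)"
    have tr: "?Y $ 2 $ 2 = - ?Y $ 1 $ 1"
      using V unfolding tangent_SL2C[OF A] by (simp add: trace2 eq_neg_iff_add_eq_0 add.commute)
    have "dagger Z = - Z" by (simp add: Z_def mat2_eq_iff)
    moreover have "Z ** (mat 1 - transpose P0) - (mat 1 - transpose P0) ** Z = 0"
      unfolding transpose_P0 Z_def by (simp add: mat2)
    ultimately have "PiF' (A, P0) (A ** Z, 0) = 0"
      using PiF'_orbit[of Z A P0] by (simp add: transpose_simps)
    moreover have "?Y = ps ?Y + Z"
      by (simp add: ps_def Z_def mat2_eq_iff tr complex_eq_iff)
    then have "V = pB A V + A ** Z"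
      unfolding pB_def matrix_ring_simps(1)[symmetric] by (metis SL2C_adj2(5)[OF A])
    ultimately show ?thesis
      using linear_add[OF lin, of "(pB A V, 0)" "(A ** Z, 0)"] by simp
  qed
  then have "map (\<lambda>V. PiF' (A, P0) (V, 0)) (map (pB A) Vs) = map (\<lambda>V. PiF' (A, P0) (V, 0)) Vs"
    using subsetD[OF Vs] by simp
  moreover have "set (map (pB A) Vs) \<subseteq> tangent SL2C A" using B.p_tangent[OF A] by auto
  ultimately show "pullback SL2C Pi_S1 \<theta> A (map (pB A) Vs) = pullback SL2C Pi_S1 \<theta> A Vs"
    unfolding pullback_S1 using A Vs by (simp del: map_map map_eq_conv)
qed

text \<open>In the coframe of the second system this matrix has w = y and u = - cnj z, so both
  complex structures multiply \<open>y\<close> and \<open>cnj z\<close> by \<i>.\<close>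

definition yB :: "complex \<Rightarrow> complex \<Rightarrow> cmat" where
  "yB y z = cscale (y + z) (munit 1 2) + cscale (- cnj z) (munit 2 1)"

text \<open>Up to an orbit direction, \<open>vecD A C y z\<close> is left translation by the conjugate of \<open>yB y z\<close>.\<close>
lemma pullback_vecD:
  assumes f: "adapted_frame A P C"
  shows "pullback SLCP Pi_Delta_SU2 \<theta> (A, P) (map (\<lambda>(y, z). vecD A C y z) l) =
    pullback SL2C Pi_S1 \<theta> (A ** dagger C) (map (\<lambda>(y, z). (A ** dagger C) ** yB y z) l)"
proof -
  interpret adapted_frame A P C by (rule f)
  let ?A = "A ** dagger C"
  have "det (dagger C) * det C = 1" using SU2_D(2)[OF C] by (metis det_I det_mul)
  moreover have "det C = 1" using SU2_D(7)[OF C] by (simp add: SL2C_def)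
  ultimately have A': "?A \<in> SL2C" using A by (simp add: SL2C_def det_mul)
  have AC: "?A ** C = A" by (simp add: matrix_ring_simps SU2_D[OF C])
  have lin: "linear (PiF' (A, P))" using PiF'_linear Pi_Delta_SU2_eq(2)[OF point] by simp
  have v: "PiF' (A, P) (vecD A C y z) = PiF' (?A, P0) (?A ** yB y z, 0)" for y z
  proof -
    \<comment> \<open>\<open>N\<close> is the anti-Hermitian matrix whose commutator with
      \<open>munit 1 1\<close> reproduces the CP1 component of \<open>vecD A C y z\<close> in the
      frame. Subtracting this orbit direction leaves a vector along \<open>SL2C\<close> alone, given
      by \<open>cscale y (munit 1 2) - N = yB y z\<close>.\<close>
    define N where "N = cscale (- z) (munit 1 2) + cscale (cnj z) (munit 2 1)"
    define Z where "Z = dagger C ** (N ** C)"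
    have "dagger N = - N" by (simp add: N_def mat2_eq_iff)
    then have "dagger Z = - Z"
      unfolding Z_def transpose_simps by (simp add: matrix_ring_simps)
    then have 0: "PiF' (A, P) (A ** Z, transpose (Z ** (mat 1 - transpose P) - (mat 1 - transpose P) ** Z)) = 0"
      by (rule PiF'_orbit)
    have "Z ** (mat 1 - transpose P) - (mat 1 - transpose P) ** Z = dagger C ** ((N ** munit 1 1 - munit 1 1 ** N) ** C)"
      unfolding Z_def Q' by (simp add: matrix_ring_simps SU2_D[OF C])
    also have "N ** munit 1 1 - munit 1 1 ** N = cscale z (munit 1 2) + cscale (cnj z) (munit 2 1)"
      by (simp add: N_def mat2)
    finally have 1: "transpose (Z ** (mat 1 - transpose P) - (mat 1 - transpose P) ** Z) = snd (vecD A C y z)"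
      unfolding vecD_def by simp
    have "cscale y (munit 1 2) = yB y z + N" by (simp add: yB_def N_def mat2_eq_iff)
    then have e: "vecD A C y z = (?A ** yB y z ** C, 0) + (A ** Z, snd (vecD A C y z))"
      unfolding vecD_def Z_def by (simp add: matrix_ring_simps)
    have "PiF' (A, P) (vecD A C y z) = PiF' (A, P) ((?A ** yB y z ** C, 0) + (A ** Z, snd (vecD A C y z)))"
      by (rule arg_cong[OF e])
    also have "\<dots> = PiF' (A, P) (?A ** yB y z ** C, 0)"
      using 0 unfolding 1 linear_add[OF lin] by simp
    also have "\<dots> = PiF' (?A ** C, P) (?A ** yB y z ** C, 0)" unfolding AC ..
    also have "\<dots> = PiF' (?A, P0) (?A ** yB y z, 0)" by (rule PiF_unitary(2)[OF C Q])
    finally show ?thesis .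
  qed
  have F: "PiF (A, P) = PiF (?A, P0)" using PiF_unitary(1)[OF C Q, of ?A] unfolding AC .
  have T: "?A ** yB y z \<in> tangent SL2C ?A" for y z
    unfolding tangent_SL2C[OF A'] by (simp add: SL2C_adj2[OF A'], simp add: yB_def trace2)
  have "set (map (\<lambda>(y, z). vecD A C y z) l) \<subseteq> tangent SLCP (A, P)" using vecD_tangent by auto
  moreover have "set (map (\<lambda>(y, z). ?A ** yB y z) l) \<subseteq> tangent SL2C ?A" using T by auto
  moreover have "map (PiF' (A, P)) (map (\<lambda>(y, z). vecD A C y z) l) =
      map (\<lambda>V. PiF' (?A, P0) (V, 0)) (map (\<lambda>(y, z). ?A ** yB y z) l)"
    by (simp add: v split_beta)
  ultimately show ?thesis
    unfolding pullback_Delta pullback_S1 F using point A' by (simp del: map_map)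
qed

lemma yB_simps:
  assumes "A \<in> SL2C"
  shows "dB A (A ** yB y z) = A ** yB y z" "JB A (A ** yB y z) = A ** yB (\<i> * y) (- \<i> * z)"
  using assms
  by (simp_all add: dB_def JB_def SL2C_adj2) (simp_all add: yB_def off_def jj_def mat2_eq_iff algebra_simps)

text \<open>At a point with frame \<open>C\<close> the values on the first distribution are those on
  the second at \<open>A ** dagger C\<close>; every point of \<open>SL2C\<close> arises in this way
  from the slice over \<open>P0\<close>, with frame \<open>mat 1\<close>.\<close>

lemma pointwise_cond_pullbacks:
  "pointwise_cond SLCP dE JE (pullback SLCP Pi_Delta_SU2 \<theta>) \<longleftrightarrow>
    pointwise_cond SL2C dB JB (pullback SL2C Pi_S1 \<theta>)"
proof
  assume E: "pointwise_cond SLCP dE JE (pullback SLCP Pi_Delta_SU2 \<theta>)"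
  show "pointwise_cond SL2C dB JB (pullback SL2C Pi_S1 \<theta>)"
    unfolding pointwise_cond_def
  proof (intro ballI conjI allI)
    fix A V W assume A: "A \<in> SL2C"
    have "mat 1 \<in> SU2" by (simp add: SU2_def SL2C_def dagger_mat1)
    then interpret adapted_frame A P0 "mat 1"
      by unfold_locales (simp_all add: A P0_CP1 transpose_P0 transpose_simps matrix_ring_simps)
    note pv = pullback_vecD[OF adapted_frame_axioms, unfolded transpose_simps matrix_ring_simps]
    have ex: "\<exists>y z. dB A V = A ** yB y z" for V
    proof (intro exI)
      show "dB A V = A ** yB ((adj2 A ** V) $ 1 $ 2 + cnj ((adj2 A ** V) $ 2 $ 1)) (- cnj ((adj2 A ** V) $ 2 $ 1))"
        by (simp add: dB_def off_def yB_def)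
    qed
    obtain y1 z1 y2 z2 where V: "dB A V = A ** yB y1 z1" and W: "dB A W = A ** yB y2 z2"
      using ex by metis
    have c: "pullback SLCP Pi_Delta_SU2 \<theta> (A, P0) [] = 0"
      "pullback SLCP Pi_Delta_SU2 \<theta> (A, P0) [dE (A, P0) v] = 0"
      "pullback SLCP Pi_Delta_SU2 \<theta> (A, P0) [JE (A, P0) (dE (A, P0) v), dE (A, P0) w] =
        pullback SLCP Pi_Delta_SU2 \<theta> (A, P0) [dE (A, P0) v, JE (A, P0) (dE (A, P0) w)]" for v w
      using E point unfolding pointwise_cond_def by blast+
    show "pullback SL2C Pi_S1 \<theta> A [] = 0"
      using c(1) pv[of "[]"] by simp
    show "pullback SL2C Pi_S1 \<theta> A [dB A V] = 0"
      using c(2)[of "vecD A (mat 1) y1 z1"] pv[of "[(y1, z1)]"] by (simp add: V dE_vecD)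
    show "pullback SL2C Pi_S1 \<theta> A [JB A (dB A V), dB A W] = pullback SL2C Pi_S1 \<theta> A [dB A V, JB A (dB A W)]"
      using c(3)[of "vecD A (mat 1) y1 z1" "vecD A (mat 1) y2 z2"]
        pv[of "[(\<i> * y1, - \<i> * z1), (y2, z2)]"] pv[of "[(y1, z1), (\<i> * y2, - \<i> * z2)]"]
      unfolding V W yB_simps[OF A] dE_vecD JE_vecD by simp
  qed
next
  assume B: "pointwise_cond SL2C dB JB (pullback SL2C Pi_S1 \<theta>)"
  show "pointwise_cond SLCP dE JE (pullback SLCP Pi_Delta_SU2 \<theta>)"
    unfolding pointwise_cond_def
  proof (intro ballI conjI allI)
    fix x v w assume x: "x \<in> SLCP"
    obtain A P p q C where xAP: "x = (A, P)" and f: "adapted_frame A P C" by (rule adapted_frameE[OF x])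
    interpret adapted_frame A P C by (rule f)
    note pv = pullback_vecD[OF f]
    let ?A = "A ** dagger C"
    have "det (dagger C) * det C = 1" using SU2_D(2)[OF C] by (metis det_I det_mul)
    moreover have "det C = 1" using SU2_D(7)[OF C] by (simp add: SL2C_def)
    ultimately have A': "?A \<in> SL2C" using A by (simp add: SL2C_def det_mul)
    obtain y1 z1 y2 z2 where v: "dE x v = vecD A C y1 z1" and w: "dE x w = vecD A C y2 z2"
      using ex_vecD xAP by metis
    have c: "pullback SL2C Pi_S1 \<theta> ?A [] = 0" "pullback SL2C Pi_S1 \<theta> ?A [dB ?A V] = 0"
      "pullback SL2C Pi_S1 \<theta> ?A [JB ?A (dB ?A V), dB ?A W] = pullback SL2C Pi_S1 \<theta> ?A [dB ?A V, JB ?A (dB ?A W)]" for V W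
      using B A' unfolding pointwise_cond_def by blast+
    show "pullback SLCP Pi_Delta_SU2 \<theta> x [] = 0"
      using c(1) pv[of "[]"] by (simp add: xAP)
    show "pullback SLCP Pi_Delta_SU2 \<theta> x [dE x v] = 0"
      using c(2)[of "?A ** yB y1 z1"] pv[of "[(y1, z1)]"] unfolding v unfolding yB_simps[OF A'] xAP by simp
    show "pullback SLCP Pi_Delta_SU2 \<theta> x [JE x (dE x v), dE x w] = pullback SLCP Pi_Delta_SU2 \<theta> x [dE x v, JE x (dE x w)]"
      using c(3)[of "?A ** yB y1 z1" "?A ** yB y2 z2"]
        pv[of "[(\<i> * y1, - \<i> * z1), (y2, z2)]"] pv[of "[(y1, z1), (\<i> * y2, - \<i> * z2)]"]
      unfolding v w unfolding xAP yB_simps[OF A'] JE_vecD by simp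
  qed
qed

end

theorem theorem4p1:
  shows "quotient_EDS (SL2C \<times> CP1) Pi_Delta_SU2 (H3 \<times> CP1) E_system = M_CMC"
  unfolding M_CMC_def quotient_EDS_def
  using E_system_iff[OF forms_pullback_Delta] B_system_iff[OF forms_pullback_S1 factors_through_pullback_S1]
    pointwise_cond_pullbacks
  by blast

end
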